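(* Let $\mathbf{k}$ be a field of characteristic $p>0$, and fix integers $m\ge 2$ and $n\ge 5$. Fix a monomial ordering on the monomials in $x_1,\dots,x_n$ with $x_1\succ\cdots\succ x_n$. Then $\mathbf{k}[x_1,\dots,x_n]/(x_1^m,\dots,x_n^m)$ has the weak Lefschetz property if and only if the ideal $(x_1^m,\dots,x_n^m,\,x_1+\cdots+x_n)\subseteq\mathbf{k}[x_1,\dots,x_n]$ has the same initial ideal (i.e. the same set of initial monomials) as the ideal given by the same generators when $\mathbf{k}$ is replaced by a field of characteristic zero.
   Context: A standard graded Artinian algebra $A=\mathbf{k}[x_1,\dots,x_n]/I$ ($I$ homogeneous) has the weak Lefschetz property if there is a linear form $\ell$ such that all multiplication maps $A_d\to A_{d+1}$, $f\mapsto\ell f$, $d\ge 0$, have maximal rank (i.e. are injective or surjective). If $I$ is a monomial ideal it suffices to consider $\ell=x_1+\cdots+x_n$. The initial ideal of an ideal is the ideal generated by the leading monomials of its nonzero elements. *)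

theory Defs
  imports
    "HOL-Library.Poly_Mapping"
    "HOL-Computational_Algebra.Computational_Algebra"
    "HOL-Algebra.QuotRing"
begin

text \<open>
  A monomial is its exponent vector, a finitely supported function on the indices of the
  variables; a polynomial is a finitely supported function from monomials to coefficients, with
  the convolution product of \<^theory>\<open>HOL-Library.Poly_Mapping\<close>. Variables are indexed by \<^typ>\<open>nat\<close>;
  the polynomial ring in $x_1, \dots, x_n$ consists of the polynomials that involve only
  variables with index in \<^term>\<open>{1..n}\<close>.
\<close>

type_synonym monomial = "nat \<Rightarrow>\<^sub>0 nat"

type_synonym 'a mpoly = "monomial \<Rightarrow>\<^sub>0 'a"

definition monomials :: "nat \<Rightarrow> monomial set"
  where "monomials n = {t. Poly_Mapping.keys t \<subseteq> {1..n}}"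

definition monom_degree :: "monomial \<Rightarrow> nat"
  where "monom_degree t = (\<Sum>i\<in>Poly_Mapping.keys t. Poly_Mapping.lookup t i)"

definition mpoly_ring :: "nat \<Rightarrow> 'a::comm_ring_1 mpoly ring"
  where "mpoly_ring n =
    \<lparr>carrier = {f. Poly_Mapping.keys f \<subseteq> monomials n}, mult = (*), one = 1, zero = 0, add = (+)\<rparr>"

definition Var :: "nat \<Rightarrow> 'a::comm_ring_1 mpoly"
  where "Var i = Poly_Mapping.single (Poly_Mapping.single i 1) 1"

definition homogeneous :: "nat \<Rightarrow> nat \<Rightarrow> 'a::comm_ring_1 mpoly set"
  where "homogeneous n d = {f \<in> carrier (mpoly_ring n). \<forall>t\<in>Poly_Mapping.keys f. monom_degree t = d}"

text \<open>The component $A_d$ of $A = k[x_1,\dots,x_n]/I$; this is a grading only for homogeneous \<open>I\<close>.\<close>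

definition quot_component :: "nat \<Rightarrow> 'a::comm_ring_1 mpoly set \<Rightarrow> nat \<Rightarrow> 'a mpoly set set"
  where "quot_component n I d = (\<lambda>f. I +>\<^bsub>mpoly_ring n\<^esub> f) ` homogeneous n d"

definition weak_lefschetz_property :: "nat \<Rightarrow> 'a::field mpoly set \<Rightarrow> bool"
  where "weak_lefschetz_property n I \<longleftrightarrow>
    (\<exists>l\<in>homogeneous n 1. \<forall>d.
      let \<mu> = (\<lambda>a. (I +>\<^bsub>mpoly_ring n\<^esub> l) \<otimes>\<^bsub>mpoly_ring n Quot I\<^esub> a) in
        inj_on \<mu> (quot_component n I d) \<or>
        \<mu> ` quot_component n I d = quot_component n I (d + 1))"

definition monomial_ordering :: "nat \<Rightarrow> monomial rel \<Rightarrow> bool"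
  where "monomial_ordering n r \<longleftrightarrow>
    well_order_on (monomials n) r \<and>
    (\<forall>s t. \<forall>u\<in>monomials n. (s, t) \<in> r \<longrightarrow> (s + u, t + u) \<in> r)"

definition leading_monomial :: "monomial rel \<Rightarrow> 'a::zero mpoly \<Rightarrow> monomial"
  where "leading_monomial r f = (THE t. t \<in> Poly_Mapping.keys f \<and> (\<forall>s\<in>Poly_Mapping.keys f. (s, t) \<in> r))"

definition initial_ideal :: "nat \<Rightarrow> monomial rel \<Rightarrow> 'a::field mpoly set \<Rightarrow> 'a mpoly set"
  where "initial_ideal n r I =
    Idl\<^bsub>mpoly_ring n\<^esub> {Poly_Mapping.single (leading_monomial r f) 1 |f. f \<in> I \<and> f \<noteq> 0}"

text \<open>
  Monomial ideals over different coefficient fields are compared through the monomials they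
  contain. By \<open>monomials_in_initial_ideal\<close> below, for an initial ideal these are exactly the
  leading monomials of the nonzero elements of the original ideal.
\<close>

definition monomials_in :: "nat \<Rightarrow> 'a::field mpoly set \<Rightarrow> monomial set"
  where "monomials_in n J = {t \<in> monomials n. Poly_Mapping.single t 1 \<in> J}"

lemma zero_in_monomials: "0 \<in> monomials n"
  by (simp add: monomials_def)

lemma add_in_monomials: "s \<in> monomials n \<Longrightarrow> t \<in> monomials n \<Longrightarrow> s + t \<in> monomials n"
  using Poly_Mapping.keys_add[of s t] by (auto simp: monomials_def)

lemma keys_mult_subset:
  assumes "\<And>s t. s \<in> Poly_Mapping.keys f \<Longrightarrow> t \<in> Poly_Mapping.keys g \<Longrightarrow> s + t \<in> A"
  shows "Poly_Mapping.keys (f * g) \<subseteq> A"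
  using keys_mult[of f g] assms by fastforce

lemma mpoly_ring_simps [simp]:
  "carrier (mpoly_ring n) = {f. Poly_Mapping.keys f \<subseteq> monomials n}"
  "f \<otimes>\<^bsub>mpoly_ring n\<^esub> g = f * g" "f \<oplus>\<^bsub>mpoly_ring n\<^esub> g = f + g"
  "\<one>\<^bsub>mpoly_ring n\<^esub> = 1" "\<zero>\<^bsub>mpoly_ring n\<^esub> = 0"
  by (simp_all add: mpoly_ring_def)

lemma cring_mpoly_ring: "cring (mpoly_ring n :: 'a::comm_ring_1 mpoly ring)"
proof (rule cringI)
  show "abelian_group (mpoly_ring n :: 'a mpoly ring)"
  proof (rule abelian_groupI, goal_cases)
    case (1 x y)
    then show ?case using Poly_Mapping.keys_add[of x y] by auto
  next
    case (6 x)
    have "Poly_Mapping.keys (- x) = Poly_Mapping.keys x"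
      by (auto simp: in_keys_iff)
    with 6 show ?case by (intro bexI[of _ "- x"]) auto
  qed (auto simp: algebra_simps)
next
  show "comm_monoid (mpoly_ring n :: 'a mpoly ring)"
  proof (rule comm_monoidI, goal_cases)
    case (1 x y)
    then have "Poly_Mapping.keys (x * y) \<subseteq> monomials n"
      by (intro keys_mult_subset add_in_monomials) auto
    then show ?case by simp
  qed (auto simp: algebra_simps zero_in_monomials)
qed (auto simp: algebra_simps)

lemma leading_monomial_eqI:
  assumes "monomial_ordering n r" "t \<in> Poly_Mapping.keys f" "\<And>s. s \<in> Poly_Mapping.keys f \<Longrightarrow> (s, t) \<in> r"
  shows "leading_monomial r f = t"
proof -
  have "antisym r"
    using assms(1) by (simp add: monomial_ordering_def order_on_defs)
  then show ?thesis
    unfolding leading_monomial_def using assms(2,3)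
    by (intro the_equality) (auto dest: antisymD)
qed

lemma leading_monomial:
  assumes ord: "monomial_ordering n r" and f: "Poly_Mapping.keys f \<subseteq> monomials n" "f \<noteq> 0"
  shows "leading_monomial r f \<in> Poly_Mapping.keys f"
    and "\<And>s. s \<in> Poly_Mapping.keys f \<Longrightarrow> (s, leading_monomial r f) \<in> r"
proof -
  have lin: "linear_order_on (monomials n) r"
    using ord by (simp add: monomial_ordering_def well_order_on_def)
  have "\<exists>t\<in>S. \<forall>s\<in>S. (s, t) \<in> r" if "finite S" "S \<noteq> {}" "S \<subseteq> monomials n" for S
    using that
  proof (induction rule: finite_ne_induct)
    case (singleton x)
    then show ?case using lin by (auto simp: order_on_defs refl_on_def)
  next
    case (insert x F)
    then obtain t where t: "t \<in> F" "\<forall>s\<in>F. (s, t) \<in> r" by auto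
    have refl: "(x, x) \<in> r" and "x \<noteq> t"
      using lin insert t by (auto simp: order_on_defs refl_on_def)
    then consider "(x, t) \<in> r" | "(t, x) \<in> r"
      using lin insert.prems t(1) by (auto simp: order_on_defs total_on_def)
    then show ?case
    proof cases
      case 1
      with t show ?thesis by auto
    next
      case 2
      have "trans r" using lin by (simp add: order_on_defs)
      with 2 t refl have "\<forall>s\<in>insert x F. (s, x) \<in> r" by (blast dest: transD)
      then show ?thesis by blast
    qed
  qed
  from this[of "Poly_Mapping.keys f"] f obtain t where t: "t \<in> Poly_Mapping.keys f" "\<And>s. s \<in> Poly_Mapping.keys f \<Longrightarrow> (s, t) \<in> r"
    by auto
  with leading_monomial_eqI[OF ord t] show
    "leading_monomial r f \<in> Poly_Mapping.keys f" "\<And>s. s \<in> Poly_Mapping.keys f \<Longrightarrow> (s, leading_monomial r f) \<in> r"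
    by auto
qed

lemma keys_single_mult:
  "Poly_Mapping.keys (Poly_Mapping.single u 1 * f) = (\<lambda>s. s + u) ` Poly_Mapping.keys (f :: 'a::comm_ring_1 mpoly)"
proof -
  have "Poly_Mapping.lookup (Poly_Mapping.single u 1 * f) (u + s) = Poly_Mapping.lookup f s" for s
    by (simp add: lookup_mult lookup_single when_mult)
  moreover have "Poly_Mapping.keys (Poly_Mapping.single u 1 * f) \<subseteq> (\<lambda>s. s + u) ` Poly_Mapping.keys f"
    by (rule keys_mult_subset) (auto simp: add.commute split: if_splits)
  ultimately show ?thesis
    by (auto simp: in_keys_iff add.commute)
qed

lemma monomials_in_initial_ideal:
  fixes I :: "'a::field mpoly set"
  assumes ord: "monomial_ordering n r" and I: "ideal I (mpoly_ring n)"
  shows "monomials_in n (initial_ideal n r I) = leading_monomial r ` (I - {0})"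
proof -
  define L where "L = leading_monomial r ` (I - {0})"
  interpret R: cring "mpoly_ring n :: 'a mpoly ring" by (rule cring_mpoly_ring)
  interpret I: ideal I "mpoly_ring n" by (rule I)
  have sub: "Poly_Mapping.keys f \<subseteq> monomials n" if "f \<in> I" for f
    using I.a_subset that by auto
  have L: "L \<subseteq> monomials n"
    using leading_monomial(1)[OF ord sub] sub by (fastforce simp: L_def)
  have L_add: "u + t \<in> L" if "t \<in> L" "u \<in> monomials n" for t u
  proof -
    from that obtain f where f: "f \<in> I" "f \<noteq> 0" "t = leading_monomial r f"
      by (auto simp: L_def)
    define g where "g = Poly_Mapping.single u 1 * f"
    have t: "t \<in> Poly_Mapping.keys f" "\<And>s. s \<in> Poly_Mapping.keys f \<Longrightarrow> (s, t) \<in> r"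
      using leading_monomial[OF ord sub[OF f(1)] f(2)] f(3) by auto
    have "g \<in> I"
      using I.I_l_closed[OF f(1), of "Poly_Mapping.single u 1"] that by (simp add: g_def)
    moreover have keys_g: "Poly_Mapping.keys g = (\<lambda>s. s + u) ` Poly_Mapping.keys f"
      by (simp add: g_def keys_single_mult)
    moreover have "leading_monomial r g = t + u"
      by (rule leading_monomial_eqI[OF ord])
        (use t keys_g ord that in \<open>auto simp: monomial_ordering_def\<close>)
    moreover have "g \<noteq> 0" using keys_g t by auto
    ultimately show ?thesis by (force simp: L_def add.commute)
  qed
  have "ideal {f :: 'a mpoly. Poly_Mapping.keys f \<subseteq> L} (mpoly_ring n)"
  proof (rule idealI)
    show "subgroup {f :: 'a mpoly. Poly_Mapping.keys f \<subseteq> L} (add_monoid (mpoly_ring n))"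
    proof (rule R.add.subgroupI)
      fix a :: "'a mpoly" assume a: "a \<in> {f. Poly_Mapping.keys f \<subseteq> L}"
      have "Poly_Mapping.keys (- a) = Poly_Mapping.keys a" by (auto simp: in_keys_iff)
      moreover have "\<ominus>\<^bsub>mpoly_ring n\<^esub> a = - a"
        using a L \<open>Poly_Mapping.keys (- a) = Poly_Mapping.keys a\<close> by (intro R.minus_equality) auto
      ultimately show "\<ominus>\<^bsub>mpoly_ring n\<^esub> a \<in> {f. Poly_Mapping.keys f \<subseteq> L}" using a by simp
    next
      fix a b :: "'a mpoly" assume "a \<in> {f. Poly_Mapping.keys f \<subseteq> L}" "b \<in> {f. Poly_Mapping.keys f \<subseteq> L}"
      then show "a \<oplus>\<^bsub>mpoly_ring n\<^esub> b \<in> {f. Poly_Mapping.keys f \<subseteq> L}"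
        using Poly_Mapping.keys_add[of a b] by auto
    qed (use L in \<open>auto intro: exI[of _ 0]\<close>)
  next
    fix a x :: "'a mpoly"
    assume a: "a \<in> {f. Poly_Mapping.keys f \<subseteq> L}" and x: "x \<in> carrier (mpoly_ring n)"
    have "Poly_Mapping.keys (x * a) \<subseteq> L"
      by (rule keys_mult_subset) (use a x L_add in auto)
    then show "x \<otimes>\<^bsub>mpoly_ring n\<^esub> a \<in> {f. Poly_Mapping.keys f \<subseteq> L}" "a \<otimes>\<^bsub>mpoly_ring n\<^esub> x \<in> {f. Poly_Mapping.keys f \<subseteq> L}"
      by (simp_all add: mult.commute)
  qed (rule R.ring_axioms)
  then have "initial_ideal n r I \<subseteq> {f. Poly_Mapping.keys f \<subseteq> L}"
    unfolding initial_ideal_def by (rule R.genideal_minimal) (auto simp: L_def)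
  moreover have "Poly_Mapping.single t 1 \<in> initial_ideal n r I" if "t \<in> L" for t
  proof -
    have "{Poly_Mapping.single (leading_monomial r f) (1::'a) |f. f \<in> I \<and> f \<noteq> 0}
        \<subseteq> initial_ideal n r I"
      unfolding initial_ideal_def
      by (rule R.genideal_self) (use L in \<open>auto simp: L_def\<close>)
    then show ?thesis using that by (auto simp: L_def)
  qed
  ultimately have "monomials_in n (initial_ideal n r I) = L"
    using L by (auto simp: monomials_in_def)
  then show ?thesis by (simp add: L_def)
qed

end

theory Submission
  imports Defs
begin

text \<open>
  Let \<open>A\<^sub>d\<close> be the span of the monomials of degree \<open>d\<close> with all exponents below \<open>m\<close> and let \<open>U\<^sub>d\<close> be
  the image of \<open>A\<^sub>d\<close> in \<open>A\<^sub>d\<^sub>+\<^sub>1\<close> under multiplication by the sum of the variables. The initial ideal is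
  determined by the leading monomials of the \<open>U\<^sub>d\<close>, whose number is the rank of that multiplication.
  If all \<open>k < m\<close> are invertible, products of differences \<open>x\<^sub>i - x\<^sub>j\<close> provide elements of
  the inverse system that show that no ballot monomial is a leading monomial, and a Clebsch-Gordan
  recursion shows that there are exactly as many ballot monomials as the weak Lefschetz property
  leaves standard monomials. Hence the weak Lefschetz property determines the leading monomials
  independently of the field. In characteristic zero it holds by \<open>sl\<^sub>2\<close>-theory. In
  characteristic \<open>p < m\<close> it fails for \<open>n \<ge> 5\<close>: for a suitable power \<open>q\<close> of \<open>p\<close>, a middle degree
  element killed by a linear form in the \<open>q\<close>-th powers of the variables yields an element of the
  kernel in too low a degree.
\<close>

section \<open>Polynomials as vectors and their leading monomials\<close>

text \<open>No Groebner basis is computed: excluding the ballot monomials gives one inclusion and a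
  dimension count does the rest, so the ordering enters only through compatibility with products and
  x_1 > ... > x_n. The exponent bounds form a function \<open>M\<close> rather than the single
  number m because the Frobenius argument needs mixed bounds: after the substitution of q-th powers
  the variables keep the bounds k + 1 or k + 2, distributed so that the socle degree is even and
  there is a middle degree. The degree count in that argument is where n \<ge> 5 enters. Passing
  from the q-th power of the form back to the form itself may cost q - 1 degrees, and the kernel
  element found must still lie below half of n * (m - 1). Each variable contributes to the gain, and
  five of them suffice once q is chosen well; p = 2 and p = 3 need higher powers of p and some
  separate cases.\<close>

abbreviation (input) lookup where "lookup \<equiv> Poly_Mapping.lookup"
abbreviation (input) keys where "keys \<equiv> Poly_Mapping.keys"
abbreviation (input) single where "single \<equiv> Poly_Mapping.single"

section \<open>The vector space of polynomials supported on a set of monomials\<close>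

definition polys :: "monomial set \<Rightarrow> 'a::zero mpoly set"
  where "polys X = {f. keys f \<subseteq> X}"

definition restr :: "monomial set \<Rightarrow> 'a::zero mpoly \<Rightarrow> 'a mpoly"
  where "restr X f = Poly_Mapping.mapp (\<lambda>t c. c when t \<in> X) f"

definition scal :: "'a::comm_ring_1 \<Rightarrow> 'a mpoly \<Rightarrow> 'a mpoly"
  where "scal c f = single 0 c * f"

lemma lookup_scal [simp]: "lookup (scal c f) t = c * lookup f t"
  unfolding scal_def mult_map_scale_conv_mult[symmetric]
  by (simp add: Poly_Mapping.map.rep_eq when_def)

lemma lookup_restr [simp]: "lookup (restr X f) t = (if t \<in> X then lookup f t else 0)"
  by (auto simp: restr_def lookup_mapp when_def in_keys_iff)

lemma restr_eq_iff: "restr X f = restr X g \<longleftrightarrow> (\<forall>t\<in>X. lookup f t = lookup g t)"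
  by (auto simp: poly_mapping_eq_iff fun_eq_iff split: if_splits)

lemma restr_in_polys [simp]: "restr X f \<in> polys X"
  by (auto simp: polys_def in_keys_iff split: if_splits)

lemma restr_polys [simp]: "f \<in> polys X \<Longrightarrow> restr X f = f"
  by (rule poly_mapping_eqI) (auto simp: polys_def in_keys_iff)

lemma polys_lookup_eq_0: "f \<in> polys X \<Longrightarrow> t \<notin> X \<Longrightarrow> lookup f t = 0"
  by (auto simp: polys_def in_keys_iff)

lemma polys_iff: "f \<in> polys X \<longleftrightarrow> (\<forall>t. t \<notin> X \<longrightarrow> lookup f t = 0)"
  by (auto simp: polys_def in_keys_iff)

lemma restr_add: "restr X (f + g) = restr X f + restr X g"
  by (rule poly_mapping_eqI) (simp add: lookup_add)

lemma restr_scal: "restr X (scal c f) = scal c (restr X f)"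
  by (rule poly_mapping_eqI) simp

interpretation mp: vector_space "scal :: 'a::field \<Rightarrow> 'a mpoly \<Rightarrow> 'a mpoly"
  by unfold_locales (auto intro!: poly_mapping_eqI simp: lookup_add algebra_simps)

interpretation mpp: vector_space_pair "scal :: 'a::field \<Rightarrow> 'a mpoly \<Rightarrow> 'a mpoly" "scal :: 'a::field \<Rightarrow> 'a mpoly \<Rightarrow> 'a mpoly"
  by unfold_locales

abbreviation mlinear :: "('a::field mpoly \<Rightarrow> 'a mpoly) \<Rightarrow> bool"
  where "mlinear \<equiv> Vector_Spaces.linear scal scal"

lemma mlinearI:
  assumes "\<And>f g. \<phi> (f + g) = \<phi> f + \<phi> g" "\<And>c f. \<phi> (scal c f) = scal c (\<phi> f)"
  shows "mlinear \<phi>"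
  using assms by (simp add: Vector_Spaces.linear_iff mp.vector_space_axioms)

lemma subspace_polys: "mp.subspace (polys X :: 'a::field mpoly set)"
  by (auto simp: mp.subspace_def polys_iff lookup_add)

lemma poly_sum_singles:
  assumes "finite X" "f \<in> polys X"
  shows "f = (\<Sum>t\<in>X. scal (lookup f t) (single t 1))"
proof (rule poly_mapping_eqI)
  fix s
  have "lookup (\<Sum>t\<in>X. scal (lookup f t) (single t 1)) s = (\<Sum>t\<in>X. if t = s then lookup f t else 0)"
    by (simp add: lookup_sum lookup_single when_def if_distrib cong: if_cong)
  also have "\<dots> = lookup f s"
    using assms polys_lookup_eq_0[OF assms(2)] by (simp add: sum.delta)
  finally show "lookup f s = lookup (\<Sum>t\<in>X. scal (lookup f t) (single t 1)) s" by simp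
qed

definition singles :: "monomial set \<Rightarrow> 'a::field mpoly set"
  where "singles X = (\<lambda>t. single t 1) ` X"

lemma span_singles: "finite X \<Longrightarrow> mp.span (singles X) = (polys X :: 'a::field mpoly set)"
proof (intro equalityI)
  assume "finite X"
  show "(polys X :: 'a mpoly set) \<subseteq> mp.span (singles X)"
  proof
    fix f :: "'a mpoly" assume "f \<in> polys X"
    then show "f \<in> mp.span (singles X)"
      by (subst poly_sum_singles[OF \<open>finite X\<close> \<open>f \<in> polys X\<close>])
        (rule mp.span_sum, rule mp.span_scale, rule mp.span_base, simp add: singles_def)
  qed
  show "mp.span (singles X) \<subseteq> (polys X :: 'a mpoly set)"
    by (rule mp.span_minimal[OF _ subspace_polys]) (auto simp: singles_def polys_def)
qed

lemma inj_single_1: "inj (\<lambda>t. single t (1::'a::zero_neq_one))"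
  by (rule injI) (metis keys_single singleton_inject zero_neq_one)

lemma card_singles: "card (singles X :: 'a::field mpoly set) = card X"
  unfolding singles_def by (rule card_image) (rule inj_on_subset[OF inj_single_1], simp)

lemma finite_singles: "finite X \<Longrightarrow> finite (singles X)"
  by (simp add: singles_def)

lemma independent_singles:
  assumes "finite X"
  shows "mp.independent (singles X :: 'a::field mpoly set)"
proof (rule mp.independent_if_scalars_zero[OF finite_singles[OF assms]])
  fix f :: "'a mpoly \<Rightarrow> 'a" and x :: "'a mpoly"
  assume s: "(\<Sum>x\<in>singles X. scal (f x) x) = 0" and "x \<in> singles X"
  then obtain t where t: "t \<in> X" "x = single t 1" by (auto simp: singles_def)
  have inj: "inj_on (\<lambda>t. single t (1::'a)) X"
 by (rule inj_on_subset[OF inj_single_1]) simp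
  have reindex: "(\<Sum>x\<in>singles X. g x) = (\<Sum>s\<in>X. g (single s (1::'a)))" for g :: "'a mpoly \<Rightarrow> 'a"
    by (simp add: singles_def sum.reindex[OF inj])
  have "0 = lookup (\<Sum>x\<in>singles X. scal (f x) x) t" by (simp add: s)
  also have "\<dots> = (\<Sum>s\<in>X. if s = t then f (single s 1) else 0)"
    unfolding lookup_sum lookup_scal reindex
    by (auto intro!: sum.cong simp: lookup_single when_def)
  also have "\<dots> = f x" using t assms by (simp add: sum.delta)
  finally show "f x = 0" by simp
qed

lemma dim_polys: "finite X \<Longrightarrow> mp.dim (polys X :: 'a::field mpoly set) = card X"
  by (metis card_singles independent_singles mp.dim_span_eq_card_independent span_singles)

lemma dim_le_polys:
  assumes "finite Y" "U \<subseteq> polys Y"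
  shows "mp.dim (U :: 'a::field mpoly set) \<le> card Y"
  by (metis assms card_singles finite_singles mp.dim_le_card span_singles)

text \<open>A basis of \<open>U\<close> extended by a vector outside \<open>U\<close> would be an
  independent set of \<open>card Y + 1\<close> vectors in the span of \<open>card Y\<close>
  monomials.\<close>

lemma subspace_full:
  assumes "finite Y" "mp.subspace U" "U \<subseteq> polys Y" "mp.dim U = card Y"
  shows "U = (polys Y :: 'a::field mpoly set)"
proof (rule ccontr)
  assume "U \<noteq> polys Y"
  then obtain y where y: "y \<in> polys Y" "y \<notin> U" using assms by auto
  obtain B where B: "B \<subseteq> U" "mp.independent B" "U \<subseteq> mp.span B" "card B = mp.dim U"
    using mp.basis_exists by blast
  have "mp.span B \<subseteq> U" using B(1) assms(2) by (simp add: mp.span_minimal)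
  then have "mp.independent (insert y B)"
    using B(2) y by (intro mp.independent_insertI) auto
  moreover have "insert y B \<subseteq> mp.span (singles Y)"
    using B(1) y assms by (auto simp: span_singles)
  ultimately have "finite (insert y B) \<and> card (insert y B) \<le> card (singles Y :: 'a mpoly set)"
    by (rule mp.independent_span_bound[OF finite_singles[OF assms(1)]])
  moreover have "y \<notin> B" using B(1) y by auto
  ultimately show False using B(4) assms(4) by (auto simp: card_singles)
qed

lemma image_polys_span:
  assumes "mlinear \<phi>" "finite X"
  shows "\<phi> ` polys X = mp.span (\<phi> ` singles X)"
  using assms by (metis mpp.linear_span_image span_singles)

lemma subspace_image_polys: "mlinear \<phi> \<Longrightarrow> mp.subspace (\<phi> ` polys X)"
  by (simp add: mpp.linear_subspace_image subspace_polys)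

lemma dim_image_polys_le:
  assumes "mlinear \<phi>" "finite X"
  shows "mp.dim (\<phi> ` polys X) \<le> card X"
proof -
  have "mp.dim (\<phi> ` polys X) \<le> card (\<phi> ` singles X)"
    using assms by (intro mp.dim_le_card) (auto simp: image_polys_span finite_singles)
  also have "\<dots> \<le> card X"
    by (metis assms(2) card_image_le card_singles finite_singles)
  finally show ?thesis .
qed

lemma inj_on_polys_iff:
  assumes lin: "mlinear \<phi>"
  shows "inj_on \<phi> (polys X) \<longleftrightarrow> (\<forall>f\<in>polys X. \<phi> f = 0 \<longrightarrow> f = 0)"
  using mpp.linear_inj_on_iff_eq_0[OF lin subspace_polys] by blast

text \<open>From dimension to injectivity: a monomial \<open>t\<close> in the support of a nonzero
  kernel element has an image that is a combination of the other images, so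
  \<open>card X - 1\<close> vectors already span the image.\<close>

lemma inj_on_polys_iff_dim:
  assumes lin: "mlinear \<phi>" and fin: "finite X"
  shows "inj_on \<phi> (polys X) \<longleftrightarrow> mp.dim (\<phi> ` polys X) = card X"
proof
  assume inj: "inj_on \<phi> (polys X)"
  then have "inj_on \<phi> (mp.span (singles X))" using fin by (simp add: span_singles)
  then have "mp.independent (\<phi> ` singles X)"
    using mpp.linear_independent_injective_image[OF lin independent_singles[OF fin]] by blast
  then have "mp.dim (\<phi> ` polys X) = card (\<phi> ` singles X)"
    using lin fin by (simp add: image_polys_span mp.dim_eq_card_independent)
  also have "\<dots> = card X"
    unfolding card_singles[where 'a='a, symmetric]
    by (rule card_image, rule inj_on_subset[OF inj]) (auto simp: singles_def polys_def)
  finally show "mp.dim (\<phi> ` polys X) = card X" .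
next
  assume dim: "mp.dim (\<phi> ` polys X) = card X"
  show "inj_on \<phi> (polys X)"
  proof (subst inj_on_polys_iff[OF lin], intro ballI impI, rule ccontr)
    fix f assume f: "f \<in> polys X" "\<phi> f = 0" "f \<noteq> 0"
    then obtain t where t: "t \<in> keys f" by (metis all_not_in_conv keys_eq_empty)
    then have tX: "t \<in> X" and ft: "lookup f t \<noteq> 0" using f by (auto simp: polys_def in_keys_iff)
    have "f = (\<Sum>t\<in>X. scal (lookup f t) (single t 1))" by (rule poly_sum_singles[OF fin f(1)])
    also have "\<phi> \<dots> = (\<Sum>t\<in>X. scal (lookup f t) (\<phi> (single t 1)))"
      using lin by (simp add: mpp.linear_sum mpp.linear_scale)
    also have "\<dots> = scal (lookup f t) (\<phi> (single t 1)) + (\<Sum>t\<in>X - {t}. scal (lookup f t) (\<phi> (single t 1)))"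
      by (rule sum.remove[OF fin tX])
    finally have "scal (lookup f t) (\<phi> (single t 1)) = - (\<Sum>t\<in>X - {t}. scal (lookup f t) (\<phi> (single t 1)))"
      using f(2) by (simp add: eq_neg_iff_add_eq_0)
    moreover have "(\<Sum>t\<in>X - {t}. scal (lookup f t) (\<phi> (single t 1))) \<in> mp.span (\<phi> ` singles (X - {t}))"
      by (rule mp.span_sum, rule mp.span_scale, rule mp.span_base, auto simp: singles_def)
    ultimately have "scal (lookup f t) (\<phi> (single t 1)) \<in> mp.span (\<phi> ` singles (X - {t}))"
      by (simp add: mp.span_neg)
    then have "scal (inverse (lookup f t)) (scal (lookup f t) (\<phi> (single t 1))) \<in> mp.span (\<phi> ` singles (X - {t}))"
      by (rule mp.span_scale)
    then have *: "\<phi> (single t 1) \<in> mp.span (\<phi> ` singles (X - {t}))" using ft by simp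
    have "\<phi> ` singles X \<subseteq> mp.span (\<phi> ` singles (X - {t}))"
    proof
      fix y assume "y \<in> \<phi> ` singles X"
      then obtain s where s: "s \<in> X" "y = \<phi> (single s 1)" by (auto simp: singles_def)
      show "y \<in> mp.span (\<phi> ` singles (X - {t}))"
      proof (cases "s = t")
        case True then show ?thesis using * s by simp
      next
        case False then show ?thesis using s by (intro mp.span_base) (auto simp: singles_def)
      qed
    qed
    then have "mp.span (\<phi> ` singles X) \<subseteq> mp.span (\<phi> ` singles (X - {t}))"
      by (simp add: mp.span_minimal)
    then have "mp.dim (\<phi> ` polys X) \<le> card (\<phi> ` singles (X - {t}))"
      using fin lin by (intro mp.dim_le_card) (auto simp: image_polys_span finite_singles)
    also have "\<dots> \<le> card (X - {t})"
      by (metis card_image_le card_singles fin finite_Diff finite_singles)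
    also have "\<dots> < card X" using fin tX by (rule card_Diff1_less)
    finally show False using dim by simp
  qed
qed

lemma surj_if_inj_endo:
  assumes "mlinear \<phi>" "finite X" "inj_on \<phi> (polys X)" "\<phi> ` polys X \<subseteq> polys X"
  shows "\<phi> ` polys X = polys X"
  using assms by (simp add: inj_on_polys_iff_dim subspace_full subspace_image_polys)

text \<open>Phrased by a maximal element of the support instead of \<open>leading_monomial\<close>,
  so that the zero polynomial contributes nothing without a side condition.\<close>

definition leads :: "monomial rel \<Rightarrow> 'a::zero mpoly set \<Rightarrow> monomial set"
  where "leads r U = {t. \<exists>u\<in>U. t \<in> keys u \<and> (\<forall>s\<in>keys u. (s, t) \<in> r)}"

lemma leads_polys_subset: "U \<subseteq> polys X \<Longrightarrow> leads r U \<subseteq> X"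
  by (auto simp: leads_def polys_def)

text \<open>Gaussian elimination: one element of \<open>U\<close> per leading monomial gives a
  basis. Distinct leading monomials force independence; spanning follows by well-founded induction,
  since subtracting a multiple of a chosen element strictly lowers the leading monomial.\<close>

lemma card_leads:
  fixes U :: "'a::field mpoly set"
  assumes ord: "monomial_ordering n r" and U: "mp.subspace U" "U \<subseteq> polys X" and X: "finite X" "X \<subseteq> monomials n"
  shows "card (leads r U) = mp.dim U"
proof -
  have lin: "linear_order_on (monomials n) r" "wf (r - Id)"
    using ord by (simp_all add: monomial_ordering_def well_order_on_def)
  have asym: "antisym r" using lin by (simp add: order_on_defs)
  define L where "L = leads r U"
  have LX: "L \<subseteq> X" unfolding L_def by (rule leads_polys_subset[OF U(2)])
  then have finL: "finite L" using X finite_subset by blast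
  have "\<forall>t\<in>L. \<exists>u\<in>U. t \<in> keys u \<and> (\<forall>s\<in>keys u. (s, t) \<in> r)" by (auto simp: L_def leads_def)
  then obtain u where u: "\<And>t. t \<in> L \<Longrightarrow> u t \<in> U" "\<And>t. t \<in> L \<Longrightarrow> t \<in> keys (u t)"
     "\<And>t s. t \<in> L \<Longrightarrow> s \<in> keys (u t) \<Longrightarrow> (s, t) \<in> r" by metis
  have inju: "inj_on u L"
    by (rule inj_onI) (metis asym antisymD u(2,3))
  have indep: "mp.independent (u ` L)"
  proof (rule mp.independent_if_scalars_zero)
    show "finite (u ` L)" using finL by simp
  next
    fix f x assume s: "(\<Sum>x\<in>u ` L. scal (f x) x) = 0" and x: "x \<in> u ` L"
    show "f x = 0"
    proof (rule ccontr)
      assume fx: "f x \<noteq> 0"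
      define g where "g = (\<Sum>t\<in>L. single t (f (u t)))"
      have lg: "lookup g s = (if s \<in> L then f (u s) else 0)" for s
        using finL by (simp add: g_def lookup_sum lookup_single when_def sum.delta)
      have g: "keys g \<subseteq> monomials n" "g \<noteq> 0"
        using LX X x fx lg by (auto simp: in_keys_iff split: if_splits) (metis lg lookup_zero)
      \<comment> \<open>Among the vectors with nonzero coefficient take the one with the largest
        leading monomial \<open>t\<close>; no other one contributes to the coefficient of
        \<open>t\<close>.\<close>
      define t where "t = leading_monomial r g"
      have t: "t \<in> keys g" "\<And>s. s \<in> keys g \<Longrightarrow> (s, t) \<in> r"
        using leading_monomial[OF ord g] by (auto simp: t_def)
      then have tL: "t \<in> L" and ft: "f (u t) \<noteq> 0" by (auto simp: in_keys_iff lg split: if_splits)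
      have "0 = lookup (\<Sum>x\<in>u ` L. scal (f x) x) t" by (simp add: s)
      also have "\<dots> = (\<Sum>s\<in>L. f (u s) * lookup (u s) t)"
        by (simp add: sum.reindex[OF inju] lookup_sum)
      also have "\<dots> = (\<Sum>s\<in>L. if s = t then f (u t) * lookup (u t) t else 0)"
      proof (rule sum.cong[OF refl])
        fix s assume sL: "s \<in> L"
        show "f (u s) * lookup (u s) t = (if s = t then f (u t) * lookup (u t) t else 0)"
        proof (rule ccontr)
          assume n: "\<not> ?thesis"
          then have "s \<noteq> t" by auto
          with n have "f (u s) \<noteq> 0" "lookup (u s) t \<noteq> 0" by auto
          then have "(s, t) \<in> r" "(t, s) \<in> r" using t(2) u(3) sL by (auto simp: in_keys_iff lg)
          then show False using asym \<open>s \<noteq> t\<close> by (auto dest: antisymD)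
        qed
      qed
      also have "\<dots> = f (u t) * lookup (u t) t" using tL finL by (simp add: sum.delta)
      finally show False using ft u(2)[OF tL] by (simp add: in_keys_iff)
    qed
  qed
  have span: "f \<in> mp.span (u ` L)" if "f \<in> U" for f
  proof (cases "f = 0")
    case True then show ?thesis by (simp add: mp.span_zero)
  next
    case False
    define t where "t = leading_monomial r f"
    have "\<forall>f\<in>U. f \<noteq> 0 \<longrightarrow> t = leading_monomial r f \<longrightarrow> f \<in> mp.span (u ` L)" for t
      using lin(2)
    proof (induction t rule: wf_induct_rule)
      case (less t)
      show ?case
      proof (intro ballI impI)
        fix f assume f: "f \<in> U" "f \<noteq> 0" "t = leading_monomial r f"
        have kf: "keys f \<subseteq> monomials n" using f U X by (auto simp: polys_def)
        have t: "t \<in> keys f" "\<And>s. s \<in> keys f \<Longrightarrow> (s, t) \<in> r"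
          using leading_monomial[OF ord kf f(2)] f(3) by auto
        then have tL: "t \<in> L" using f by (auto simp: L_def leads_def)
        define c where "c = lookup f t / lookup (u t) t"
        define g where "g = f - scal c (u t)"
        have gU: "g \<in> U" using U f u tL by (simp add: g_def mp.subspace_diff mp.subspace_scale)
        have gt: "lookup g t = 0"
          using u(2)[OF tL] by (simp add: g_def c_def lookup_minus in_keys_iff)
        have kg: "(s, t) \<in> r" if "s \<in> keys g" for s
        proof -
          have "s \<in> keys f \<or> s \<in> keys (u t)" using that by (auto simp: g_def in_keys_iff lookup_minus)
          then show ?thesis using t u(3) tL by auto
        qed
        have "g \<in> mp.span (u ` L)"
        proof (cases "g = 0")
          case True then show ?thesis by (simp add: mp.span_zero)
        next
          case False
          have kg': "keys g \<subseteq> monomials n" using gU U X by (auto simp: polys_def)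
          have l: "leading_monomial r g \<in> keys g" by (rule leading_monomial(1)[OF ord kg' False])
          then have "leading_monomial r g \<noteq> t" using gt by (auto simp: in_keys_iff)
          then show ?thesis using less gU False kg[OF l] by auto
        qed
        moreover have "scal c (u t) \<in> mp.span (u ` L)" using tL by (intro mp.span_scale mp.span_base) auto
        ultimately have "g + scal c (u t) \<in> mp.span (u ` L)" by (rule mp.span_add)
        then show "f \<in> mp.span (u ` L)" by (simp add: g_def)
      qed
    qed
    then show ?thesis using that False by blast
  qed
  have "card (u ` L) = mp.dim U"
    by (rule mp.basis_card_eq_dim) (use u span indep in auto)
  then show ?thesis unfolding card_image[OF inju] by (simp add: L_def)
qed

section \<open>Ballot monomials and the Hilbert function\<close>

lemma monom_degree_eq_sum: "finite A \<Longrightarrow> keys t \<subseteq> A \<Longrightarrow> monom_degree t = (\<Sum>i\<in>A. lookup t i)"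
  unfolding monom_degree_def by (intro sum.mono_neutral_left) (auto simp: in_keys_iff)

lemma monom_degree_add [simp]: "monom_degree (s + t) = monom_degree s + monom_degree t"
proof -
  have "keys (s + t) \<subseteq> keys s \<union> keys t" by (rule Poly_Mapping.keys_add)
  then show ?thesis
    by (simp add: monom_degree_eq_sum[of "keys s \<union> keys t"] lookup_add sum.distrib)
qed

lemma monom_degree_single [simp]: "monom_degree (single i a) = a"
  by (simp add: monom_degree_def)

lemma monom_degree_zero [simp]: "monom_degree 0 = 0"
  by (simp add: monom_degree_def)

lemma monom_degree_eq_0_iff [simp]: "monom_degree t = 0 \<longleftrightarrow> t = 0"
proof
  assume "monom_degree t = 0"
  then have "lookup t i = 0" for i
    by (cases "i \<in> keys t") (auto simp: monom_degree_def in_keys_iff)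
  then show "t = 0" by (intro poly_mapping_eqI) simp
qed simp

lemma monom_degree_monomials: "t \<in> monomials n \<Longrightarrow> monom_degree t = (\<Sum>i=1..n. lookup t i)"
  by (simp add: monomials_def monom_degree_eq_sum)

lemma monomials_lookup_eq_0: "t \<in> monomials n \<Longrightarrow> i \<notin> {1..n} \<Longrightarrow> lookup t i = 0"
  by (auto simp: monomials_def in_keys_iff)

section \<open>Monomials with bounded exponents and ballot monomials\<close>

definition box :: "nat \<Rightarrow> (nat \<Rightarrow> nat) \<Rightarrow> monomial set"
  where "box n M = {t \<in> monomials n. \<forall>i\<in>{1..n}. lookup t i < M i}"

definition box_deg :: "nat \<Rightarrow> (nat \<Rightarrow> nat) \<Rightarrow> nat \<Rightarrow> monomial set"
  where "box_deg n M d = {t \<in> box n M. monom_degree t = d}"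

definition socle_degree :: "nat \<Rightarrow> (nat \<Rightarrow> nat) \<Rightarrow> nat"
  where "socle_degree n M = (\<Sum>i=1..n. M i - 1)"

text \<open>
  The exponent \<open>a j\<close> of a ballot monomial names a summand of the tensor product of two irreducible
  \<open>sl\<^sub>2\<close>-modules, of dimensions \<open>1 + (\<Sum>i<j. M i - 1 - 2 * a i)\<close> and \<open>M j\<close>. For \<open>M = 2\<close> this is the
  ballot condition on the second row of a standard Young tableau.
\<close>
definition ballot :: "nat \<Rightarrow> (nat \<Rightarrow> nat) \<Rightarrow> monomial \<Rightarrow> bool"
  where "ballot n M t \<longleftrightarrow> (\<forall>j\<in>{1..n}. lookup t j + 2 * (\<Sum>i=1..<j. lookup t i) \<le> (\<Sum>i=1..<j. M i - 1))"

definition ballot_deg :: "nat \<Rightarrow> (nat \<Rightarrow> nat) \<Rightarrow> nat \<Rightarrow> monomial set"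
  where "ballot_deg n M d = {t \<in> box_deg n M d. ballot n M t}"

lemma box_subset: "box n M \<subseteq> monomials n" "box_deg n M d \<subseteq> monomials n" "box_deg n M d \<subseteq> box n M"
  by (auto simp: box_def box_deg_def)

lemma box_0: "box 0 M = {0}"
  by (auto simp: box_def monomials_def)

lemma split_monomial:
  assumes "t \<in> monomials (Suc n)"
  shows "\<exists>s\<in>monomials n. t = s + single (Suc n) (lookup t (Suc n))"
proof
  define s where "s = t - single (Suc n) (lookup t (Suc n))"
  have l: "lookup s i = (if i = Suc n then 0 else lookup t i)" for i
    by (simp add: s_def lookup_minus lookup_single when_def)
  show "t = s + single (Suc n) (lookup t (Suc n))"
    by (rule poly_mapping_eqI) (simp add: lookup_add l lookup_single when_def)
  have "i \<in> {1..n}" if "i \<in> keys s" for i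
  proof -
    have "i \<in> keys t" "i \<noteq> Suc n" using that by (auto simp: in_keys_iff l split: if_splits)
    then show ?thesis using assms by (auto simp: monomials_def)
  qed
  then show "s \<in> monomials n" by (auto simp: monomials_def)
qed

lemma box_Suc: "box (Suc n) M = (\<lambda>(a, s). s + single (Suc n) a) ` (SIGMA a:{..<M (Suc n)}. box n M)"
proof (intro equalityI subsetI)
  fix t assume t: "t \<in> box (Suc n) M"
  then obtain s where s: "s \<in> monomials n" "t = s + single (Suc n) (lookup t (Suc n))"
    using split_monomial[of t n] by (auto simp: box_def)
  have "lookup s i = lookup t i" if "i \<in> {1..n}" for i
    using that by (subst s(2)) (simp add: lookup_add lookup_single when_def)
  then have "s \<in> box n M" using t s(1) by (auto simp: box_def)
  moreover have "lookup t (Suc n) < M (Suc n)" using t by (auto simp: box_def)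
  ultimately show "t \<in> (\<lambda>(a, s). s + single (Suc n) a) ` (SIGMA a:{..<M (Suc n)}. box n M)"
    using s(2) by (intro image_eqI[of _ _ "(lookup t (Suc n), s)"]) auto
next
  fix t assume "t \<in> (\<lambda>(a, s). s + single (Suc n) a) ` (SIGMA a:{..<M (Suc n)}. box n M)"
  then obtain a s where t: "a < M (Suc n)" "s \<in> box n M" "t = s + single (Suc n) a" by auto
  have s: "lookup s i = 0" if "i \<notin> {1..n}" for i
    using that t(2) monomials_lookup_eq_0 by (auto simp: box_def)
  have lt: "lookup t i = (if i = Suc n then a else lookup s i)" for i
    using s[of "Suc n"] by (auto simp: t(3) lookup_add lookup_single when_def)
  have "keys t \<subseteq> {1..Suc n}"
  proof
    fix i assume "i \<in> keys t"
    then have "lookup t i \<noteq> 0" by (simp add: in_keys_iff)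
    then have "i = Suc n \<or> i \<in> {1..n}" using s[of i] by (auto simp: lt split: if_splits)
    then show "i \<in> {1..Suc n}" by auto
  qed
  then show "t \<in> box (Suc n) M"
    using t(1,2) unfolding box_def monomials_def by (simp add: lt)
qed

lemma inj_box_Suc: "inj_on (\<lambda>(a, s). s + single (Suc n) a) (SIGMA a:A. box n M)"
proof (rule inj_onI, clarsimp)
  fix a b s t assume st: "s \<in> box n M" "t \<in> box n M" and eq: "s + single (Suc n) a = t + single (Suc n) b"
  have "lookup s (Suc n) = 0" "lookup t (Suc n) = 0"
    using st monomials_lookup_eq_0[of _ n "Suc n"] by (auto simp: box_def)
  with arg_cong[OF eq, of "\<lambda>t. lookup t (Suc n)"] have "a = b" by (simp add: lookup_add)
  then show "a = b \<and> s = t" using eq by simp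
qed

lemma finite_box [simp]: "finite (box n M)"
  by (induction n) (auto simp: box_0 box_Suc)

lemma finite_box_deg [simp]: "finite (box_deg n M d)"
  by (simp add: box_deg_def)

section \<open>Recursions in the number of variables\<close>

lemma card_box_Suc:
  "card {t \<in> box (Suc n) M. P t} = (\<Sum>a<M (Suc n). card {s \<in> box n M. P (s + single (Suc n) a)})"
proof -
  define A where "A = (SIGMA a:{..<M (Suc n)}. {s \<in> box n M. P (s + single (Suc n) a)})"
  have "{t \<in> box (Suc n) M. P t} = (\<lambda>(a, s). s + single (Suc n) a) ` A"
    unfolding box_Suc by (force simp: A_def)
  moreover have "inj_on (\<lambda>(a, s). s + single (Suc n) a) A"
    by (rule inj_on_subset[OF inj_box_Suc[of n "{..<M (Suc n)}" M]]) (auto simp: A_def)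
  ultimately have "card {t \<in> box (Suc n) M. P t} = card A" by (simp add: card_image)
  then show ?thesis by (simp add: A_def)
qed

text \<open>With integer degrees the count vanishes below zero by itself, so that neither the
  recursion nor the reflection at the socle degree meets truncated subtraction.\<close>

definition hilb :: "nat \<Rightarrow> (nat \<Rightarrow> nat) \<Rightarrow> int \<Rightarrow> int"
  where "hilb n M d = int (card {t \<in> box n M. int (monom_degree t) = d})"

definition ballot_count :: "nat \<Rightarrow> (nat \<Rightarrow> nat) \<Rightarrow> int \<Rightarrow> int"
  where "ballot_count n M d = int (card {t \<in> box n M. ballot n M t \<and> int (monom_degree t) = d})"

lemma socle_degree_Suc: "socle_degree (Suc n) M = socle_degree n M + (M (Suc n) - 1)"
  by (simp add: socle_degree_def)

lemma hilb_0: "hilb 0 M d = (if d = 0 then 1 else 0)"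
proof -
  have "{t \<in> box 0 M. int (monom_degree t) = d} = (if d = 0 then {0} else {})" by (auto simp: box_0)
  then show ?thesis by (simp add: hilb_def)
qed

lemma ballot_count_0: "ballot_count 0 M d = (if d = 0 then 1 else 0)"
proof -
  have "{t \<in> box 0 M. ballot 0 M t \<and> int (monom_degree t) = d} = (if d = 0 then {0} else {})"
    by (auto simp: box_0 ballot_def)
  then show ?thesis by (simp add: ballot_count_def)
qed

lemma sum_shift_int: "(\<Sum>a<m. f (d - int a)) = (\<Sum>e\<in>{d - int m + 1..d}. f e)"
  by (rule sum.reindex_bij_witness[of _ "\<lambda>e. nat (d - e)" "\<lambda>a. d - int a"]) auto

lemma hilb_Suc: "hilb (Suc n) M d = (\<Sum>e\<in>{d - int (M (Suc n)) + 1..d}. hilb n M e)"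
proof -
  have "hilb (Suc n) M d = (\<Sum>a<M (Suc n). hilb n M (d - int a))"
    unfolding hilb_def card_box_Suc by (simp add: algebra_simps)
  then show ?thesis by (simp add: sum_shift_int)
qed

text \<open>The conditions for \<open>j \<le> n\<close> do not see the new exponent, and in the
  condition for the last variable the sums are the degree of \<open>s\<close> and the socle
  degree.\<close>

lemma ballot_add_single:
  assumes "s \<in> box n M"
  shows "ballot (Suc n) M (s + single (Suc n) a) \<longleftrightarrow> ballot n M s \<and> a + 2 * monom_degree s \<le> socle_degree n M"
proof -
  have sm: "s \<in> monomials n" using assms by (simp add: box_def)
  have lt: "lookup (s + single (Suc n) a) i = (if i = Suc n then a else lookup s i)" for i
    using monomials_lookup_eq_0[OF sm, of "Suc n"] by (auto simp: lookup_add lookup_single when_def)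
  have sums: "(\<Sum>i=1..<j. lookup (s + single (Suc n) a) i) = (\<Sum>i=1..<j. lookup s i)" if "j \<le> Suc n" for j
    using that by (intro sum.cong) (auto simp: lt)
  have "ballot (Suc n) M (s + single (Suc n) a) \<longleftrightarrow>
     (\<forall>j\<in>{1..n}. lookup s j + 2 * (\<Sum>i=1..<j. lookup s i) \<le> (\<Sum>i=1..<j. M i - 1)) \<and>
     a + 2 * (\<Sum>i=1..<Suc n. lookup s i) \<le> (\<Sum>i=1..<Suc n. M i - 1)"
    unfolding ballot_def atLeastAtMostSuc_conv[of 1 n, simplified] using sums
    by (auto simp: lt)
  then show ?thesis
    unfolding ballot_def[symmetric] atLeastLessThanSuc_atLeastAtMost
    by (simp add: monom_degree_monomials[OF sm] socle_degree_def)
qed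

text \<open>With e = d - a for the degree in the first n variables and D for their socle degree, the
  new condition a + 2 * e \<le> D becomes e \<le> D - d.\<close>

lemma ballot_count_Suc:
  "ballot_count (Suc n) M d =
     (\<Sum>e\<in>{d - int (M (Suc n)) + 1..d}. if e \<le> int (socle_degree n M) - d then ballot_count n M e else 0)"
proof -
  have c: "int (card {s \<in> box n M. ballot (Suc n) M (s + single (Suc n) a) \<and> int (monom_degree (s + single (Suc n) a)) = d})
      = (if d - int a \<le> int (socle_degree n M) - d
         then int (card {s \<in> box n M. ballot n M s \<and> int (monom_degree s) = d - int a}) else 0)" for a
  proof -
    have "{s \<in> box n M. ballot (Suc n) M (s + single (Suc n) a) \<and> int (monom_degree (s + single (Suc n) a)) = d}
      = (if d - int a \<le> int (socle_degree n M) - d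
         then {s \<in> box n M. ballot n M s \<and> int (monom_degree s) = d - int a} else {})"
      by (auto simp: ballot_add_single)
    then show ?thesis by simp
  qed
  have "ballot_count (Suc n) M d =
     (\<Sum>a<M (Suc n). if d - int a \<le> int (socle_degree n M) - d then ballot_count n M (d - int a) else 0)"
    unfolding ballot_count_def card_box_Suc of_nat_sum by (simp only: c)
  then show ?thesis
    by (simp only: sum_shift_int[of "\<lambda>e. if e \<le> int (socle_degree n M) - d then ballot_count n M e else 0"])
qed

text \<open>Reflection at the socle degree of the first n variables carries the summation window of
  the reflected degree to the window of d, because the socle degree grows by exactly
  \<open>M (Suc n) - 1\<close>.\<close>

lemma hilb_symmetric:
  assumes "\<And>i. i \<in> {1..n} \<Longrightarrow> M i \<ge> 1"
  shows "hilb n M (int (socle_degree n M) - d) = hilb n M d"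
  using assms
proof (induction n arbitrary: d)
  case 0
  then show ?case by (simp add: hilb_0 socle_degree_def)
next
  case (Suc n)
  have IH: "hilb n M (int (socle_degree n M) - e) = hilb n M e" for e using Suc by simp
  have M: "M (Suc n) \<ge> 1" using Suc.prems by simp
  show ?case
    unfolding hilb_Suc
    by (rule sum.reindex_bij_witness[of _ "\<lambda>e. int (socle_degree n M) - e" "\<lambda>e. int (socle_degree n M) - e"])
      (use M in \<open>auto simp: IH socle_degree_Suc of_nat_diff\<close>)
qed

text \<open>The first difference g of the Hilbert function is antisymmetric about (D + 1) / 2. One
  more variable sums g over a window of length m ending at d, and the ballot condition cuts this
  window at D - d. What it cuts off is an interval symmetric about the same centre, on which g
  cancels.\<close>

lemma ballot_count_eq:
  assumes "\<And>i. i \<in> {1..n} \<Longrightarrow> M i \<ge> 1"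
  shows "ballot_count n M d = (if 2 * d \<le> int (socle_degree n M) then hilb n M d - hilb n M (d - 1) else 0)"
  using assms
proof (induction n arbitrary: d)
  case 0
  then show ?case by (auto simp: hilb_0 ballot_count_0 socle_degree_def)
next
  case (Suc n)
  define D where "D = int (socle_degree n M)"
  define m where "m = int (M (Suc n))"
  define g where "g e = hilb n M e - hilb n M (e - 1)" for e
  have m: "m \<ge> 1" using Suc.prems[of "Suc n"] by (simp add: m_def)
  have D': "int (socle_degree (Suc n) M) = D + m - 1"
    using m by (simp add: socle_degree_Suc D_def m_def of_nat_diff)
  have IH: "ballot_count n M e = (if 2 * e \<le> D then g e else 0)" for e
    using Suc by (simp add: D_def g_def)
  have anti: "g (D + 1 - e) = - g e" for e
    using hilb_symmetric[of n M "e - 1"] hilb_symmetric[of n M e] Suc.prems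
    by (simp add: g_def D_def algebra_simps)
  have diff: "hilb (Suc n) M d - hilb (Suc n) M (d - 1) = (\<Sum>e\<in>{d - m + 1..d}. g e)"
  proof -
    have "hilb (Suc n) M (d - 1) = (\<Sum>e\<in>{d - m + 1..d}. hilb n M (e - 1))"
      unfolding hilb_Suc m_def
      by (rule sum.reindex_bij_witness[of _ "\<lambda>e. e - 1" "\<lambda>e. e + 1"]) auto
    then show ?thesis by (simp add: hilb_Suc m_def g_def sum_subtractf)
  qed
  \<comment> \<open>Below the cut, e \<le> d and e \<le> D - d give 2 * e \<le> D, so the induction
    hypothesis returns g e there.\<close>
  have count: "ballot_count (Suc n) M d = (\<Sum>e\<in>{d - m + 1..d}. if e \<le> D - d then g e else 0)"
    unfolding ballot_count_Suc D_def[symmetric] m_def[symmetric]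
    by (rule sum.cong) (auto simp: IH)
  show ?case
  proof (cases "2 * d \<le> D + m - 1")
    case True
    have "(\<Sum>e\<in>{d - m + 1..d}. g e)
       = (\<Sum>e\<in>{d - m + 1..d}. if e \<le> D - d then g e else 0) + (\<Sum>e\<in>{d - m + 1..d}. if e \<le> D - d then 0 else g e)"
      by (subst sum.distrib[symmetric]) (auto intro: sum.cong)
    also have "(\<Sum>e\<in>{d - m + 1..d}. if e \<le> D - d then 0 else g e) = (\<Sum>e\<in>{D - d + 1..d}. g e)"
      by (rule sum.mono_neutral_cong_right) (use True in auto)
    also have "\<dots> = 0"
    proof -
      have "(\<Sum>e\<in>{D - d + 1..d}. g e) = (\<Sum>e\<in>{D - d + 1..d}. g (D + 1 - e))"
        by (rule sum.reindex_bij_witness[of _ "\<lambda>e. D + 1 - e" "\<lambda>e. D + 1 - e"]) auto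
      also have "\<dots> = - (\<Sum>e\<in>{D - d + 1..d}. g e)" by (simp add: anti sum_negf)
      finally show ?thesis by simp
    qed
    finally show ?thesis using True diff count by (simp add: D')
  next
    case False
    \<comment> \<open>Beyond the middle the whole window lies above the cut.\<close>
    then have "(\<Sum>e\<in>{d - m + 1..d}. if e \<le> D - d then g e else 0) = 0"
      by (intro sum.neutral) auto
    with False show ?thesis by (simp add: count D')
  qed
qed

lemma card_box_deg: "int (card (box_deg n M d)) = hilb n M (int d)"
  by (simp add: box_deg_def hilb_def)

lemma card_ballot_deg: "int (card (ballot_deg n M d)) = ballot_count n M (int d)"
  by (simp add: ballot_deg_def box_deg_def ballot_count_def conj_commute conj_left_commute)

text \<open>Unimodality of the Hilbert function from the nonnegativity of a cardinality: below the
  middle its growth is a ballot count, above the middle its decrease is the ballot count of the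
  reflected degree. If 2 * Suc d is the socle degree plus one, the two degrees are mirror images and
  there are no ballot monomials.\<close>

lemma card_box_deg_Suc:
  assumes "\<And>i. i \<in> {1..n} \<Longrightarrow> M i \<ge> 1"
  shows "2 * Suc d \<le> socle_degree n M + 1 \<Longrightarrow> card (ballot_deg n M (Suc d)) + card (box_deg n M d) = card (box_deg n M (Suc d))"
    and "2 * Suc d \<ge> socle_degree n M + 1 \<Longrightarrow> card (box_deg n M (Suc d)) \<le> card (box_deg n M d)"
    and "2 * d > socle_degree n M \<Longrightarrow> ballot_deg n M d = {}"
proof -
  define D where "D = int (socle_degree n M)"
  have c: "ballot_count n M d = (if 2 * d \<le> D then hilb n M d - hilb n M (d - 1) else 0)" for d
    using ballot_count_eq assms by (simp add: D_def)
  have s: "hilb n M (D - d) = hilb n M d" for d using hilb_symmetric assms by (simp add: D_def)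
  {
    assume d: "2 * Suc d \<le> socle_degree n M + 1"
    have "int (card (ballot_deg n M (Suc d)) + card (box_deg n M d)) = int (card (box_deg n M (Suc d)))"
    proof (cases "2 * Suc d \<le> socle_degree n M")
      case True
      then show ?thesis by (simp add: card_box_deg card_ballot_deg c D_def)
    next
      case False
      with d have "D - int d = int (Suc d)" "\<not> 2 * int (Suc d) \<le> D" by (auto simp: D_def)
      then show ?thesis using s[of "int d"] c[of "int (Suc d)"]
        by (simp add: card_box_deg card_ballot_deg del: of_nat_Suc)
    qed
    then show "card (ballot_deg n M (Suc d)) + card (box_deg n M d) = card (box_deg n M (Suc d))"
      by linarith
  }
  {
    assume d: "2 * Suc d \<ge> socle_degree n M + 1"
    have "hilb n M (int (Suc d)) \<le> hilb n M (int d)"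
    proof (cases "D = 2 * int d + 1")
      case True
      then show ?thesis using s[of "int d"] by (simp add: add.commute)
    next
      case False
      have "0 \<le> ballot_count n M (D - int d)" by (simp add: ballot_count_def)
      also have "\<dots> = hilb n M (D - int d) - hilb n M (D - int d - 1)"
        unfolding c using d False by (simp add: D_def)
      also have "D - int d - 1 = D - int (Suc d)" by simp
      finally show ?thesis using s by simp
    qed
    then show "card (box_deg n M (Suc d)) \<le> card (box_deg n M d)"
      by (simp add: card_box_deg[symmetric] del: of_nat_Suc)
  }
  {
    assume "2 * d > socle_degree n M"
    then have "int (card (ballot_deg n M d)) = 0" by (simp add: card_ballot_deg c D_def)
    then show "ballot_deg n M d = {}" by (simp add: ballot_deg_def)
  }
qed

section \<open>The weak Lefschetz property in characteristic zero\<close>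

definition ev :: "nat \<Rightarrow> monomial"
  where "ev i = single i 1"

lemma lookup_ev: "lookup (ev i) j = (if i = j then 1 else 0)"
  by (simp add: ev_def lookup_single when_def)

lemma keys_ev [simp]: "keys (ev i) = {i}"
  by (simp add: ev_def)

lemma monom_degree_ev [simp]: "monom_degree (ev i) = 1"
  by (simp add: ev_def)

definition lin :: "nat \<Rightarrow> (nat \<Rightarrow> 'a::comm_ring_1) \<Rightarrow> 'a mpoly"
  where "lin n c = (\<Sum>i=1..n. single (ev i) (c i))"

text \<open>Monomials outside the box vanish in the quotient by the powers, so this is
  multiplication in that quotient, written in its monomial basis.\<close>

definition lmult :: "nat \<Rightarrow> (nat \<Rightarrow> nat) \<Rightarrow> (nat \<Rightarrow> 'a::comm_ring_1) \<Rightarrow> 'a mpoly \<Rightarrow> 'a mpoly"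
  where "lmult n M c f = restr (box n M) (lin n c * f)"

lemma single_add_minus: "lookup t i \<noteq> 0 \<Longrightarrow> ev i + (t - ev i) = (t :: monomial)"
  by (rule poly_mapping_eqI) (auto simp: lookup_add lookup_minus lookup_ev)

lemma add_single_minus: "(t :: monomial) + ev i - ev i = t"
  by (rule poly_mapping_eqI) (auto simp: lookup_add lookup_minus lookup_ev)

lemma add_minus_single_commute:
  "i \<noteq> j \<Longrightarrow> (t :: monomial) + ev i - ev j = t - ev j + ev i"
  by (rule poly_mapping_eqI) (auto simp: lookup_add lookup_minus lookup_ev)

lemma lookup_single_mult_add:
  "lookup (single u c * f) (u + s) = c * lookup (f :: 'a::comm_ring_1 mpoly) s"
  by (simp add: lookup_mult lookup_single when_mult)

lemma lookup_var_mult: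
  "lookup (single (ev i) c * f) t = (if lookup t i = 0 then 0 else c * lookup (f :: 'a::comm_ring_1 mpoly) (t - ev i))"
proof (cases "lookup t i = 0")
  case False
  then show ?thesis using lookup_single_mult_add[of "ev i" c f "t - ev i"]
    by (simp add: single_add_minus)
next
  case True
  have "t \<notin> keys (single (ev i) c * f)"
  proof
    assume "t \<in> keys (single (ev i) c * f)"
    then obtain s where "t = ev i + s"
      using keys_mult[of "single (ev i) c" f] by (auto split: if_splits)
    then show False using True by (simp add: lookup_add lookup_ev)
  qed
  then show ?thesis using True by (simp add: in_keys_iff)
qed

lemma lookup_lin_mult:
  "lookup (lin n c * f) t = (\<Sum>i=1..n. if lookup t i = 0 then 0 else c i * lookup f (t - ev i))"
  unfolding lin_def sum_distrib_right lookup_sum lookup_var_mult ..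

lemma lookup_lmult:
  "lookup (lmult n M c f) t = (if t \<in> box n M then \<Sum>i=1..n. if lookup t i = 0 then 0 else c i * lookup f (t - ev i) else 0)"
  by (simp add: lmult_def lookup_lin_mult)

lemma mlinear_lmult: "mlinear (lmult n M c)"
proof (rule mlinearI)
  show "lmult n M c (scal a f) = scal a (lmult n M c f)" for a f
    unfolding lmult_def restr_scal[symmetric] by (simp add: scal_def mult.left_commute)
qed (simp add: lmult_def distrib_left restr_add)

lemma minus_single_box:
  assumes "t \<in> box n M"
  shows "t - ev i \<in> box n M"
proof -
  have l: "lookup (t - ev i) j \<le> lookup t j" for j by (simp add: lookup_minus)
  have "keys (t - ev i) \<subseteq> keys t" using l unfolding in_keys_iff subset_iff by (metis le_zero_eq)
  moreover have "\<forall>j\<in>{1..n}. lookup (t - ev i) j < M j"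
    using assms l by (auto simp: box_def intro: le_less_trans)
  ultimately show ?thesis using assms unfolding box_def monomials_def by blast
qed

lemma monom_degree_minus_single: "lookup t i \<noteq> 0 \<Longrightarrow> Suc (monom_degree (t - ev i)) = monom_degree t"
  using monom_degree_add[of "ev i" "t - ev i"] by (simp add: single_add_minus)

lemma lmult_in_polys:
  assumes "f \<in> polys (box_deg n M d)"
  shows "lmult n M c f \<in> polys (box_deg n M (Suc d))"
  unfolding polys_iff
proof (intro allI impI)
  fix t assume t: "t \<notin> box_deg n M (Suc d)"
  show "lookup (lmult n M c f) t = 0"
  proof (cases "t \<in> box n M")
    case True
    with t have "monom_degree t \<noteq> Suc d" by (simp add: box_deg_def)
    then have "lookup f (t - ev i) = 0" if "lookup t i \<noteq> 0" for i
      using monom_degree_minus_single[OF that] by (intro polys_lookup_eq_0[OF assms]) (auto simp: box_deg_def)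
    then show ?thesis by (auto simp: lookup_lmult intro!: sum.neutral)
  qed (simp add: lookup_lmult)
qed

text \<open>The sl2-partner of multiplication by the sum of the variables. On one factor with basis
  x^0, ..., x^(M-1) it sends x^a to a * (M - a) * x^(a-1), and on the tensor product it acts on one
  factor at a time. The formula is indexed by the target, hence a = lookup t i + 1.\<close>

definition lower :: "nat \<Rightarrow> (nat \<Rightarrow> nat) \<Rightarrow> 'a::comm_ring_1 mpoly \<Rightarrow> 'a mpoly"
  where "lower n M f = (\<Sum>i=1..n. Poly_Mapping.mapp (\<lambda>t c. of_nat ((lookup t i + 1) * (M i - (lookup t i + 1))) * c)
     (Poly_Mapping.map_key (\<lambda>t. t + ev i) f))"

lemma lookup_lower:
  "lookup (lower n M f) t = (\<Sum>i=1..n. of_nat ((lookup t i + 1) * (M i - (lookup t i + 1))) * lookup f (t + ev i))"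
proof -
  have "inj (\<lambda>t :: monomial. t + ev i)" for i by (rule injI) simp
  then have k: "lookup (Poly_Mapping.map_key (\<lambda>t. t + ev i) f) t = lookup f (t + ev i)" for i
    by (simp add: Poly_Mapping.map_key.rep_eq o_def)
  show ?thesis
    unfolding lower_def lookup_sum lookup_mapp in_keys_iff k
    by (rule sum.cong) (auto simp: when_def)
qed

lemma mlinear_lower: "mlinear (lower n M)"
  by (rule mlinearI; rule poly_mapping_eqI)
    (simp_all add: lookup_lower lookup_add distrib_left sum.distrib sum_distrib_left mult_ac)

lemma add_single_in_box:
  assumes "t \<in> box n M" "i \<in> {1..n}"
  shows "t + ev i \<in> box n M \<longleftrightarrow> Suc (lookup t i) < M i"
proof -
  have k: "keys (t + ev i) \<subseteq> {1..n}"
    using assms Poly_Mapping.keys_add[of t "ev i"] by (auto simp: box_def monomials_def)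
  show ?thesis
  proof
    assume "t + ev i \<in> box n M"
    then have "lookup (t + ev i) i < M i" using assms(2) by (simp add: box_def)
    then show "Suc (lookup t i) < M i" by (simp add: lookup_add lookup_ev)
  next
    assume "Suc (lookup t i) < M i"
    then show "t + ev i \<in> box n M"
      using assms k by (auto simp: box_def monomials_def lookup_add lookup_ev)
  qed
qed

lemma box_add_single_imp: "t + ev i \<in> box n M \<Longrightarrow> t \<in> box n M"
  using minus_single_box[of "t + ev i" n M i] by (simp add: add_single_minus)

lemma lower_in_polys:
  assumes "f \<in> polys (box_deg n M d)"
  shows "lower n M f \<in> polys {t \<in> box n M. Suc (monom_degree t) = d}"
  unfolding polys_iff
proof (intro allI impI)
  fix t assume t: "t \<notin> {t \<in> box n M. Suc (monom_degree t) = d}"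
  have "lookup f (t + ev i) = 0" for i
    using t box_add_single_imp by (intro polys_lookup_eq_0[OF assms]) (auto simp: box_deg_def)
  then show "lookup (lower n M f) t = 0" by (simp add: lookup_lower)
qed

lemma lower_Suc_in_polys: "f \<in> polys (box_deg n M (Suc d)) \<Longrightarrow> lower n M f \<in> polys (box_deg n M d)"
  using lower_in_polys by (fastforce simp: box_deg_def)

lemma lower_0: "f \<in> polys (box_deg n M 0) \<Longrightarrow> lower n M f = 0"
  using lower_in_polys[of f n M 0] by (simp add: polys_def)

lemma box_pos: "t \<in> box n M \<Longrightarrow> i \<in> {1..n} \<Longrightarrow> M i > 0"
  by (metis (mono_tags, lifting) box_def bot_nat_0.not_eq_extremum less_nat_zero_code mem_Collect_eq)

text \<open>Operators on different variables commute, so only the terms with i = j survive. There (a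
  + 1) * (M - a - 1) - a * (M - a) = M - 1 - 2 * a, and the sum over all variables is the weight of
  degree \<open>e\<close>.\<close>

lemma sl2_commutator:
  fixes f :: "'a::comm_ring_1 mpoly"
  assumes f: "f \<in> polys (box_deg n M e)"
  shows "lower n M (lmult n M (\<lambda>_. 1) f) = lmult n M (\<lambda>_. 1) (lower n M f) + scal (of_int (int (socle_degree n M) - 2 * int e)) f"
proof (rule poly_mapping_eqI)
  fix t
  let ?E = "lmult n M (\<lambda>_. 1)" and ?F = "lower n M"
  let ?a = "\<lambda>i k. (of_nat ((k + 1) * (M i - (k + 1))) :: 'a)"
  show "lookup (?F (?E f)) t = lookup (?E (?F f) + scal (of_int (int (socle_degree n M) - 2 * int e)) f) t"
  proof (cases "t \<in> box n M")
    case False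
    have "lookup (?F (?E f)) t = 0"
      by (rule polys_lookup_eq_0[OF lower_in_polys[OF lmult_in_polys[OF f]]]) (use False in auto)
    moreover have "lookup f t = 0" by (rule polys_lookup_eq_0[OF f]) (use False in \<open>auto simp: box_deg_def\<close>)
    ultimately show ?thesis using False by (simp add: lookup_add lookup_lmult)
  next
    case True
    have FE: "lookup (?F (?E f)) t =
      (\<Sum>i=1..n. \<Sum>j=1..n. ?a i (lookup t i) * (if lookup (t + ev i) j = 0 then 0 else lookup f (t + ev i - ev j)))"
      unfolding lookup_lower
    proof (rule sum.cong[OF refl])
      fix i assume i: "i \<in> {1..n}"
      show "?a i (lookup t i) * lookup (?E f) (t + ev i) =
        (\<Sum>j=1..n. ?a i (lookup t i) * (if lookup (t + ev i) j = 0 then 0 else lookup f (t + ev i - ev j)))"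
      proof (cases "t + ev i \<in> box n M")
        case T: True
        then show ?thesis by (simp add: lookup_lmult sum_distrib_left cong: if_cong)
      next
        case F: False
        \<comment> \<open>Where raising leaves the box, the coefficient of the lowering operator is
          zero, so the truncation is invisible.\<close>
        then have "M i - (lookup t i + 1) = 0" using add_single_in_box[OF True i] by simp
        then have "?a i (lookup t i) = 0" by simp
        then show ?thesis by (simp only: mult_zero_left sum.neutral_const)
      qed
    qed
    have EF: "lookup (?E (?F f)) t =
      (\<Sum>i=1..n. \<Sum>j=1..n. if lookup t j = 0 then 0 else ?a i (lookup (t - ev j) i) * lookup f (t - ev j + ev i))"
      using True by (subst sum.swap) (simp add: lookup_lmult lookup_lower cong: if_cong, intro sum.cong refl, auto)
    have diag: "(\<Sum>j=1..n. ?a i (lookup t i) * (if lookup (t + ev i) j = 0 then 0 else lookup f (t + ev i - ev j)))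
        - (\<Sum>j=1..n. if lookup t j = 0 then 0 else ?a i (lookup (t - ev j) i) * lookup f (t - ev j + ev i))
      = of_int (int (M i - 1) - 2 * int (lookup t i)) * lookup f t" if i: "i \<in> {1..n}" for i
    proof -
      have "(\<Sum>j=1..n. ?a i (lookup t i) * (if lookup (t + ev i) j = 0 then 0 else lookup f (t + ev i - ev j)))
        - (\<Sum>j=1..n. if lookup t j = 0 then 0 else ?a i (lookup (t - ev j) i) * lookup f (t - ev j + ev i))
        = (\<Sum>j=1..n. if j = i then of_int (int (M i - 1) - 2 * int (lookup t i)) * lookup f t else 0)"
        unfolding sum_subtractf[symmetric]
      proof (rule sum.cong[OF refl])
        fix j assume "j \<in> {1..n}"
        show "?a i (lookup t i) * (if lookup (t + ev i) j = 0 then 0 else lookup f (t + ev i - ev j))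
          - (if lookup t j = 0 then 0 else ?a i (lookup (t - ev j) i) * lookup f (t - ev j + ev i))
          = (if j = i then of_int (int (M i - 1) - 2 * int (lookup t i)) * lookup f t else 0)"
        proof (cases "j = i")
          case False
          then have "lookup (t + ev i) j = lookup t j" "lookup (t - ev j) i = lookup t i"
            by (simp_all add: lookup_add lookup_minus lookup_ev)
          then show ?thesis using False add_minus_single_commute[of i j t] by (simp add: mult_ac)
        next
          case eq: True
          have lt: "lookup t i < M i" using True i by (simp add: box_def)
          then have Mi: "int (M i - (lookup t i + 1)) = int (M i) - int (lookup t i) - 1" "int (M i - 1) = int (M i) - 1"
            by (simp_all add: of_nat_diff)
          have a: "?a i (lookup t i) = of_int ((int (lookup t i) + 1) * (int (M i) - int (lookup t i) - 1))"
            unfolding Mi(1)[symmetric] by (simp add: distrib_right del: of_nat_diff)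
          have l1: "lookup (t + ev i) i \<noteq> 0" by (simp add: lookup_add lookup_ev)
          have coeff: "(if lookup t i = 0 then 0 else ?a i (lookup (t - ev i) i) * lookup f (t - ev i + ev i))
              = of_int (int (lookup t i) * (int (M i) - int (lookup t i))) * lookup f t"
          proof (cases "lookup t i = 0")
            case False
            then have "t - ev i + ev i = t" "lookup (t - ev i) i + 1 = lookup t i"
              using single_add_minus[of t i] by (simp_all add: add.commute lookup_minus lookup_ev)
            moreover have "(of_nat (lookup t i * (M i - lookup t i)) :: 'a) = of_int (int (lookup t i) * (int (M i) - int (lookup t i)))"
              using lt by (simp add: of_nat_diff)
            ultimately show ?thesis using False by (simp only: if_False)
          qed simp
          have "?a i (lookup t i) * lookup f t - of_int (int (lookup t i) * (int (M i) - int (lookup t i))) * lookup f t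
             = of_int ((int (lookup t i) + 1) * (int (M i) - int (lookup t i) - 1) - int (lookup t i) * (int (M i) - int (lookup t i))) * lookup f t"
            unfolding a by (simp only: of_int_diff left_diff_distrib)
          also have "(int (lookup t i) + 1) * (int (M i) - int (lookup t i) - 1) - int (lookup t i) * (int (M i) - int (lookup t i))
             = int (M i - 1) - 2 * int (lookup t i)"
            unfolding Mi(2) by (simp add: algebra_simps)
          finally show ?thesis unfolding eq coeff add_single_minus using l1 by simp
        qed
      qed
      also have "\<dots> = of_int (int (M i - 1) - 2 * int (lookup t i)) * lookup f t"
        using i by (simp add: sum.delta)
      finally show ?thesis .
    qed
    have tm: "t \<in> monomials n" using True by (simp add: box_def)
    have "lookup (?F (?E f)) t - lookup (?E (?F f)) t = (\<Sum>i=1..n. of_int (int (M i - 1) - 2 * int (lookup t i)) * lookup f t)"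
      unfolding FE EF by (subst sum_subtractf[symmetric]) (rule sum.cong[OF refl diag])
    also have "\<dots> = of_int (\<Sum>i=1..n. int (M i - 1) - 2 * int (lookup t i)) * lookup f t"
      by (simp only: of_int_sum sum_distrib_right)
    also have "(\<Sum>i=1..n. int (M i - 1) - 2 * int (lookup t i)) = int (socle_degree n M) - 2 * int (monom_degree t)"
      by (simp only: sum_subtractf sum_distrib_left[symmetric] of_nat_sum[symmetric] monom_degree_monomials[OF tm] socle_degree_def)
    also have "of_int (int (socle_degree n M) - 2 * int (monom_degree t)) * lookup f t
       = of_int (int (socle_degree n M) - 2 * int e) * lookup f t"
      using polys_lookup_eq_0[OF f, of t] True by (cases "monom_degree t = e") (auto simp: box_deg_def)
    finally show ?thesis unfolding lookup_add lookup_scal by (simp only: diff_eq_eq add.commute)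
  qed
qed

text \<open>Stated for abstract operators because it is applied with raising and lowering in both
  roles. Commuting \<open>E\<close> past the powers of \<open>F\<close> gives E (F^(j+1) f) = - c *
  F^j f with a positive integer c, which is nonzero in characteristic zero. Hence F^(j+1) f = 0
  forces F^j f = 0, down to f = 0.\<close>

lemma sl2_descent:
  fixes E F :: "'a::field_char_0 mpoly \<Rightarrow> 'a mpoly"
  assumes lin: "mlinear E" "mlinear F"
    and comm: "\<And>j. F (E ((F ^^ j) f)) = E (F ((F ^^ j) f)) + scal (of_nat (a + 2 * j)) ((F ^^ j) f)"
    and "a > 0" "F (E f) = 0" "(F ^^ k) f = 0"
  shows "f = 0"
proof -
  have step: "\<exists>c>0. E ((F ^^ Suc j) f) = scal (- of_nat c) ((F ^^ j) f)" for j
  proof (induction j)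
    case 0
    have "E (F f) + scal (of_nat a) f = 0" using comm[of 0] assms(5) by simp
    then have "E (F f) = scal (- of_nat a) f" by (simp add: eq_neg_iff_add_eq_0)
    then show ?case using assms(4) by auto
  next
    case (Suc j)
    then obtain c where c: "c > 0" "E ((F ^^ Suc j) f) = scal (- of_nat c) ((F ^^ j) f)" by auto
    have "scal (- of_nat c) ((F ^^ Suc j) f) = F (E ((F ^^ Suc j) f))"
      unfolding c(2) using lin(2) by (simp add: mpp.linear_scale mpp.linear_neg)
    also have "\<dots> = E ((F ^^ Suc (Suc j)) f) + scal (of_nat (a + 2 * Suc j)) ((F ^^ Suc j) f)"
      using comm[of "Suc j"] by simp
    finally have "E ((F ^^ Suc (Suc j)) f) = scal (- of_nat c) ((F ^^ Suc j) f) - scal (of_nat (a + 2 * Suc j)) ((F ^^ Suc j) f)"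
      by (simp only: eq_diff_eq)
    also have "\<dots> = scal (- of_nat (c + (a + 2 * Suc j))) ((F ^^ Suc j) f)"
      unfolding mp.scale_left_diff_distrib[symmetric] of_nat_add by (simp only: minus_add_distrib diff_conv_add_uminus add.assoc)
    finally show ?case using c(1) by (intro exI[of _ "c + (a + 2 * Suc j)"]) auto
  qed
  have down: "(F ^^ j) f = 0" if "(F ^^ Suc j) f = 0" for j
  proof -
    obtain c where "c > 0" "E ((F ^^ Suc j) f) = scal (- of_nat c) ((F ^^ j) f)" using step by blast
    moreover have "E 0 = 0" using lin(1) by (rule mpp.linear_0)
    ultimately show ?thesis using that by (simp add: mp.scale_eq_0_iff del: funpow.simps)
  qed
  have "(F ^^ j) f = 0 \<Longrightarrow> f = 0" for j
  proof (induction j)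
    case (Suc j)
    then show ?case using down by blast
  qed simp
  then show ?thesis using assms(6) by blast
qed

lemma funpow_lower:
  assumes "f \<in> polys (box_deg n M d)"
  shows "j \<le> d \<Longrightarrow> (lower n M ^^ j) f \<in> polys (box_deg n M (d - j))" and "j > d \<Longrightarrow> (lower n M ^^ j) f = 0"
proof -
  have *: "(lower n M ^^ j) f \<in> polys (box_deg n M (d - j))" if "j \<le> d" for j
    using that
  proof (induction j)
    case (Suc j)
    then have "(lower n M ^^ j) f \<in> polys (box_deg n M (Suc (d - Suc j)))" by (simp add: Suc_diff_Suc)
    then show ?case using lower_Suc_in_polys by simp
  qed (use assms in simp)
  then show "j \<le> d \<Longrightarrow> (lower n M ^^ j) f \<in> polys (box_deg n M (d - j))" .
  have "(lower n M ^^ Suc (d + k)) f = 0" for k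
  proof (induction k)
    case 0
    then show ?case using *[of d] lower_0 by simp
  next
    case (Suc k)
    then show ?case by (simp add: poly_mapping_eq_iff fun_eq_iff lookup_lower)
  qed
  moreover assume "j > d"
  ultimately show "(lower n M ^^ j) f = 0" by (metis less_iff_Suc_add)
qed

lemma funpow_lmult: "f \<in> polys (box_deg n M d) \<Longrightarrow> (lmult n M c ^^ j) f \<in> polys (box_deg n M (d + j))"
  by (induction j) (auto simp: lmult_in_polys)

lemma box_deg_empty:
  assumes "d > socle_degree n M"
  shows "box_deg n M d = {}"
proof -
  have "monom_degree t \<le> socle_degree n M" if "t \<in> box n M" for t
  proof -
    have "monom_degree t = (\<Sum>i=1..n. lookup t i)" using that by (intro monom_degree_monomials) (simp add: box_def)
    also have "\<dots> \<le> socle_degree n M"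
      unfolding socle_degree_def
    proof (rule sum_mono)
      fix i assume "i \<in> {1..n}"
      then have "lookup t i < M i" using that by (simp add: box_def)
      then show "lookup t i \<le> M i - 1" by simp
    qed
    finally show ?thesis .
  qed
  then show ?thesis using assms by (fastforce simp: box_deg_def)
qed

lemma char_0_injective:
  assumes "2 * d < socle_degree n M"
  shows "inj_on (lmult n M (\<lambda>_. 1 :: 'a::field_char_0)) (polys (box_deg n M d))"
proof (subst inj_on_polys_iff[OF mlinear_lmult], intro ballI impI)
  fix f :: "'a mpoly" assume f: "f \<in> polys (box_deg n M d)" and Ef: "lmult n M (\<lambda>_. 1) f = 0"
  show "f = 0"
  proof (rule sl2_descent[OF mlinear_lmult mlinear_lower, where a = "socle_degree n M - 2 * d" and k = "Suc d"])
    fix j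
    show "lower n M (lmult n M (\<lambda>_. 1) ((lower n M ^^ j) f)) = lmult n M (\<lambda>_. 1) (lower n M ((lower n M ^^ j) f)) +
         scal (of_nat (socle_degree n M - 2 * d + 2 * j)) ((lower n M ^^ j) f)"
    proof (cases "j \<le> d")
      case True
      have "(of_int (int (socle_degree n M) - 2 * int (d - j)) :: 'a) = of_nat (socle_degree n M - 2 * d + 2 * j)"
        using True assms by (simp add: of_nat_diff)
      then show ?thesis using sl2_commutator[OF funpow_lower(1)[OF f True]] by simp
    next
      case False
      then have "(lower n M ^^ j) f = 0" using funpow_lower(2)[OF f] by simp
      then show ?thesis
        by (simp add: mpp.linear_0[OF mlinear_lmult] mpp.linear_0[OF mlinear_lower])
    qed
  next
    show "lower n M (lmult n M (\<lambda>_. 1) f) = 0"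
      unfolding Ef by (rule mpp.linear_0[OF mlinear_lower])
    show "(lower n M ^^ Suc d) f = 0" by (rule funpow_lower(2)[OF f]) simp
  qed (use assms in auto)
qed

text \<open>Lowering followed by raising is an endomorphism of the target component. Above the
  middle the weights change sign, so the descent with exchanged roles makes it injective, and then
  it is onto by finite dimension.\<close>

lemma char_0_surjective:
  assumes "2 * Suc d > socle_degree n M"
  shows "lmult n M (\<lambda>_. 1 :: 'a::field_char_0) ` polys (box_deg n M d) = polys (box_deg n M (Suc d))"
proof -
  let ?E = "lmult n M (\<lambda>_. 1 :: 'a)" and ?F = "lower n M :: 'a mpoly \<Rightarrow> 'a mpoly" and ?V = "polys (box_deg n M (Suc d)) :: 'a mpoly set"
  have lin: "mlinear (\<lambda>f. ?E (?F f))"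
    using Vector_Spaces.linear_compose[OF mlinear_lower mlinear_lmult] by (simp add: o_def)
  have "inj_on (\<lambda>f. ?E (?F f)) ?V"
  proof (subst inj_on_polys_iff[OF lin], intro ballI impI)
    fix f assume f: "f \<in> ?V" and EF: "?E (?F f) = 0"
    show "f = 0"
    proof (rule sl2_descent[OF mlinear_lower mlinear_lmult, where a = "2 * Suc d - socle_degree n M" and k = "Suc (socle_degree n M)"])
      fix j
      have "(of_int (int (socle_degree n M) - 2 * int (Suc d + j)) :: 'a) = - of_nat (2 * Suc d - socle_degree n M + 2 * j)"
        using assms by (simp add: of_nat_diff algebra_simps)
      then have "?F (?E ((?E ^^ j) f)) = ?E (?F ((?E ^^ j) f)) - scal (of_nat (2 * Suc d - socle_degree n M + 2 * j)) ((?E ^^ j) f)"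
        using sl2_commutator[OF funpow_lmult[OF f, where c = "\<lambda>_. 1" and j = j]]
        by (simp only: mp.scale_minus_left diff_conv_add_uminus)
      then show "?E (?F ((?E ^^ j) f)) = ?F (?E ((?E ^^ j) f)) + scal (of_nat (2 * Suc d - socle_degree n M + 2 * j)) ((?E ^^ j) f)"
        by (simp only: diff_add_cancel)
    next
      \<comment> \<open>So many raisings lead beyond the socle degree, where no monomial is
        left.\<close>
      show "(?E ^^ Suc (socle_degree n M)) f = 0"
        using funpow_lmult[OF f, where c = "\<lambda>_. 1" and j = "Suc (socle_degree n M)"] box_deg_empty[of n M "Suc d + Suc (socle_degree n M)"]
        by (simp add: polys_def del: funpow.simps)
    qed (use assms EF in auto)
  qed
  then have "(\<lambda>f. ?E (?F f)) ` ?V = ?V"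
    by (intro surj_if_inj_endo lin finite_box_deg) (auto intro: lmult_in_polys lower_Suc_in_polys)
  then have "?V \<subseteq> ?E ` polys (box_deg n M d)" using lower_Suc_in_polys by blast
  then show ?thesis using lmult_in_polys by blast
qed

section \<open>Ballot monomials are not leading monomials\<close>

lemma add_single_add_minus: "lookup s i \<noteq> 0 \<Longrightarrow> s - ev i + ev i = s"
  using single_add_minus[of s i] by (simp add: add.commute)

text \<open>The sums are the coefficients of the image under the sum of all partial derivatives;
  this is the Leibniz rule for x_i * g when that operator kills g.\<close>

lemma derivation_var_mult:
  fixes g :: "'a::comm_ring_1 mpoly"
  assumes i: "i \<in> {1..n}" and g: "\<And>s. (\<Sum>k=1..n. of_nat (lookup s k + 1) * lookup g (s + ev k)) = 0"
  shows "(\<Sum>k=1..n. of_nat (lookup s k + 1) * lookup (single (ev i) 1 * g) (s + ev k)) = lookup g s"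
proof -
  have summand: "of_nat (lookup s k + 1) * lookup (single (ev i) 1 * g) (s + ev k)
     = (if lookup s i = 0 then 0 else of_nat (lookup (s - ev i) k + 1) * lookup g (s - ev i + ev k))
       + (if k = i then lookup g s else 0)" for k
  proof (cases "k = i")
    case True
    have "(of_nat (lookup s i + 1) :: 'a) * lookup g s =
        (if lookup s i = 0 then 0 else of_nat (lookup (s - ev i) i + 1) * lookup g (s - ev i + ev i)) + lookup g s"
      by (cases "lookup s i") (simp_all add: add_single_add_minus lookup_minus lookup_ev distrib_right)
    moreover have "lookup (single (ev i) 1 * g) (s + ev i) = lookup g s"
      unfolding lookup_var_mult add_single_minus by (simp add: lookup_add lookup_ev)
    ultimately show ?thesis using True by (simp only: if_True refl)
  next
    case False
    then have "lookup (s + ev k) i = lookup s i" "lookup (s - ev i) k = lookup s k"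
      by (simp_all add: lookup_add lookup_minus lookup_ev)
    then show ?thesis using False add_minus_single_commute[of k i s] by (simp add: lookup_var_mult)
  qed
  have "(\<Sum>k=1..n. of_nat (lookup s k + 1) * lookup (single (ev i) 1 * g) (s + ev k))
    = (if lookup s i = 0 then 0 else \<Sum>k=1..n. of_nat (lookup (s - ev i) k + 1) * lookup g (s - ev i + ev k))
      + (\<Sum>k=1..n. if k = i then lookup g s else 0)"
    unfolding summand sum.distrib by simp
  then show ?thesis using i g[of "s - ev i"] by (simp add: sum.delta)
qed

lemma sum_split_at:
  fixes f :: "nat \<Rightarrow> nat"
  assumes "j \<in> {1..n}"
  shows "sum f {1..n} = sum f {1..<j} + f j + sum f {j<..n}"
proof -
  have "{1..n} = insert j ({1..<j} \<union> {j<..n})" using assms by auto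
  then have "sum f {1..n} = f j + sum f ({1..<j} \<union> {j<..n})" by simp
  also have "sum f ({1..<j} \<union> {j<..n}) = sum f {1..<j} + sum f {j<..n}"
    by (rule sum.union_disjoint) auto
  finally show ?thesis by simp
qed

lemma monomial_ordering_refl: "monomial_ordering n r \<Longrightarrow> t \<in> monomials n \<Longrightarrow> (t, t) \<in> r"
  by (auto simp: monomial_ordering_def well_order_on_def order_on_defs refl_on_def)

lemma monomial_ordering_trans: "monomial_ordering n r \<Longrightarrow> (s, t) \<in> r \<Longrightarrow> (t, u) \<in> r \<Longrightarrow> (s, u) \<in> r"
  by (auto simp: monomial_ordering_def well_order_on_def order_on_defs dest: transD)

lemma monomial_ordering_antisym: "monomial_ordering n r \<Longrightarrow> (s, t) \<in> r \<Longrightarrow> (t, s) \<in> r \<Longrightarrow> s = t"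
  by (auto simp: monomial_ordering_def well_order_on_def order_on_defs dest: antisymD)

lemma monomial_ordering_add: "monomial_ordering n r \<Longrightarrow> u \<in> monomials n \<Longrightarrow> (s, t) \<in> r \<Longrightarrow> (s + u, t + u) \<in> r"
  by (auto simp: monomial_ordering_def)

lemma ev_in_monomials [simp]: "ev i \<in> monomials n \<longleftrightarrow> i \<in> {1..n}"
  by (auto simp: monomials_def)

text \<open>
  The polynomial is a product of differences \<open>x\<^sub>i - x\<^sub>j\<close> with \<open>i < j\<close>, one for each factor \<open>x\<^sub>j\<close> of the
  ballot monomial \<open>t\<close>; the ballot condition says that there is always an \<open>i < j\<close> left whose degree
  \<open>\<beta>\<^sub>i\<close> is still below its bound. The trailing monomial is \<open>t\<close>, with coefficient \<open>\<plusminus>1\<close>.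
\<close>
lemma translation_invariant_with_trailing_monomial:
  assumes ord: "monomial_ordering n r" and var: "\<And>i j. 1 \<le> i \<Longrightarrow> i < j \<Longrightarrow> j \<le> n \<Longrightarrow> (ev j, ev i) \<in> r"
    and "t \<in> box n M" "ballot n M t"
  shows "\<exists>(g :: 'a::comm_ring_1 mpoly) \<beta>.
     (\<forall>s\<in>keys g. s \<in> monomials n \<and> (t, s) \<in> r \<and> monom_degree s = monom_degree t \<and> (\<forall>i\<in>{1..n}. lookup s i \<le> \<beta> i)) \<and>
     lookup g t \<noteq> 0 \<and>
     (\<forall>s. (\<Sum>k=1..n. of_nat (lookup s k + 1) * lookup g (s + ev k)) = 0) \<and>
     (\<forall>i\<in>{1..n}. \<beta> i < M i) \<and> (\<Sum>i=1..n. \<beta> i) = 2 * monom_degree t \<and>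
     (\<forall>i\<in>{1..n}. (\<forall>k\<in>{i<..n}. lookup t k = 0) \<longrightarrow> \<beta> i = lookup t i)"
  using assms(3,4)
proof (induction "monom_degree t" arbitrary: t)
  case 0
  have t: "t = 0" using 0(1) by simp
  have "\<And>i. i \<in> {1..n} \<Longrightarrow> M i > 0" using box_pos[OF 0(2)] .
  moreover have "lookup (1 :: 'a mpoly) (s + ev k) = 0" for s k
  proof -
    have "s + ev k \<noteq> 0"
    proof
      assume "s + ev k = 0"
      then have "lookup (s + ev k) k = 0" by simp
      then show False by (simp add: lookup_add lookup_ev)
    qed
    then show ?thesis by (simp add: lookup_one)
  qed
  ultimately show ?case
    by (intro exI[of _ 1] exI[of _ "\<lambda>_. 0"])
      (auto simp: t zero_in_monomials monomial_ordering_refl[OF ord])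
next
  case (Suc d)
  have tm: "t \<in> monomials n" using Suc.prems by (simp add: box_def)
  have "keys t \<noteq> {}" using Suc.hyps by (auto simp: monom_degree_def)
  define j where "j = Max (keys t)"
  have j: "j \<in> keys t" using \<open>keys t \<noteq> {}\<close> by (simp add: j_def)
  have jmax: "lookup t k = 0" if "k > j" for k
    using that Max_ge[of "keys t" k] unfolding j_def by (metis finite_keys in_keys_iff not_le)
  have jn: "j \<in> {1..n}" using j tm by (auto simp: monomials_def)
  have tj: "lookup t j \<noteq> 0" using j by (simp add: in_keys_iff)
  define t' where "t' = t - ev j"
  have t: "t = t' + ev j" using tj by (simp add: t'_def add_single_add_minus)
  have lt: "lookup t k = lookup t' k + (if k = j then 1 else 0)" for k
    by (simp add: t lookup_add lookup_ev)
  have dt: "monom_degree t = monom_degree t' + 1" unfolding t by simp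
  have t'box: "t' \<in> box n M" unfolding t'_def by (rule minus_single_box) (rule Suc.prems)
  have "ballot n M t'"
    unfolding ballot_def
  proof
    fix k assume k: "k \<in> {1..n}"
    have "lookup t' k + 2 * (\<Sum>i=1..<k. lookup t' i) \<le> lookup t k + 2 * (\<Sum>i=1..<k. lookup t i)"
      by (intro add_mono mult_left_mono sum_mono) (auto simp: lt)
    also have "\<dots> \<le> (\<Sum>i=1..<k. M i - 1)" using Suc.prems k by (simp add: ballot_def)
    finally show "lookup t' k + 2 * (\<Sum>i=1..<k. lookup t' i) \<le> (\<Sum>i=1..<k. M i - 1)" .
  qed
  moreover have "d = monom_degree t'" using Suc.hyps dt by simp
  ultimately obtain g :: "'a mpoly" and \<beta> where
    g: "\<And>s. s \<in> keys g \<Longrightarrow> s \<in> monomials n" "\<And>s. s \<in> keys g \<Longrightarrow> (t', s) \<in> r" "\<And>s. s \<in> keys g \<Longrightarrow> monom_degree s = monom_degree t'"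
      "\<And>s i. s \<in> keys g \<Longrightarrow> i \<in> {1..n} \<Longrightarrow> lookup s i \<le> \<beta> i"
      "lookup g t' \<noteq> 0" "\<And>s. (\<Sum>k=1..n. of_nat (lookup s k + 1) * lookup g (s + ev k)) = 0"
    and \<beta>: "\<And>i. i \<in> {1..n} \<Longrightarrow> \<beta> i < M i" "(\<Sum>i=1..n. \<beta> i) = 2 * monom_degree t'"
      "\<And>i. i \<in> {1..n} \<Longrightarrow> \<forall>k\<in>{i<..n}. lookup t' k = 0 \<Longrightarrow> \<beta> i = lookup t' i"
    using Suc.hyps(1)[of t'] t'box by blast
  have top: "\<beta> i = lookup t' i" if "i \<in> {j..n}" for i
    using that jn jmax by (intro \<beta>(3)) (auto simp: lt)
  \<comment> \<open>The bounds from \<open>j\<close> on are known and all bounds add up to twice the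
    degree, so those before \<open>j\<close> sum to one less than the left side of the ballot
    condition at \<open>j\<close>. This leaves room at some \<open>i < j\<close>.\<close>
  have "(\<Sum>i=1..<j. \<beta> i) < (\<Sum>i=1..<j. M i - 1)"
  proof -
    have "(\<Sum>i\<in>{j<..n}. \<beta> i) = 0" "(\<Sum>i\<in>{j<..n}. lookup t' i) = 0"
      using jmax top by (auto simp: lt)
    moreover have "\<beta> j = lookup t' j" using top jn by simp
    moreover have "monom_degree t' = (\<Sum>i=1..n. lookup t' i)"
      using t'box by (intro monom_degree_monomials) (simp add: box_def)
    ultimately have "(\<Sum>i=1..<j. \<beta> i) = 2 * (\<Sum>i=1..<j. lookup t' i) + lookup t' j"
      using \<beta>(2) sum_split_at[OF jn, of \<beta>] sum_split_at[OF jn, of "lookup t'"] by simp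
    also have "(\<Sum>i=1..<j. lookup t' i) = (\<Sum>i=1..<j. lookup t i)"
      by (intro sum.cong) (auto simp: lt)
    finally have "(\<Sum>i=1..<j. \<beta> i) < lookup t j + 2 * (\<Sum>i=1..<j. lookup t i)" by (simp add: lt)
    also have "\<dots> \<le> (\<Sum>i=1..<j. M i - 1)" using Suc.prems jn by (simp add: ballot_def)
    finally show ?thesis .
  qed
  then obtain i where i: "i \<in> {1..<j}" "\<beta> i < M i - 1"
    by (meson not_le sum_mono)
  have in': "i \<in> {1..n}" "i \<noteq> j" using i jn by auto
  define x where "x k = single (ev k) (1 :: 'a)" for k
  define g' where "g' = x i * g - x j * g"
  define \<beta>' where "\<beta>' k = \<beta> k + (if k = i \<or> k = j then 1 else 0)" for k
  have lg': "lookup g' s = (if lookup s i = 0 then 0 else lookup g (s - ev i)) - (if lookup s j = 0 then 0 else lookup g (s - ev j))" for s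
    by (simp add: g'_def x_def lookup_minus lookup_var_mult)
  have keys_g': "\<exists>s'\<in>keys g. s = s' + ev i \<or> s = s' + ev j" if "s \<in> keys g'" for s
  proof -
    have "(lookup s i \<noteq> 0 \<and> s - ev i \<in> keys g) \<or> (lookup s j \<noteq> 0 \<and> s - ev j \<in> keys g)"
      using that by (auto simp: in_keys_iff lg' split: if_splits)
    then show ?thesis using add_single_add_minus by metis
  qed
  have ij: "(ev j, ev i) \<in> r" using i jn by (intro var) auto
  have step: "(t' + ev j, s' + ev i) \<in> r" "(t' + ev j, s' + ev j) \<in> r" if "s' \<in> keys g" for s'
  proof -
    show "(t' + ev j, s' + ev j) \<in> r"
      using monomial_ordering_add[OF ord _ g(2)[OF that], of "ev j"] jn by simp
    moreover have "(s' + ev j, s' + ev i) \<in> r"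
      using monomial_ordering_add[OF ord g(1)[OF that] ij] by (simp add: add.commute)
    ultimately show "(t' + ev j, s' + ev i) \<in> r" by (rule monomial_ordering_trans[OF ord])
  qed
  show ?case
  proof (intro exI[of _ g'] exI[of _ \<beta>'] conjI ballI allI impI)
    fix s assume "s \<in> keys g'"
    then obtain s' where s': "s' \<in> keys g" "s = s' + ev i \<or> s = s' + ev j" using keys_g' by blast
    show "s \<in> monomials n"
      using s' g(1) in' jn by (auto intro: add_in_monomials)
    show "(t, s) \<in> r" using s' step t by auto
    show "monom_degree s = monom_degree t" using s' g(3)[OF s'(1)] dt by auto
    fix k assume "k \<in> {1..n}"
    then have "lookup s' k \<le> \<beta> k" using g(4) s'(1) by blast
    then show "lookup s k \<le> \<beta>' k" using s'(2) by (auto simp: \<beta>'_def lookup_add lookup_ev)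
  next
    \<comment> \<open>If x_i * g contributed to \<open>t\<close>, then \<open>t' + ev i\<close>
      would be at most \<open>t' + ev j\<close>, against x_i > x_j. So the coefficient of
      \<open>t\<close> comes from x_j * g alone.\<close>
    have "(if lookup t i = 0 then 0 else lookup g (t - ev i)) = 0"
    proof (rule ccontr)
      assume n: "\<not> ?thesis"
      then have k: "t - ev i \<in> keys g" and li: "lookup t i \<noteq> 0" by (auto simp: in_keys_iff split: if_splits)
      have "(t' + ev i, t - ev i + ev i) \<in> r"
        using monomial_ordering_add[OF ord _ g(2)[OF k], of "ev i"] in' by simp
      then have "(t' + ev i, t) \<in> r" by (simp only: add_single_add_minus[OF li])
      moreover have "(t, t' + ev i) \<in> r" unfolding t by (rule step(1)) (use g(5) in \<open>simp add: in_keys_iff\<close>)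
      ultimately have "t' + ev i = t" by (rule monomial_ordering_antisym[OF ord])
      then have "t' + ev i = t' + ev j" by (simp only: t)
      then have "keys (ev i) = keys (ev j)" by (simp only: add_left_cancel)
      then show False using in' by simp
    qed
    then show "lookup g' t \<noteq> 0" using tj g(5) by (simp add: lg' t'_def)
  next
    fix s
    have "(\<Sum>k=1..n. of_nat (lookup s k + 1) * lookup g' (s + ev k))
       = (\<Sum>k=1..n. of_nat (lookup s k + 1) * lookup (x i * g) (s + ev k)) - (\<Sum>k=1..n. of_nat (lookup s k + 1) * lookup (x j * g) (s + ev k))"
      by (simp only: g'_def lookup_minus right_diff_distrib sum_subtractf)
    also have "\<dots> = 0" unfolding x_def using derivation_var_mult[OF in'(1) g(6)] derivation_var_mult[OF jn g(6)] by simp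
    finally show "(\<Sum>k=1..n. of_nat (lookup s k + 1) * lookup g' (s + ev k)) = 0" .
  next
    fix k assume k: "k \<in> {1..n}"
    have "lookup t j < M j" using Suc.prems jn by (simp add: box_def)
    then have "\<beta> j + 1 < M j \<or> \<beta> j + 1 = lookup t j" using top[of j] jn by (simp add: lt)
    then show "\<beta>' k < M k" using \<open>lookup t j < M j\<close> \<beta>(1)[OF k] i(2) by (auto simp: \<beta>'_def)
  next
    have "{1..n} \<inter> {k. k = i \<or> k = j} = {i, j}" using in' jn by auto
    then have "(\<Sum>k=1..n. if k = i \<or> k = j then 1 else 0 :: nat) = 2"
      using in' by (subst sum.inter_filter[symmetric]) (auto simp: Int_def)
    then show "(\<Sum>i=1..n. \<beta>' i) = 2 * monom_degree t"
      using \<beta>(2) unfolding \<beta>'_def sum.distrib by (simp add: dt)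
  next
    fix k assume k: "k \<in> {1..n}" "\<forall>l\<in>{k<..n}. lookup t l = 0"
    have "k \<ge> j" using k(2) tj jn by (meson atLeastAtMost_iff greaterThanAtMost_iff not_le)
    then have "\<beta> k = lookup t' k" "k \<noteq> i" using top[of k] k(1) i by auto
    then show "\<beta>' k = lookup t k" by (simp add: \<beta>'_def lt)
  qed
qed

text \<open>The transpose of multiplication is contraction of the functional \<open>w\<close>; since
  \<open>w\<close> vanishes off the box, truncating the product does not affect the pairing.\<close>

lemma lmult_pairing:
  fixes w :: "monomial \<Rightarrow> 'a::comm_ring_1"
  assumes f: "f \<in> polys (box_deg n M d)" and supp: "\<And>s. s \<notin> box n M \<Longrightarrow> w s = 0"
  shows "(\<Sum>s\<in>box_deg n M (Suc d). lookup (lmult n M c f) s * w s) = (\<Sum>s\<in>box_deg n M d. lookup f s * (\<Sum>i=1..n. c i * w (s + ev i)))"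
proof -
  have "(\<Sum>s\<in>box_deg n M (Suc d). lookup (lmult n M c f) s * w s)
     = (\<Sum>s\<in>box_deg n M (Suc d). \<Sum>i=1..n. (if lookup s i = 0 then 0 else c i * lookup f (s - ev i)) * w s)"
    by (rule sum.cong) (auto simp: lookup_lmult sum_distrib_right box_deg_def)
  also have "\<dots> = (\<Sum>i=1..n. \<Sum>s\<in>box_deg n M (Suc d). (if lookup s i = 0 then 0 else c i * lookup f (s - ev i)) * w s)"
    by (rule sum.swap)
  also have "\<dots> = (\<Sum>i=1..n. \<Sum>s\<in>box_deg n M d. c i * lookup f s * w (s + ev i))"
  proof (rule sum.cong[OF refl])
    fix i assume "i \<in> {1..n}"
    show "(\<Sum>s\<in>box_deg n M (Suc d). (if lookup s i = 0 then 0 else c i * lookup f (s - ev i)) * w s)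
       = (\<Sum>s\<in>box_deg n M d. c i * lookup f s * w (s + ev i))"
    proof (rule sum.reindex_bij_witness_not_neutral[where S' = "{s \<in> box_deg n M (Suc d). lookup s i = 0}"
          and T' = "{s \<in> box_deg n M d. s + ev i \<notin> box n M}" and j = "\<lambda>s. s - ev i" and i = "\<lambda>s. s + ev i"])
      fix s assume s: "s \<in> box_deg n M (Suc d) - {s \<in> box_deg n M (Suc d). lookup s i = 0}"
      then have l: "lookup s i \<noteq> 0" by simp
      show "s - ev i + ev i = s" by (rule add_single_add_minus[OF l])
      show "s - ev i \<in> box_deg n M d - {s \<in> box_deg n M d. s + ev i \<notin> box n M}"
        using s monom_degree_minus_single[OF l] minus_single_box[of s n M i]
        by (auto simp: box_deg_def add_single_add_minus[OF l])
    next
      fix s assume s: "s \<in> box_deg n M (Suc d)"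
      show "c i * lookup f (s - ev i) * w (s - ev i + ev i) = (if lookup s i = 0 then 0 else c i * lookup f (s - ev i)) * w s"
      proof (cases "lookup s i = 0")
        case True
        then have "s - ev i = s" by (intro poly_mapping_eqI) (auto simp: lookup_minus lookup_ev)
        moreover have "lookup f s = 0" using s by (intro polys_lookup_eq_0[OF f]) (simp add: box_deg_def)
        ultimately show ?thesis using True by simp
      qed (simp add: add_single_add_minus)
    next
      fix s assume s: "s \<in> box_deg n M d - {s \<in> box_deg n M d. s + ev i \<notin> box n M}"
      show "s + ev i - ev i = s" by (rule add_single_minus)
      show "s + ev i \<in> box_deg n M (Suc d) - {s \<in> box_deg n M (Suc d). lookup s i = 0}"
        using s by (auto simp: box_deg_def lookup_add lookup_ev)
    qed (auto simp: supp)
  qed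
  also have "\<dots> = (\<Sum>s\<in>box_deg n M d. \<Sum>i=1..n. c i * lookup f s * w (s + ev i))" by (rule sum.swap)
  also have "\<dots> = (\<Sum>s\<in>box_deg n M d. lookup f s * (\<Sum>i=1..n. c i * w (s + ev i)))"
    by (simp add: sum_distrib_left mult_ac)
  finally show ?thesis .
qed

text \<open>An element of the inverse system is a functional that annihilates the image. Its support
  lies above \<open>t\<close>, while that of a polynomial with leading monomial \<open>t\<close>
  lies below \<open>t\<close>, so their pairing would be the single nonzero product at
  \<open>t\<close>.\<close>

lemma ballot_not_leading:
  assumes ord: "monomial_ordering n r" and var: "\<And>i j. 1 \<le> i \<Longrightarrow> i < j \<Longrightarrow> j \<le> n \<Longrightarrow> (ev j, ev i) \<in> r"
    and char: "\<And>i k. i \<in> {1..n} \<Longrightarrow> 0 < k \<Longrightarrow> k < M i \<Longrightarrow> (of_nat k :: 'a::field) \<noteq> 0"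
    and t: "t \<in> ballot_deg n M (Suc d)"
  shows "t \<notin> leads r (lmult n M (\<lambda>_. 1 :: 'a) ` polys (box_deg n M d))"
proof
  assume "t \<in> leads r (lmult n M (\<lambda>_. 1 :: 'a) ` polys (box_deg n M d))"
  then obtain f where f: "f \<in> polys (box_deg n M d)" and
    u: "t \<in> keys (lmult n M (\<lambda>_. 1 :: 'a) f)" "\<And>s. s \<in> keys (lmult n M (\<lambda>_. 1 :: 'a) f) \<Longrightarrow> (s, t) \<in> r"
    by (auto simp: leads_def)
  have tb: "t \<in> box n M" "ballot n M t" "monom_degree t = Suc d" using t by (auto simp: ballot_deg_def box_deg_def)
  obtain g :: "'a mpoly" and \<beta> where
    g: "\<And>s. s \<in> keys g \<Longrightarrow> s \<in> monomials n" "\<And>s. s \<in> keys g \<Longrightarrow> (t, s) \<in> r"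
      "\<And>s i. s \<in> keys g \<Longrightarrow> i \<in> {1..n} \<Longrightarrow> lookup s i \<le> \<beta> i"
      "lookup g t \<noteq> 0" "\<And>s. (\<Sum>k=1..n. of_nat (lookup s k + 1) * lookup g (s + ev k)) = 0"
    and \<beta>: "\<And>i. i \<in> {1..n} \<Longrightarrow> \<beta> i < M i"
    using translation_invariant_with_trailing_monomial[OF ord var tb(1,2), where 'a = 'a] by blast
  \<comment> \<open>Factorials turn contraction into differentiation, so that a polynomial killed by
    the sum of the derivatives becomes a functional killed by the transpose.\<close>
  define F where "F s = (\<Prod>i=1..n. fact (lookup s i) :: nat)" for s
  define w where "w s = of_nat (F s) * lookup g s" for s
  have supp: "w s = 0" if "s \<notin> box n M" for s
  proof -
    have "s \<notin> keys g"
    proof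
      assume s: "s \<in> keys g"
      have "lookup s i < M i" if "i \<in> {1..n}" for i using g(3)[OF s that] \<beta>[OF that] by simp
      then show False using that g(1)[OF s] by (simp add: box_def)
    qed
    then show ?thesis by (simp add: w_def in_keys_iff)
  qed
  have F: "F (s + ev i) = F s * (lookup s i + 1)" if "i \<in> {1..n}" for s i
  proof -
    have "F (s + ev i) = fact (lookup s i + 1) * (\<Prod>k\<in>{1..n} - {i}. fact (lookup s k))"
      unfolding F_def using that
      by (subst prod.remove[of _ i]) (auto simp: lookup_add lookup_ev intro!: prod.cong)
    moreover have "F s = fact (lookup s i) * (\<Prod>k\<in>{1..n} - {i}. fact (lookup s k))"
      unfolding F_def using that by (subst prod.remove[of _ i]) auto
    ultimately show ?thesis by (simp add: algebra_simps)
  qed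
  have "(\<Sum>i=1..n. 1 * w (s + ev i)) = of_nat (F s) * (\<Sum>i=1..n. of_nat (lookup s i + 1) * lookup g (s + ev i))" for s
    unfolding sum_distrib_left
    by (rule sum.cong) (simp_all only: w_def F of_nat_mult mult_1_left mult.assoc)
  then have "(\<Sum>i=1..n. 1 * w (s + ev i)) = 0" for s using g(5) by simp
  moreover have "(\<Sum>s\<in>box_deg n M (Suc d). lookup (lmult n M (\<lambda>_. 1) f) s * w s)
      = (\<Sum>s\<in>box_deg n M d. lookup f s * (\<Sum>i=1..n. 1 * w (s + ev i)))"
    by (rule lmult_pairing[OF f supp])
  ultimately have "(\<Sum>s\<in>box_deg n M (Suc d). lookup (lmult n M (\<lambda>_. 1) f) s * w s) = 0" by simp
  moreover have "(\<Sum>s\<in>box_deg n M (Suc d). lookup (lmult n M (\<lambda>_. 1) f) s * w s)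
      = (\<Sum>s\<in>{t}. lookup (lmult n M (\<lambda>_. 1) f) s * w s)"
  proof (rule sum.mono_neutral_right)
    show "{t} \<subseteq> box_deg n M (Suc d)" using tb by (simp add: box_deg_def)
    show "\<forall>s\<in>box_deg n M (Suc d) - {t}. lookup (lmult n M (\<lambda>_. 1) f) s * w s = 0"
    proof (rule ballI, rule ccontr)
      fix s assume s: "s \<in> box_deg n M (Suc d) - {t}" "lookup (lmult n M (\<lambda>_. 1) f) s * w s \<noteq> 0"
      then have "(s, t) \<in> r" "(t, s) \<in> r" by (auto intro!: u(2) g(2) simp: in_keys_iff w_def)
      then show False using monomial_ordering_antisym[OF ord] s(1) by blast
    qed
  qed simp
  ultimately have "lookup (lmult n M (\<lambda>_. 1) f) t * w t = 0" by simp
  \<comment> \<open>Here the characteristic matters: the exponents of \<open>t\<close> are below the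
    bounds \<open>M\<close>, so \<open>char\<close> makes their factorials nonzero.\<close>
  moreover have "(of_nat (F t) :: 'a) \<noteq> 0"
  proof -
    have "(of_nat (fact k) :: 'a) \<noteq> 0" if "i \<in> {1..n}" "k < M i" for i k
      using that(2)
    proof (induction k)
      case (Suc k)
      then have "(of_nat (fact k) :: 'a) \<noteq> 0" by simp
      moreover have "(of_nat (Suc k) :: 'a) \<noteq> 0" using Suc.prems by (intro char[OF that(1)]) auto
      ultimately show ?case by (simp only: fact_Suc of_nat_mult of_nat_id mult_eq_0_iff de_Morgan_disj) simp
    qed simp
    then show ?thesis using tb(1) by (simp add: F_def box_def)
  qed
  ultimately show False using u(1) g(4) by (simp add: w_def in_keys_iff)
qed

section \<open>Reduction to the sum of the variables\<close>

definition lefschetz :: "nat \<Rightarrow> (nat \<Rightarrow> nat) \<Rightarrow> (nat \<Rightarrow> 'a::comm_ring_1) \<Rightarrow> bool"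
  where "lefschetz n M c \<longleftrightarrow> (\<forall>d. inj_on (lmult n M c) (polys (box_deg n M d)) \<or>
     lmult n M c ` polys (box_deg n M d) = polys (box_deg n M (Suc d)))"

definition twist :: "(monomial \<Rightarrow> 'a::comm_ring_1) \<Rightarrow> 'a mpoly \<Rightarrow> 'a mpoly"
  where "twist h f = Poly_Mapping.mapp (\<lambda>t c. h t * c) f"

lemma lookup_twist [simp]: "lookup (twist h f) t = h t * lookup f t"
  by (auto simp: twist_def lookup_mapp when_def in_keys_iff)

lemma twist_in_polys: "f \<in> polys X \<Longrightarrow> twist h f \<in> polys X"
  by (auto simp: polys_iff)

text \<open>
  Variables with nonzero coefficient are rescaled; the remaining variables, indexed by \<open>Z\<close>, give a
  grading for which the linear form with coefficients \<open>c\<close> is the lowest component of the sum of all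
  variables.
\<close>
lemma lefschetz_sum_of_variables:
  fixes c :: "nat \<Rightarrow> 'a::field"
  assumes lef: "lefschetz n M c"
  shows "lefschetz n M (\<lambda>_. 1 :: 'a)"
  unfolding lefschetz_def
proof
  fix d
  define Z where "Z = {i\<in>{1..n}. c i = 0}"
  define wt :: "monomial \<Rightarrow> nat" where "wt t = (\<Sum>i\<in>Z. lookup t i)" for t
  \<comment> \<open>Scaling x_i by \<open>\<gamma> i\<close> multiplies the monomial
    \<open>t\<close> by \<open>G t\<close>. On \<open>Z\<close> the value 1 is a placeholder that
    keeps \<open>G\<close> nonzero.\<close>
  define \<gamma> where "\<gamma> i = (if c i = 0 then 1 else c i)" for i
  define G where "G t = (\<Prod>i=1..n. \<gamma> i ^ lookup t i)" for t
  let ?E = "lmult n M (\<lambda>_. 1 :: 'a)" and ?V = "polys (box_deg n M d) :: 'a mpoly set" and ?W = "polys (box_deg n M (Suc d)) :: 'a mpoly set"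
  have finZ: "finite Z" by (simp add: Z_def)
  have G0: "G t \<noteq> 0" for t by (simp add: G_def \<gamma>_def)
  have G_step: "G t = G (t - ev i) * c i" if "i \<in> {1..n}" "i \<notin> Z" "lookup t i \<noteq> 0" for t i
  proof -
    have "G t = (\<Prod>k=1..n. \<gamma> k ^ lookup (t - ev i) k * (if k = i then \<gamma> i else 1))"
      unfolding G_def
    proof (rule prod.cong[OF refl])
      fix k
      show "\<gamma> k ^ lookup t k = \<gamma> k ^ lookup (t - ev i) k * (if k = i then \<gamma> i else 1)"
        using that(3) by (cases "lookup t i") (auto simp: lookup_minus lookup_ev)
    qed
    also have "\<dots> = G (t - ev i) * \<gamma> i"
      using that(1) by (simp add: prod.distrib G_def prod.delta)
    finally show ?thesis using that by (simp add: \<gamma>_def Z_def)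
  qed
  have wt_step: "wt t = wt (t - ev i) + (if i \<in> Z then 1 else 0)" if "lookup t i \<noteq> 0" for t i
  proof -
    have "wt t = (\<Sum>k\<in>Z. lookup (t - ev i) k + (if k = i then 1 else 0))"
      unfolding wt_def using that by (intro sum.cong) (auto simp: lookup_minus lookup_ev)
    then show ?thesis using finZ by (simp add: sum.distrib wt_def sum.delta)
  qed
  consider "inj_on (lmult n M c) ?V" | "lmult n M c ` ?V = ?W" using lef by (auto simp: lefschetz_def)
  then show "inj_on ?E ?V \<or> ?E ` ?V = ?W"
  proof cases
    case 1
    have "f = 0" if f: "f \<in> ?V" "?E f = 0" for f
    proof (rule ccontr)
      assume "f \<noteq> 0"
      then have ne: "keys f \<noteq> {}" by simp
      define w where "w = Min (wt ` keys f)"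
      have w: "w \<le> wt t" if "lookup f t \<noteq> 0" for t using that by (simp add: w_def in_keys_iff)
      have "w \<in> wt ` keys f" using ne by (simp add: w_def)
      then obtain t0 where t0: "t0 \<in> keys f" "wt t0 = w" by auto
      \<comment> \<open>The rescaled lowest part of \<open>f\<close> is killed by the form with
        coefficients \<open>c\<close>: a variable in \<open>Z\<close> raises the weight, so it
        reaches weight \<open>w\<close> only from smaller weights, where \<open>f\<close> is
        zero.\<close>
      define f0 where "f0 = twist (\<lambda>t. if wt t = w then G t else 0) f"
      have "lmult n M c f0 = 0"
      proof (rule poly_mapping_eqI)
        fix t
        have "(if lookup t i = 0 then 0 else c i * lookup f0 (t - ev i))
          = (if wt t = w then G t * (if lookup t i = 0 then 0 else 1 * lookup f (t - ev i)) else 0)"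
          if i: "i \<in> {1..n}" for i
        proof (cases "lookup t i = 0 \<or> i \<in> Z")
          case True
          show ?thesis
          proof (cases "lookup t i = 0")
            case False
            then have iZ: "i \<in> Z" using True by simp
            have "lookup f (t - ev i) = 0" if "wt t = w"
              using w[of "t - ev i"] wt_step[OF False] iZ that by force
            then show ?thesis using iZ by (simp add: Z_def)
          qed simp
        next
          case False
          then show ?thesis using wt_step[of t i] G_step[OF i, of t] by (simp add: f0_def mult_ac)
        qed
        then have "(\<Sum>i=1..n. if lookup t i = 0 then 0 else c i * lookup f0 (t - ev i))
           = (\<Sum>i=1..n. if wt t = w then G t * (if lookup t i = 0 then 0 else 1 * lookup f (t - ev i)) else 0)"
          by (rule sum.cong[OF refl])
        also have "\<dots> = (if wt t = w then G t * (\<Sum>i=1..n. if lookup t i = 0 then 0 else 1 * lookup f (t - ev i)) else 0)"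
          by (simp add: sum_distrib_left)
        also have "\<dots> = 0" if "t \<in> box n M"
          using arg_cong[OF f(2), of "\<lambda>f. lookup f t"] that by (simp add: lookup_lmult)
        finally show "lookup (lmult n M c f0) t = lookup 0 t" by (simp add: lookup_lmult)
      qed
      moreover have "f0 \<in> ?V" unfolding f0_def by (rule twist_in_polys[OF f(1)])
      ultimately have "f0 = 0" using 1 by (simp add: inj_on_polys_iff[OF mlinear_lmult])
      then have "lookup f0 t0 = 0" by simp
      then show False using t0 G0 by (simp add: f0_def in_keys_iff)
    qed
    then show ?thesis by (simp add: inj_on_polys_iff[OF mlinear_lmult])
  next
    case 2
    define U where "U = ?E ` ?V"
    have U: "mp.subspace U" unfolding U_def by (rule subspace_image_polys[OF mlinear_lmult])
    have wle: "wt t \<le> Suc d" if "t \<in> box_deg n M (Suc d)" for t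
    proof -
      have "wt t \<le> (\<Sum>i=1..n. lookup t i)" unfolding wt_def by (rule sum_mono2) (auto simp: Z_def)
      then show ?thesis using that monom_degree_monomials[of t n] by (simp add: box_deg_def box_def)
    qed
    \<comment> \<open>Downward induction on the least weight in \<open>g\<close>: surjectivity for
      \<open>c\<close> reaches the lowest part, and the remainder has larger weights. No weight
      exceeds \<open>Suc d\<close>, so for \<open>k = 0\<close> only the zero polynomial is
      left.\<close>
    have "\<forall>g\<in>?W. (\<forall>t\<in>keys g. Suc (Suc d) - k \<le> wt t) \<longrightarrow> g \<in> U" for k
    proof (induction k)
      case 0
      have "g = 0" if "g \<in> ?W" "\<forall>t\<in>keys g. Suc (Suc d) \<le> wt t" for g
        using that wle by (subst keys_eq_empty[symmetric]) (fastforce simp: polys_def)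
      moreover have "0 \<in> U" using U by (rule mp.subspace_0)
      ultimately show ?case by (metis diff_zero)
    next
      case (Suc k)
      show ?case
      proof (cases "k \<le> Suc d")
        case False
        then show ?thesis using Suc by simp
      next
        case True
        define w where "w = Suc d - k"
        have w: "Suc (Suc d) - k = Suc w" "Suc (Suc d) - Suc k = w" using True by (auto simp: w_def)
        show ?thesis
        proof (intro ballI impI)
          fix g assume g: "g \<in> ?W" "\<forall>t\<in>keys g. Suc (Suc d) - Suc k \<le> wt t"
          define g0 where "g0 = twist (\<lambda>t. if wt t = w then G t else 0) g"
          have "g0 \<in> ?W" unfolding g0_def by (rule twist_in_polys[OF g(1)])
          then obtain f where f: "f \<in> ?V" "lmult n M c f = g0" using 2 by (metis imageE)
          define f0 where "f0 = twist (\<lambda>t. if wt t = w then inverse (G t) else 0) f"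
          have f0V: "f0 \<in> ?V" unfolding f0_def by (rule twist_in_polys[OF f(1)])
          have eqw: "lookup (?E f0) t = lookup g t" if t: "t \<in> box n M" "wt t = w" for t
          proof -
            have "(if lookup t i = 0 then 0 else 1 * lookup f0 (t - ev i))
              = inverse (G t) * (if lookup t i = 0 then 0 else c i * lookup f (t - ev i))"
              if i: "i \<in> {1..n}" for i
            proof (cases "lookup t i = 0 \<or> i \<in> Z")
              case True
              then show ?thesis using wt_step[of t i] t(2) by (auto simp: f0_def Z_def)
            next
              case False
              then have "c i \<noteq> 0" using i by (simp add: Z_def)
              then show ?thesis using False wt_step[of t i] G_step[OF i, of t] t(2) G0
                by (simp add: f0_def field_simps)
            qed
            then have "lookup (?E f0) t = (\<Sum>i=1..n. inverse (G t) * (if lookup t i = 0 then 0 else c i * lookup f (t - ev i)))"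
              unfolding lookup_lmult if_P[OF t(1)] by (rule sum.cong[OF refl])
            also have "\<dots> = inverse (G t) * lookup (lmult n M c f) t"
              using t(1) by (simp add: lookup_lmult sum_distrib_left)
            also have "\<dots> = lookup g t" using G0 t(2) by (simp add: f(2) g0_def)
            finally show ?thesis .
          qed
          have low: "lookup (?E f0) t = 0" if "t \<in> box n M" "wt t < w" for t
          proof -
            have "(if lookup t i = 0 then 0 else 1 * lookup f0 (t - ev i)) = 0" for i
              using wt_step[of t i] that(2) by (auto simp: f0_def)
            then show ?thesis using that(1) by (simp add: lookup_lmult)
          qed
          have EW: "?E f0 \<in> ?W" by (rule lmult_in_polys[OF f0V])
          have gE: "g - ?E f0 \<in> ?W" using mp.subspace_diff[OF subspace_polys g(1) EW] .
          have "Suc w \<le> wt t" if t: "t \<in> keys (g - ?E f0)" for t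
          proof (rule ccontr)
            assume "\<not> Suc w \<le> wt t"
            then consider "wt t = w" | "wt t < w" by linarith
            moreover have "t \<in> box n M" using t gE by (auto simp: polys_def box_deg_def)
            moreover have "lookup g t = 0" if "wt t < w" using g(2) that w(2) by (metis in_keys_iff not_le)
            ultimately have "lookup (g - ?E f0) t = 0" using eqw low by cases (auto simp: lookup_minus)
            then show False using t by (simp add: in_keys_iff)
          qed
          then have "g - ?E f0 \<in> U" using Suc gE w by auto
          moreover have "?E f0 \<in> U" using f0V by (simp add: U_def)
          ultimately have "g - ?E f0 + ?E f0 \<in> U" by (rule mp.subspace_add[OF U])
          then show "g \<in> U" by simp
        qed
      qed
    qed
    from this[of "Suc (Suc d)"] have "?W \<subseteq> U" by auto
    then have "?E ` ?V = ?W" using lmult_in_polys by (auto simp: U_def)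
    then show ?thesis by simp
  qed
qed

section \<open>Small characteristic\<close>

definition vec :: "nat \<Rightarrow> (nat \<Rightarrow> nat) \<Rightarrow> monomial"
  where "vec n w = (\<Sum>i=1..n. single i (w i))"

lemma lookup_vec: "lookup (vec n w) i = (if i \<in> {1..n} then w i else 0)"
  by (simp add: vec_def lookup_sum lookup_single when_def sum.delta)

lemma vec_in_monomials [simp]: "vec n w \<in> monomials n"
  by (auto simp: monomials_def in_keys_iff lookup_vec split: if_splits)

lemma monom_degree_vec: "monom_degree (vec n w) = (\<Sum>i=1..n. w i)"
  by (simp add: monom_degree_monomials[OF vec_in_monomials] lookup_vec)

lemma restr_lmult: "lmult n M c (restr (box n M) f) = lmult n M c f"
proof (rule poly_mapping_eqI)
  fix t
  show "lookup (lmult n M c (restr (box n M) f)) t = lookup (lmult n M c f) t"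
    using minus_single_box[of t n M] by (simp add: lookup_lmult cong: if_cong)
qed

lemma funpow_lmult_eq: "(lmult n M c ^^ j) (restr (box n M) f) = restr (box n M) (lin n c ^ j * f)"
proof (induction j)
  case (Suc j)
  then show ?case using restr_lmult[of n M c "lin n c ^ j * f"] by (simp add: lmult_def mult.assoc)
qed simp

text \<open>Additivity of q-th powers is applied to polynomials, so it is the characteristic of the
  polynomial ring that has to be prime.\<close>

lemma CHAR_mpoly: "CHAR('a::comm_ring_1 mpoly) = CHAR('a)"
proof (rule CHAR_eqI)
  have "(of_nat k :: 'a mpoly) = 0 \<longleftrightarrow> (of_nat k :: 'a) = 0" for k
    unfolding single_of_nat[symmetric] by (metis lookup_single_eq lookup_zero single_zero)
  then show "of_nat CHAR('a) = (0 :: 'a mpoly)" "\<And>k. of_nat k = (0 :: 'a mpoly) \<Longrightarrow> CHAR('a) dvd k"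
    by (simp_all add: of_nat_eq_0_iff_char_dvd)
qed

lemma power_single: "single (single i 1) (c :: 'a::comm_ring_1) ^ k = single (single i k) (c ^ k)"
  by (induction k) (simp_all add: mult_single single_add[symmetric])

lemma frobenius_lin:
  fixes c :: "nat \<Rightarrow> 'a::comm_ring_1"
  assumes "prime CHAR('a)" "q = CHAR('a) ^ e"
  shows "lin n c ^ q = (\<Sum>i=1..n. single (single i q) (c i ^ q))"
proof -
  have *: "prime CHAR('a mpoly)" "q = CHAR('a mpoly) ^ e" using assms by (simp_all add: CHAR_mpoly)
  show ?thesis
    unfolding lin_def ev_def freshmans_dream_sum'[OF *] power_single ..
qed

text \<open>
  Substituting \<open>x\<^sub>i\<^sup>q\<close> into \<open>h\<close> and multiplying by a monomial gives an element killed by the \<open>q\<close>-th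
  power of the linear form, because that power is additive.
\<close>
lemma frobenius_kernel:
  fixes c :: "nat \<Rightarrow> 'a::comm_ring_1"
  assumes char: "prime CHAR('a)" "q = CHAR('a) ^ e"
    and K: "\<And>i. i \<in> {1..n} \<Longrightarrow> K i \<ge> 1 \<and> u i + q * (K i - 1) < M i \<and> M i \<le> u i + q * K i"
    and h: "h \<in> polys (box_deg n K s)" "h \<noteq> 0" "lmult n K (\<lambda>i. c i ^ q) h = 0"
  shows "\<exists>f d. f \<noteq> 0 \<and> f \<in> polys (box_deg n M d) \<and> lmult n M c f = 0 \<and> d < (\<Sum>i=1..n. u i) + q * s + q"
proof -
  have q: "q > 0" using char by (simp add: prime_gt_0_nat)
  \<comment> \<open>The monomial with exponents \<open>u\<close> times the substitution of q-th
    powers. By the assumption on \<open>K\<close>, the bound \<open>K i\<close> is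
    \<open>(M i - u i) / q\<close> rounded up, so \<open>\<psi>\<close> respects the two
    boxes.\<close>
  define \<psi> where "\<psi> t = vec n (\<lambda>i. u i + q * lookup t i)" for t :: monomial
  have lpsi: "lookup (\<psi> t) i = (if i \<in> {1..n} then u i + q * lookup t i else 0)" for t i
    by (simp add: \<psi>_def lookup_vec)
  have inj: "s = t" if "\<psi> s = \<psi> t" "s \<in> monomials n" "t \<in> monomials n" for s t
  proof (rule poly_mapping_eqI)
    fix i
    show "lookup s i = lookup t i"
      using arg_cong[OF that(1), of "\<lambda>t. lookup t i"] monomials_lookup_eq_0[OF that(2), of i] monomials_lookup_eq_0[OF that(3), of i] q
      by (cases "i \<in> {1..n}") (auto simp: lpsi)
  qed
  have box: "\<psi> t \<in> box n M \<longleftrightarrow> t \<in> box n K" if t: "t \<in> monomials n" for t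
  proof -
    have "u i + q * lookup t i < M i \<longleftrightarrow> lookup t i < K i" if i: "i \<in> {1..n}" for i
    proof
      assume "u i + q * lookup t i < M i"
      then have "q * lookup t i < q * K i" using K[OF i] by linarith
      then show "lookup t i < K i" by simp
    next
      assume "lookup t i < K i"
      then have "q * lookup t i \<le> q * (K i - 1)" using q by (intro mult_le_mono) auto
      then show "u i + q * lookup t i < M i" using K[OF i] by linarith
    qed
    then show ?thesis using t by (simp add: box_def lpsi \<psi>_def[symmetric]) (simp add: \<psi>_def)
  qed
  have deg: "monom_degree (\<psi> t) = (\<Sum>i=1..n. u i) + q * monom_degree t" if "t \<in> monomials n" for t
    by (simp add: \<psi>_def monom_degree_vec sum.distrib sum_distrib_left[symmetric] monom_degree_monomials[OF that])
  have psi_add: "single i q + \<psi> t = \<psi> (t + ev i)" if "i \<in> {1..n}" for i t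
    using that by (intro poly_mapping_eqI) (auto simp: lookup_add lpsi lookup_ev lookup_single when_def)
  define \<phi> where "\<phi> = (\<Sum>t\<in>box_deg n K s. single (\<psi> t) (lookup h t))"
  have bm: "box_deg n K s \<subseteq> monomials n" by (rule box_subset)
  have phi_polys: "\<phi> \<in> polys (box_deg n M ((\<Sum>i=1..n. u i) + q * s))"
  proof -
    have "keys \<phi> \<subseteq> \<psi> ` box_deg n K s"
      using keys_sum[of "\<lambda>t. single (\<psi> t) (lookup h t)" "box_deg n K s"] by (fastforce simp: \<phi>_def split: if_splits)
    also have "\<dots> \<subseteq> box_deg n M ((\<Sum>i=1..n. u i) + q * s)"
      using bm box deg by (auto simp: box_deg_def subset_iff)
    finally show ?thesis by (simp add: polys_def)
  qed
  have lphi: "lookup \<phi> (\<psi> t) = lookup h t" if "t \<in> box_deg n K s" for t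
  proof -
    have "lookup \<phi> (\<psi> t) = (\<Sum>s\<in>box_deg n K s. if s = t then lookup h t else 0)"
      unfolding \<phi>_def lookup_sum lookup_single
      by (rule sum.cong) (use bm inj that in \<open>auto simp: when_def\<close>)
    then show ?thesis using that by (simp add: sum.delta)
  qed
  obtain t where "t \<in> keys h" using h(2) by (metis all_not_in_conv keys_eq_empty)
  then have "t \<in> box_deg n K s" "lookup h t \<noteq> 0" using h(1) by (auto simp: polys_def in_keys_iff)
  then have phi0: "\<phi> \<noteq> 0" using lphi[of t] by auto
  have kill: "restr (box n M) (lin n c ^ q * \<phi>) = 0"
  proof (rule poly_mapping_eqI)
    fix v
    have "lookup (lin n c ^ q * \<phi>) v = 0" if v: "v \<in> box n M"
    proof -
      have "lin n c ^ q * \<phi> = (\<Sum>i=1..n. \<Sum>t\<in>box_deg n K s. single (\<psi> (t + ev i)) (c i ^ q * lookup h t))"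
        unfolding frobenius_lin[OF char] \<phi>_def sum_product
        by (intro sum.cong refl) (simp add: mult_single psi_add)
      then have eq: "lookup (lin n c ^ q * \<phi>) v = (\<Sum>i=1..n. \<Sum>t\<in>box_deg n K s. c i ^ q * lookup h t when \<psi> (t + ev i) = v)"
        by (simp add: lookup_sum lookup_single)
      show ?thesis
      \<comment> \<open>Off the image of \<open>\<psi>\<close> all coefficients vanish; on it they
        are those of \<open>h\<close> times the form with coefficients
        \<open>c i ^ q\<close>.\<close>
      proof (cases "\<exists>w\<in>monomials n. \<psi> w = v")
        case False
        moreover have "t + ev i \<in> monomials n" if "i \<in> {1..n}" "t \<in> box_deg n K s" for i t
          using that bm by (intro add_in_monomials) auto
        ultimately have "\<psi> (t + ev i) \<noteq> v" if "i \<in> {1..n}" "t \<in> box_deg n K s" for i t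
          using that by blast
        then show ?thesis unfolding eq by (intro sum.neutral) auto
      next
        case True
        then obtain w where w: "w \<in> monomials n" "\<psi> w = v" by auto
        have wK: "w \<in> box n K" using box[OF w(1)] v w(2) by simp
        have "(\<Sum>t\<in>box_deg n K s. c i ^ q * lookup h t when \<psi> (t + ev i) = v)
            = (if lookup w i = 0 then 0 else c i ^ q * lookup h (w - ev i))" if i: "i \<in> {1..n}" for i
        proof -
          have *: "\<psi> (t + ev i) = v \<longleftrightarrow> lookup w i \<noteq> 0 \<and> t = w - ev i" if t: "t \<in> box_deg n K s" for t
          proof
            assume "\<psi> (t + ev i) = v"
            moreover have "t + ev i \<in> monomials n" using t i bm by (intro add_in_monomials) auto
            ultimately have "w = t + ev i" using inj[of "t + ev i" w] w by simp
            then show "lookup w i \<noteq> 0 \<and> t = w - ev i" by (simp add: lookup_add lookup_ev add_single_minus)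
          next
            assume "lookup w i \<noteq> 0 \<and> t = w - ev i"
            then show "\<psi> (t + ev i) = v" using add_single_add_minus[of w i] w(2) by simp
          qed
          have "(\<Sum>t\<in>box_deg n K s. c i ^ q * lookup h t when \<psi> (t + ev i) = v)
             = (\<Sum>t\<in>box_deg n K s. if t = w - ev i then (if lookup w i = 0 then 0 else c i ^ q * lookup h (w - ev i)) else 0)"
            by (rule sum.cong[OF refl]) (auto simp: * when_def)
          also have "\<dots> = (if lookup w i = 0 then 0 else c i ^ q * lookup h (w - ev i))"
            using polys_lookup_eq_0[OF h(1), of "w - ev i"] by (simp add: sum.delta)
          finally show ?thesis .
        qed
        then have "lookup (lin n c ^ q * \<phi>) v = lookup (lmult n K (\<lambda>i. c i ^ q) h) w"
          unfolding eq lookup_lmult using wK by simp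
        then show ?thesis by (simp add: h(3))
      qed
    qed
    then show "lookup (restr (box n M) (lin n c ^ q * \<phi>)) v = lookup 0 v" by simp
  qed
  \<comment> \<open>The last nonzero element of this sequence is killed by the form itself. It comes
    before index \<open>q\<close>, so its degree exceeds that of \<open>\<phi>\<close> by less than
    \<open>q\<close>.\<close>
  define a where "a j = (lmult n M c ^^ j) \<phi>" for j
  have "\<phi> = restr (box n M) \<phi>"
    using phi_polys by (intro restr_polys[symmetric]) (auto simp: polys_def box_deg_def)
  then have aq: "a q = 0" using funpow_lmult_eq[of q n M c \<phi>] kill by (simp add: a_def)
  define j where "j = (LEAST j. a j = 0)"
  have j: "a j = 0" "j \<le> q" using aq by (auto simp: j_def intro: LeastI Least_le)
  have "j \<noteq> 0" using j(1) phi0 by (metis a_def funpow_0)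
  then obtain i where i: "j = Suc i" by (cases j) auto
  have "a i \<noteq> 0" using not_less_Least[of i "\<lambda>j. a j = 0"] i by (auto simp: j_def)
  moreover have "a i \<in> polys (box_deg n M ((\<Sum>i=1..n. u i) + q * s + i))"
    unfolding a_def by (rule funpow_lmult[OF phi_polys])
  moreover have "lmult n M c (a i) = 0" using j(1) by (simp add: i a_def)
  ultimately show ?thesis using i j(2) by (intro exI[of _ "a i"] exI[of _ "(\<Sum>i=1..n. u i) + q * s + i"]) auto
qed

text \<open>Up to the middle the dimensions do not decrease, so a surjective map would have to be
  injective.\<close>

lemma not_lefschetz_if_kernel:
  fixes c :: "nat \<Rightarrow> 'a::field"
  assumes "f \<noteq> 0" "f \<in> polys (box_deg n M d)" "lmult n M c f = 0" "2 * d < socle_degree n M"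
    and M: "\<And>i. i \<in> {1..n} \<Longrightarrow> M i \<ge> 1"
  shows "\<not> lefschetz n M c"
proof
  assume "lefschetz n M c"
  moreover have ninj: "\<not> inj_on (lmult n M c) (polys (box_deg n M d))"
    using assms(1-3) by (auto simp: inj_on_polys_iff[OF mlinear_lmult])
  ultimately have "lmult n M c ` polys (box_deg n M d) = polys (box_deg n M (Suc d))" by (auto simp: lefschetz_def)
  moreover have "mp.dim (lmult n M c ` polys (box_deg n M d)) < card (box_deg n M d)"
    using ninj dim_image_polys_le[OF mlinear_lmult[of n M c], of "box_deg n M d"]
    by (simp add: inj_on_polys_iff_dim[OF mlinear_lmult])
  ultimately have "card (box_deg n M (Suc d)) < card (box_deg n M d)" by (simp add: dim_polys)
  moreover have "card (ballot_deg n M (Suc d)) + card (box_deg n M d) = card (box_deg n M (Suc d))"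
    using assms(4) by (intro card_box_deg_Suc M) auto
  ultimately show False by simp
qed

text \<open>By symmetry degree s + 1 has the dimension of degree s - 1, and the ballot monomials of
  degree s count the drop from s to s - 1. So every linear form has a kernel in degree s.\<close>

lemma middle_kernel:
  fixes c :: "nat \<Rightarrow> 'a::field"
  assumes K: "\<And>i. i \<in> {1..n} \<Longrightarrow> K i \<ge> 1" and D: "socle_degree n K = 2 * s" and t: "t \<in> ballot_deg n K s"
  shows "\<exists>h. h \<in> polys (box_deg n K s) \<and> h \<noteq> 0 \<and> lmult n K c h = 0"
proof -
  have "card (ballot_deg n K s) > 0" using t by (auto simp: card_gt_0_iff ballot_deg_def)
  then have "ballot_count n K (int s) > 0" by (simp add: card_ballot_deg[symmetric])
  moreover have "ballot_count n K (int s) = hilb n K (int s) - hilb n K (int s - 1)"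
    using D by (subst ballot_count_eq[OF K]) auto
  moreover have "hilb n K (int (Suc s)) = hilb n K (int s - 1)"
    using hilb_symmetric[of n K "int (Suc s)"] K D by simp
  ultimately have less: "card (box_deg n K (Suc s)) < card (box_deg n K s)"
    by (simp add: card_box_deg[symmetric] del: of_nat_Suc)
  have "\<not> inj_on (lmult n K c) (polys (box_deg n K s))"
  proof
    assume "inj_on (lmult n K c) (polys (box_deg n K s))"
    then have "card (box_deg n K s) = mp.dim (lmult n K c ` polys (box_deg n K s))"
      by (simp add: inj_on_polys_iff_dim[OF mlinear_lmult])
    also have "\<dots> \<le> card (box_deg n K (Suc s))"
      by (rule dim_le_polys) (auto intro: lmult_in_polys)
    finally show False using less by simp
  qed
  then show ?thesis by (auto simp: inj_on_polys_iff[OF mlinear_lmult])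
qed

text \<open>A path of Clebsch-Gordan choices: \<open>b\<close> lists the highest weights of the
  factors, and \<open>g\<close> is the highest weight of the summand reached. Reaching g = 0, the
  trivial module, corresponds to a ballot monomial in the middle degree.\<close>

definition ballot_fun :: "nat \<Rightarrow> (nat \<Rightarrow> nat) \<Rightarrow> (nat \<Rightarrow> nat) \<Rightarrow> nat \<Rightarrow> bool"
  where "ballot_fun n b a g \<longleftrightarrow>
    (\<forall>j\<in>{1..n}. a j \<le> b j \<and> a j + 2 * (\<Sum>i=1..<j. a i) \<le> (\<Sum>i=1..<j. b i)) \<and>
    (\<Sum>i=1..n. b i) = 2 * (\<Sum>i=1..n. a i) + g"

lemma ballot_fun_Suc:
  assumes "ballot_fun n b a g" "y \<le> b (Suc n)" "y \<le> g"
  shows "ballot_fun (Suc n) b (a(Suc n := y)) (g + b (Suc n) - 2 * y)"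
proof -
  have s: "(\<Sum>i=1..<j. (a(Suc n := y)) i) = (\<Sum>i=1..<j. a i)" if "j \<le> Suc n" for j
    using that by (intro sum.cong) auto
  have S: "(\<Sum>i=1..n. (a(Suc n := y)) i) = (\<Sum>i=1..n. a i)" by (intro sum.cong) auto
  have tot: "(\<Sum>i=1..n. b i) = 2 * (\<Sum>i=1..n. a i) + g" using assms(1) by (simp add: ballot_fun_def)
  have "(a(Suc n := y)) j \<le> b j \<and> (a(Suc n := y)) j + 2 * (\<Sum>i=1..<j. (a(Suc n := y)) i) \<le> (\<Sum>i=1..<j. b i)"
    if j: "j \<in> {1..Suc n}" for j
  proof (cases "j = Suc n")
    case True
    then show ?thesis using assms(2,3) tot s[of j] by (simp add: atLeastLessThanSuc_atLeastAtMost)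
  next
    case False
    then have "j \<in> {1..n}" using j by auto
    then show ?thesis using assms(1) s[of j] j False by (simp add: ballot_fun_def)
  qed
  moreover have "(\<Sum>i=1..Suc n. b i) = 2 * (\<Sum>i=1..Suc n. (a(Suc n := y)) i) + (g + b (Suc n) - 2 * y)"
    using tot S assms(2,3) by simp
  ultimately show ?thesis unfolding ballot_fun_def by blast
qed

text \<open>Greedy pairing of nearly equal factors: from weight 0 or 1 the next factor leads to
  \<kappa> or \<kappa> + 1, and the largest possible choice for the following factor cancels this up
  to 1.\<close>

lemma ballot_fun_alternating:
  assumes "\<And>i. i \<in> {1..n} \<Longrightarrow> b i = \<kappa> \<or> b i = Suc \<kappa>"
  shows "\<exists>a g. ballot_fun n b a g \<and> (if even n then g \<le> 1 else g = \<kappa> \<or> g = Suc \<kappa>)"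
  using assms
proof (induction n)
  case 0
  have "ballot_fun 0 b (\<lambda>_. 0) 0" by (simp add: ballot_fun_def)
  then show ?case by (metis even_zero zero_le)
next
  case (Suc n)
  then obtain a g where ag: "ballot_fun n b a g" "if even n then g \<le> 1 else g = \<kappa> \<or> g = Suc \<kappa>" by auto
  have x: "b (Suc n) = \<kappa> \<or> b (Suc n) = Suc \<kappa>" using Suc.prems by simp
  show ?case
  proof (cases "even n")
    case True
    define y where "y = (if g = 1 \<and> b (Suc n) = Suc \<kappa> then 1 else 0 :: nat)"
    have "ballot_fun (Suc n) b (a(Suc n := y)) (g + b (Suc n) - 2 * y)"
      by (rule ballot_fun_Suc[OF ag(1)]) (auto simp: y_def)
    moreover have "g + b (Suc n) - 2 * y = \<kappa> \<or> g + b (Suc n) - 2 * y = Suc \<kappa>"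
      using x ag(2) True by (auto simp: y_def)
    ultimately show ?thesis using True by (intro exI conjI) auto
  next
    case False
    define y where "y = min g (b (Suc n))"
    have "ballot_fun (Suc n) b (a(Suc n := y)) (g + b (Suc n) - 2 * y)"
      by (rule ballot_fun_Suc[OF ag(1)]) (auto simp: y_def)
    moreover have "g + b (Suc n) - 2 * y \<le> 1" using x ag(2) False by (auto simp: y_def)
    ultimately show ?thesis using False by (intro exI conjI) auto
  qed
qed

text \<open>For even n parity removes the remaining 1. For odd n the path stops two factors early;
  its weight and the last two factors have even sum and satisfy the triangle inequality, so the
  tensor product of the three contains the trivial module.\<close>

lemma ballot_fun_balanced:
  assumes b: "\<And>i. i \<in> {1..n} \<Longrightarrow> b i = \<kappa> \<or> b i = Suc \<kappa>" and "even (\<Sum>i=1..n. b i)" "n \<ge> 2"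
  shows "\<exists>a. ballot_fun n b a 0"
proof (cases "even n")
  case True
  obtain a g where ag: "ballot_fun n b a g" "if even n then g \<le> 1 else g = \<kappa> \<or> g = Suc \<kappa>"
    using ballot_fun_alternating[of n b \<kappa>] b by blast
  have "even g" using ag(1) assms(2) by (simp add: ballot_fun_def)
  then have "g = 0" using ag(2) True by (cases "g = 1") auto
  then show ?thesis using ag(1) by auto
next
  case False
  then obtain N where n: "n = Suc (Suc N)" using assms(3) by (metis Suc_le_D numeral_2_eq_2 Suc_le_mono)
  have "odd N" using False n by simp
  obtain a g where ag: "ballot_fun N b a g" "if even N then g \<le> 1 else g = \<kappa> \<or> g = Suc \<kappa>"
    using ballot_fun_alternating[of N b \<kappa>] b n by auto
  define x z where "x = b (Suc N)" and "z = b n"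
  have vals: "x = \<kappa> \<or> x = Suc \<kappa>" "z = \<kappa> \<or> z = Suc \<kappa>" "g = \<kappa> \<or> g = Suc \<kappa>"
    using b[of "Suc N"] b[of n] ag(2) \<open>odd N\<close> by (auto simp: x_def z_def n)
  have "(\<Sum>i=1..n. b i) = 2 * (\<Sum>i=1..N. a i) + (g + x + z)"
    using ag(1) by (simp add: n ballot_fun_def x_def z_def)
  then have par: "even (g + x + z)" using assms(2) by simp
  \<comment> \<open>For \<kappa> = 0 this rests on parity, which excludes g = x = 0 with z =
    1.\<close>
  have "z \<le> g + x" using vals par by (cases \<kappa>) auto
  moreover have "even (g + x - z)" using par calculation by (simp add: even_diff_nat)
  ultimately obtain y where y: "g + x = z + 2 * y" by (metis dvdE le_add_diff_inverse)
  have yx: "y \<le> x" "y \<le> g" using y vals by auto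
  have "ballot_fun (Suc N) b (a(Suc N := y)) (g + x - 2 * y)"
    unfolding x_def by (rule ballot_fun_Suc[OF ag(1)]) (use yx in \<open>auto simp: x_def\<close>)
  then have "ballot_fun (Suc N) b (a(Suc N := y)) z" using y by simp
  from ballot_fun_Suc[OF this, of z] show ?thesis by (auto simp: z_def n)
qed

lemma ballot_deg_middle_nonempty:
  assumes b: "\<And>i. i \<in> {1..n} \<Longrightarrow> K i - 1 = \<kappa> \<or> K i - 1 = Suc \<kappa>" and K: "\<And>i. i \<in> {1..n} \<Longrightarrow> K i \<ge> 1"
    and "socle_degree n K = 2 * s" "n \<ge> 2"
  shows "ballot_deg n K s \<noteq> {}"
proof -
  obtain a where a: "ballot_fun n (\<lambda>i. K i - 1) a 0"
    using ballot_fun_balanced[of n "\<lambda>i. K i - 1" \<kappa>] assms by (auto simp: socle_degree_def)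
  have "vec n a \<in> box n K"
    unfolding box_def
  proof (intro CollectI conjI ballI)
    fix i assume i: "i \<in> {1..n}"
    then have "a i \<le> K i - 1" using a by (simp add: ballot_fun_def)
    then show "lookup (vec n a) i < K i" using i K[OF i] by (simp add: lookup_vec)
  qed simp
  moreover have "monom_degree (vec n a) = s"
    using a assms(3) by (simp add: monom_degree_vec ballot_fun_def socle_degree_def)
  moreover have "ballot n K (vec n a)"
    unfolding ballot_def
  proof
    fix j assume j: "j \<in> {1..n}"
    have "(\<Sum>i=1..<j. lookup (vec n a) i) = (\<Sum>i=1..<j. a i)"
      using j by (intro sum.cong) (auto simp: lookup_vec)
    then show "lookup (vec n a) j + 2 * (\<Sum>i=1..<j. lookup (vec n a) i) \<le> (\<Sum>i=1..<j. K i - 1)"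
      using a j by (simp add: ballot_fun_def lookup_vec)
  qed
  ultimately have "vec n a \<in> ballot_deg n K s" by (simp add: ballot_deg_def box_deg_def)
  then show ?thesis by auto
qed

text \<open>Nearly equal bounds \<open>K\<close> with even socle degree provide the middle degree
  element killed by the form with coefficients \<open>c i ^ q\<close>; \<open>bound\<close> puts the
  kernel element built from it strictly below half of the socle degree n * (m - 1).\<close>

lemma frobenius_not_lefschetz:
  fixes c :: "nat \<Rightarrow> 'a::field"
  assumes char: "prime CHAR('a)" "q = CHAR('a) ^ e" and n: "n \<ge> 2"
    and K: "\<And>i. i \<in> {1..n} \<Longrightarrow> K i \<ge> 1 \<and> u i + q * (K i - 1) < m \<and> m \<le> u i + q * K i"
    and b: "\<And>i. i \<in> {1..n} \<Longrightarrow> K i - 1 = \<kappa> \<or> K i - 1 = Suc \<kappa>"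
    and D: "(\<Sum>i=1..n. K i - 1) = 2 * s"
    and bound: "2 * ((\<Sum>i=1..n. u i) + q * s + q) \<le> n * (m - 1) + 1"
  shows "\<not> lefschetz n (\<lambda>_. m) c"
proof -
  have m: "m \<ge> 1" using K[of 1] n by auto
  obtain t where t: "t \<in> ballot_deg n K s"
    using ballot_deg_middle_nonempty[of n K \<kappa> s] b K D n by (auto simp: socle_degree_def)
  obtain h where h: "h \<in> polys (box_deg n K s)" "h \<noteq> 0" "lmult n K (\<lambda>i. c i ^ q) h = 0"
    using middle_kernel[OF _ _ t, of "\<lambda>i. c i ^ q"] K D by (auto simp: socle_degree_def)
  obtain f d where f: "f \<noteq> 0" "f \<in> polys (box_deg n (\<lambda>_. m) d)" "lmult n (\<lambda>_. m) c f = 0"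
      and d: "d < (\<Sum>i=1..n. u i) + q * s + q"
    using frobenius_kernel[where M = "\<lambda>_. m", OF char K h] by blast
  have "2 * Suc d \<le> 2 * ((\<Sum>i=1..n. u i) + q * s + q)" using d by (intro mult_le_mono2 Suc_leI)
  also note bound
  finally have "2 * d < n * (m - 1)" by simp
  then have "2 * d < socle_degree n (\<lambda>_. m)" by (simp add: socle_degree_def)
  then show ?thesis by (intro not_lefschetz_if_kernel[OF f]) (use m in auto)
qed

section \<open>Choice of q and the degree bound\<close>

lemma sum_prefix:
  fixes x y :: nat
  assumes "j \<le> n"
  shows "(\<Sum>i=1..n. if i \<le> j then x else y) = j * x + (n - j) * y"
proof -
  have "(\<Sum>i=1..n. if i \<le> j then x else y) = (\<Sum>i\<in>{1..j} \<union> {j<..n}. if i \<le> j then x else y)"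
    using assms by (intro sum.cong) auto
  also have "\<dots> = (\<Sum>i\<in>{1..j}. if i \<le> j then x else y) + (\<Sum>i\<in>{j<..n}. if i \<le> j then x else y)"
    by (rule sum.union_disjoint) auto
  also have "\<dots> = (\<Sum>i\<in>{1..j}. x) + (\<Sum>i\<in>{j<..n}. y)"
    by (intro arg_cong2[of _ _ _ _ "(+)"] sum.cong) auto
  finally show ?thesis by simp
qed

text \<open>
  The first \<open>j\<close> variables enter through \<open>x\<^sub>i\<^sup>r\<close> times powers of \<open>x\<^sub>i\<^sup>q\<close>, the others through powers of
  \<open>x\<^sub>i\<^sup>q\<close> alone; the parity of \<open>j\<close> makes the socle degree in the \<open>x\<^sub>i\<^sup>q\<close> even.
\<close>
lemma not_lefschetz_split:
  fixes c :: "nat \<Rightarrow> 'a::field"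
  assumes char: "prime CHAR('a)" "q = CHAR('a) ^ e" and n: "n \<ge> 2"
    and m: "m = Suc k * q + r" "1 \<le> r" "r \<le> q" and j: "j \<le> n" "even (n * Suc k - j)"
    and bound: "2 * j * r + q * (n * Suc k - j) + 2 * q \<le> n * (m - 1) + 1"
  shows "\<not> lefschetz n (\<lambda>_. m) c"
proof -
  define s where "s = (n * Suc k - j) div 2"
  have s: "n * Suc k - j = 2 * s" using j(2) by (simp add: s_def)
  show ?thesis
  proof (rule frobenius_not_lefschetz[OF char n,
      where K = "\<lambda>i. if i \<le> j then Suc k else Suc (Suc k)" and u = "\<lambda>i. if i \<le> j then r else 0" and \<kappa> = k and s = s])
    have "(\<Sum>i=1..n. (if i \<le> j then Suc k else Suc (Suc k)) - 1) = (\<Sum>i=1..n. if i \<le> j then k else Suc k)"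
      by (intro sum.cong) auto
    also have "\<dots> = j * k + (n - j) * Suc k" by (rule sum_prefix[OF j(1)])
    also have "\<dots> = n * Suc k - j"
    proof -
      obtain l where "n = j + l" using j(1) le_Suc_ex by blast
      then show ?thesis by (simp add: algebra_simps)
    qed
    finally show "(\<Sum>i=1..n. (if i \<le> j then Suc k else Suc (Suc k)) - 1) = 2 * s" using s by simp
    have "(\<Sum>i=1..n. if i \<le> j then r else 0) = j * r" using sum_prefix[OF j(1), of r 0] by simp
    then show "2 * ((\<Sum>i=1..n. if i \<le> j then r else 0) + q * s + q) \<le> n * (m - 1) + 1"
      using bound unfolding s by (simp add: algebra_simps)
  qed (use m in \<open>auto simp: algebra_simps\<close>)
qed

text \<open>As m \<le> q, all x_i^q vanish in the quotient. So the q-th power of the form is zero,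
  and its last nonzero power lies in the kernel.\<close>

lemma not_lefschetz_small_exponent:
  fixes c :: "nat \<Rightarrow> 'a::field"
  assumes char: "prime CHAR('a)" "q = CHAR('a) ^ e" and n: "n \<ge> 2"
    and m: "1 \<le> m" "m \<le> q" and bound: "2 * q \<le> n * (m - 1) + 1"
  shows "\<not> lefschetz n (\<lambda>_. m) c"
  by (rule frobenius_not_lefschetz[OF char n, where K = "\<lambda>_. 1" and u = "\<lambda>_. 0" and \<kappa> = 0 and s = 0])
    (use m bound in auto)

text \<open>For \<open>q = 6\<close>, \<open>n = 5\<close> and \<open>r = 3\<close> no choice of \<open>j\<close> below satisfies the degree bound.\<close>
lemma not_lefschetz_large_exponent:
  fixes c :: "nat \<Rightarrow> 'a::field"
  assumes char: "prime CHAR('a)" "q = CHAR('a) ^ e" and n: "n \<ge> 5" and q: "q \<ge> 5" "q \<noteq> 6" and m: "q < m"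
  shows "\<not> lefschetz n (\<lambda>_. m) c"
proof -
  \<comment> \<open>Dividing m - 1 instead of m puts \<open>r\<close> into the range from 1 to
    q.\<close>
  define k where "k = (m - 1) div q - 1"
  define r where "r = (m - 1) mod q + 1"
  have "(m - 1) div q \<ge> 1" using m q by (simp add: div_greater_zero_iff Suc_le_eq)
  then have "Suc k = (m - 1) div q" by (simp add: k_def)
  then have mk: "m = Suc k * q + r"
    using div_mult_mod_eq[of "m - 1" q] m by (simp add: r_def)
  have r: "1 \<le> r" "r \<le> q" using q mod_less_divisor[of q "m - 1"] by (simp_all add: r_def Suc_le_eq)
  have n2: "n \<ge> 2" using n by simp
  obtain N where N: "n = 5 + N" using n le_Suc_ex by blast
  have m1: "m - 1 = Suc k * q + (r - 1)" using mk r by simp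
  have nk: "n \<le> n * Suc k" by simp
  obtain w where w: "n * Suc k = n + w" using nk le_Suc_ex by blast
  have nm: "n * (m - 1) = n * Suc k * q + n * (r - 1)" unfolding m1 by (simp add: algebra_simps)
  show ?thesis
  proof (cases "q \<le> 2 * r")
    case True
    \<comment> \<open>Each variable counted by \<open>j\<close> adds \<open>2 * r\<close> to the
      left side of the degree bound and removes \<open>q\<close>. With \<open>q \<le> 2 * r\<close>,
      as few as parity permits are taken.\<close>
    define j where "j = n * Suc k mod 2"
    have j: "j \<le> 1" "even (n * Suc k - j)" by (auto simp: j_def minus_mod_eq_mult_div)
    show ?thesis
    proof (rule not_lefschetz_split[OF char n2 mk r _ j(2)])
      show "j \<le> n" using j n by simp
      have "j = 0 \<or> j = 1" using j(1) by auto
      moreover have "2 * q \<le> n * (r - 1) + 1" "2 * r + q \<le> n * (r - 1) + 1"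
      proof -
        obtain R where R: "r = Suc R" using r by (cases r) auto
        have "R \<ge> 2" using True q R by simp
        have q2: "q \<le> 2 * R + 2" using True R by simp
        \<comment> \<open>For \<open>R = 2\<close> the inequality \<open>q \<le> 2 * R + 2\<close>
          leaves 5 and the excluded 6.\<close>
        have "q = 5 \<and> R = 2 \<or> R \<ge> 3" using \<open>R \<ge> 2\<close> q q2 by auto
        then have "2 * q \<le> 5 * R + 1" "2 * r + q \<le> 5 * R + 1" using q2 R by auto
        moreover have "5 * R \<le> n * (r - 1)" using n R by simp
        ultimately show "2 * q \<le> n * (r - 1) + 1" "2 * r + q \<le> n * (r - 1) + 1" by linarith+
      qed
      moreover have "q * (n * Suc k - 1) + q = n * Suc k * q"
        using n by (cases "n * Suc k") (simp_all add: algebra_simps)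
      ultimately show "2 * j * r + q * (n * Suc k - j) + 2 * q \<le> n * (m - 1) + 1"
        unfolding nm by (auto simp: mult.commute)
    qed
  next
    case False
    \<comment> \<open>Now \<open>2 * r < q\<close>, so as many variables as parity permits are
      taken: n or n - 1.\<close>
    define j where "j = n - w mod 2"
    have w2: "w mod 2 \<le> 1" by auto
    have "n * Suc k - j = w + w mod 2" using w w2 n by (simp add: j_def)
    moreover have "even (w + w mod 2)" by (cases "even w") auto
    ultimately have j: "even (n * Suc k - j)" by simp
    show ?thesis
    proof (rule not_lefschetz_split[OF char n2 mk r _ j])
      show "j \<le> n" by (simp add: j_def)
      have wj: "n * Suc k - j = w + w mod 2" by fact
      have jr: "j + w mod 2 = n" using w2 n by (simp add: j_def)
      obtain R where R: "r = Suc R" using r by (cases r) auto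
      obtain Q where Q: "q = 2 * r + 1 + Q" using False by (metis Suc_eq_plus1 le_Suc_ex not_less_eq_eq)
      have main: "2 * j * r + q * (w + w mod 2) + 2 * q \<le> (n + w) * q + n * (r - 1) + 1"
      proof -
        consider "w mod 2 = 0" "j = n" | "w mod 2 = 1" "j = 4 + N" using jr w2 N by fastforce
        then show ?thesis
        proof cases
          case 1
          have "2 * n * r + 2 * q \<le> n * q + n * (r - 1) + 1"
            unfolding Q N R by (simp add: algebra_simps)
          then show ?thesis using 1 by (simp add: algebra_simps)
        next
          case 2
          have "2 * (4 + N) * r + 3 * q \<le> n * q + n * (r - 1) + 1"
            using q unfolding Q N R by (simp add: algebra_simps)
          then show ?thesis using 2 by (simp add: algebra_simps)
        qed
      qed
      show "2 * j * r + q * (n * Suc k - j) + 2 * q \<le> n * (m - 1) + 1"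
        unfolding nm wj unfolding w by (rule main)
    qed
  qed
qed

text \<open>For p \<ge> 5 the choice q = p works. For p = 2 and p = 3 it is too small for the
  general bound; 8 and 9 take over when m exceeds them, and most smaller m are covered by a power of
  p that is at least m.\<close>

theorem char_less_imp_not_lefschetz:
  fixes c :: "nat \<Rightarrow> 'a::field"
  assumes char: "CHAR('a) > 0" and n: "n \<ge> 5" and m: "CHAR('a) < m"
  shows "\<not> lefschetz n (\<lambda>_. m) c"
proof -
  define p where "p = CHAR('a)"
  have prime: "prime CHAR('a)" using char by (rule prime_CHAR_semidom)
  then have p2: "p \<ge> 2" by (simp add: p_def prime_ge_2_nat)
  have n2: "n \<ge> 2" using n by simp
  have mult: "5 * (m - 1) \<le> n * (m - 1)" using n by simp
  consider "p \<ge> 5" | "p = 2" | "p = 3" | "p = 4" using p2 by linarith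
  then show ?thesis
  proof cases
    case 1
    have "\<not> prime (6 :: nat)"
    proof
      assume "prime (6 :: nat)"
      moreover have "(6 :: nat) = 2 * 3" by simp
      ultimately show False by (metis One_nat_def numeral_eq_one_iff prime_product semiring_norm(85) semiring_norm(86))
    qed
    then have "p \<noteq> 6" using prime p_def by metis
    then show ?thesis
      using not_lefschetz_large_exponent[OF prime _ n, where e = 1 and q = p] 1 m by (simp add: p_def)
  next
    case 2
    consider "m = 3" | "4 \<le> m" "m \<le> 8" | "m > 8" using m 2 p_def by linarith
    then show ?thesis
    proof cases
      case 1
      \<comment> \<open>The power 8 would be too large here: for n = 5 the bound would read 16 \<le>
        11.\<close>
      show ?thesis
        by (rule not_lefschetz_small_exponent[OF prime _ n2, where e = 2 and q = 4])
          (use 1 2 mult in \<open>auto simp: p_def[symmetric]\<close>)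
    next
      case 2
      \<comment> \<open>Tight: for n = 5 and m = 4 the bound reads 16 \<le> 16.\<close>
      then have "15 \<le> n * (m - 1)" using mult by linarith
      then show ?thesis
        by (intro not_lefschetz_small_exponent[OF prime _ n2, where e = 3 and q = 8])
          (use 2 \<open>p = 2\<close> in \<open>auto simp: p_def[symmetric]\<close>)
    next
      case 3
      then show ?thesis
        using not_lefschetz_large_exponent[OF prime _ n, where e = 3 and q = 8] 2 by (simp add: p_def[symmetric])
    qed
  next
    case 3
    consider "m = 4" | "5 \<le> m" "m \<le> 9" | "m > 9" using m 3 p_def by linarith
    then show ?thesis
    proof cases
      case 1
      \<comment> \<open>The power 9 fails the bound for n = 5. Instead, the product of all variables
        is killed by the cube of the form, since each x_i^4 is zero. The bound 2 * (n + 3) \<le> 3 *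
        n + 1 holds exactly from n = 5 on.\<close>
      show ?thesis
        by (rule frobenius_not_lefschetz[OF prime _ n2, where e = 1 and q = 3 and K = "\<lambda>_. 1" and u = "\<lambda>_. 1" and \<kappa> = 0 and s = 0])
          (use 1 3 n in \<open>auto simp: p_def[symmetric]\<close>)
    next
      case 2
      then have "20 \<le> n * (m - 1)" using mult by linarith
      then show ?thesis
        by (intro not_lefschetz_small_exponent[OF prime _ n2, where e = 2 and q = 9])
          (use 2 \<open>p = 3\<close> in \<open>auto simp: p_def[symmetric]\<close>)
    next
      case 3
      then show ?thesis
        using not_lefschetz_large_exponent[OF prime _ n, where e = 2 and q = 9] \<open>p = 3\<close> by (simp add: p_def[symmetric])
    qed
  next
    case 4
    have "prime (2 ^ 2 :: nat)" using prime 4 by (simp add: p_def)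
    then show ?thesis using prime_power_iff[of "2 :: nat" 2] by simp
  qed
qed

section \<open>The ideals and their initial ideals\<close>

lemma carrier_mpoly_ring: "carrier (mpoly_ring n) = polys (monomials n)"
  by (simp add: polys_def)

lemma mult_in_polys_monomials:
  "f \<in> polys (monomials n) \<Longrightarrow> g \<in> polys (monomials n) \<Longrightarrow> f * g \<in> polys (monomials n)"
proof -
  assume fg: "f \<in> polys (monomials n)" "g \<in> polys (monomials n)"
  have "keys (f * g) \<subseteq> monomials n"
    by (rule keys_mult_subset) (use fg in \<open>auto simp: polys_def intro: add_in_monomials\<close>)
  then show ?thesis by (simp add: polys_def)
qed

lemma zero_in_polys [simp]: "0 \<in> polys X"
  by (simp add: polys_def)

lemma restr_0 [simp]: "restr X 0 = 0"
  by (rule poly_mapping_eqI) simp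

lemma lmult_0 [simp]: "lmult n M c 0 = 0"
  by (simp add: lmult_def)

lemma add_in_polys: "f \<in> polys X \<Longrightarrow> g \<in> polys X \<Longrightarrow> f + g \<in> polys X"
  for f g :: "'a::monoid_add mpoly"
  by (auto simp: polys_iff lookup_add)

lemma ideal_mpoly_ringI:
  fixes S :: "'a::comm_ring_1 mpoly set"
  assumes S: "S \<subseteq> polys (monomials n)" "0 \<in> S" "\<And>f g. f \<in> S \<Longrightarrow> g \<in> S \<Longrightarrow> f + g \<in> S"
    and mult: "\<And>x f. x \<in> polys (monomials n) \<Longrightarrow> f \<in> S \<Longrightarrow> x * f \<in> S"
  shows "ideal S (mpoly_ring n)"
proof -
  interpret R: cring "mpoly_ring n :: 'a mpoly ring" by (rule cring_mpoly_ring)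
  have car: "carrier (mpoly_ring n) = (polys (monomials n) :: 'a mpoly set)" by (rule carrier_mpoly_ring)
  have neg: "- f \<in> S" if "f \<in> S" for f
    using mult[of "- 1" f] that by (simp add: polys_def zero_in_monomials)
  show ?thesis
  proof (rule idealI)
    show "subgroup S (add_monoid (mpoly_ring n))"
    proof (rule R.add.subgroupI)
      fix a assume a: "a \<in> S"
      have "\<ominus>\<^bsub>mpoly_ring n\<^esub> a = - a"
        using a neg[OF a] S(1) by (intro R.minus_equality) (auto simp del: mpoly_ring_simps(1) simp: car)
      then show "\<ominus>\<^bsub>mpoly_ring n\<^esub> a \<in> S" using neg[OF a] by simp
    qed (use S in \<open>auto simp del: mpoly_ring_simps(1) simp: car\<close>)
  next
    fix a x :: "'a mpoly" assume "a \<in> S" "x \<in> carrier (mpoly_ring n)"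
    then have "x * a \<in> S" using mult car by auto
    then show "x \<otimes>\<^bsub>mpoly_ring n\<^esub> a \<in> S" "a \<otimes>\<^bsub>mpoly_ring n\<^esub> x \<in> S"
      by (simp_all add: mult.commute)
  qed (rule R.ring_axioms)
qed

lemma ideal_mpoly_ringD:
  fixes S :: "'a::comm_ring_1 mpoly set"
  assumes "ideal S (mpoly_ring n)"
  shows "S \<subseteq> polys (monomials n)" "0 \<in> S" "\<And>f g. f \<in> S \<Longrightarrow> g \<in> S \<Longrightarrow> f + g \<in> S"
    "\<And>x f. x \<in> polys (monomials n) \<Longrightarrow> f \<in> S \<Longrightarrow> x * f \<in> S"
proof -
  interpret I: ideal S "mpoly_ring n" by (rule assms)
  show "S \<subseteq> polys (monomials n)" using I.a_subset by (simp add: polys_def)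
  show "0 \<in> S" using additive_subgroup.zero_closed[OF ideal.axioms(1)[OF assms]] by simp
  show "f + g \<in> S" if "f \<in> S" "g \<in> S" for f g using additive_subgroup.a_closed[OF ideal.axioms(1)[OF assms] that] by simp
  show "x * f \<in> S" if "x \<in> polys (monomials n)" "f \<in> S" for x f
    using I.I_l_closed[OF that(2), of x] that(1) by (simp add: polys_def)
qed

text \<open>The ideal of the powers x_i^(M i), described by coefficients; \<open>Idl_powers\<close>
  identifies it for constant \<open>M\<close>.\<close>

definition box_ideal :: "nat \<Rightarrow> (nat \<Rightarrow> nat) \<Rightarrow> 'a::zero mpoly set"
  where "box_ideal n M = {f \<in> polys (monomials n). restr (box n M) f = 0}"

lemma restr_eq_0_iff: "restr X f = 0 \<longleftrightarrow> (\<forall>t\<in>X. lookup f t = 0)"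
  using restr_eq_iff[of X f 0] by (simp add: restr_def Poly_Mapping.mapp_def)

lemma box_add_imp: "s + t \<in> box n M \<Longrightarrow> t \<in> monomials n \<Longrightarrow> t \<in> box n M"
  by (fastforce simp: box_def lookup_add)

lemma mult_in_box_ideal:
  fixes f x :: "'a::comm_ring_1 mpoly"
  assumes f: "f \<in> box_ideal n M" and x: "x \<in> polys (monomials n)"
  shows "x * f \<in> box_ideal n M"
proof -
  have fm: "f \<in> polys (monomials n)" and f0: "\<And>t. t \<in> box n M \<Longrightarrow> lookup f t = 0"
    using f by (auto simp: box_ideal_def restr_eq_0_iff)
  have "keys (x * f) \<subseteq> - box n M"
    by (rule keys_mult_subset) (use fm f0 box_add_imp in \<open>auto simp: polys_def in_keys_iff subset_iff\<close>)
  then have "restr (box n M) (x * f) = 0" by (auto simp: restr_eq_0_iff in_keys_iff)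
  then show ?thesis using mult_in_polys_monomials[OF x fm] by (simp add: box_ideal_def)
qed

lemma box_ideal_minus_restr:
  "f \<in> polys (monomials n) \<Longrightarrow> f - restr (box n M) f \<in> box_ideal n M"
  for f :: "'a::comm_ring_1 mpoly"
  using box_subset(1)[of n M] by (auto simp: box_ideal_def restr_eq_0_iff lookup_minus polys_iff)

lemma restr_mult_restr:
  fixes f x :: "'a::comm_ring_1 mpoly"
  assumes "f \<in> polys (monomials n)" "x \<in> polys (monomials n)"
  shows "restr (box n M) (x * restr (box n M) f) = restr (box n M) (x * f)"
proof -
  have "x * (f - restr (box n M) f) \<in> box_ideal n M"
    using assms by (intro mult_in_box_ideal box_ideal_minus_restr)
  then have "restr (box n M) (x * f - x * restr (box n M) f) = 0"
    by (simp add: box_ideal_def right_diff_distrib)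
  then show ?thesis by (auto simp: restr_eq_0_iff restr_eq_iff lookup_minus)
qed

lemma ideal_box_ideal: "ideal (box_ideal n M :: 'a::comm_ring_1 mpoly set) (mpoly_ring n)"
proof (rule ideal_mpoly_ringI)
  show "x * f \<in> box_ideal n M" if "x \<in> polys (monomials n)" "f \<in> box_ideal n M" for x f :: "'a mpoly"
    using that by (intro mult_in_box_ideal)
qed (auto simp: box_ideal_def restr_add add_in_polys)

lemma Var_power: "Var i ^ m = (single (single i m) 1 :: 'a::comm_ring_1 mpoly)"
  unfolding Var_def power_single by simp

lemma single_in_polys: "t \<in> X \<Longrightarrow> single t c \<in> polys X"
  by (simp add: polys_def)

text \<open>Every monomial outside the box is divisible by some x_i^m.\<close>

lemma box_ideal_subset:
  fixes J :: "'a::comm_ring_1 mpoly set"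
  assumes J: "ideal J (mpoly_ring n)" and gens: "\<And>i. i \<in> {1..n} \<Longrightarrow> Var i ^ m \<in> J"
  shows "box_ideal n (\<lambda>_. m) \<subseteq> J"
proof
  fix f :: "'a mpoly" assume f: "f \<in> box_ideal n (\<lambda>_. m)"
  note J' = ideal_mpoly_ringD[OF J]
  have mon: "single t c \<in> J" if t: "t \<in> keys f" for t c
  proof -
    have tm: "t \<in> monomials n" "t \<notin> box n (\<lambda>_. m)"
      using f t by (auto simp: box_ideal_def polys_def restr_eq_0_iff in_keys_iff)
    then obtain i where i: "i \<in> {1..n}" "m \<le> lookup t i" by (auto simp: box_def)
    have t_eq: "t - single i m + single i m = t"
      by (rule poly_mapping_eqI) (use i in \<open>auto simp: lookup_add lookup_minus lookup_single when_def\<close>)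
    have "lookup (t - single i m) k \<le> lookup t k" for k by (simp add: lookup_minus)
    then have "keys (t - single i m) \<subseteq> keys t" unfolding in_keys_iff subset_iff by (metis le_zero_eq)
    then have "t - single i m \<in> monomials n" using tm(1) by (auto simp: monomials_def)
    then have "single (t - single i m) c * Var i ^ m \<in> J"
      using gens[OF i(1)] by (intro J'(4) single_in_polys)
    then show ?thesis by (simp add: Var_power mult_single t_eq)
  qed
  have "(\<Sum>t\<in>A. single t (lookup f t)) \<in> J" if "finite A" "A \<subseteq> keys f" for A
    using that by (induction A rule: finite_induct) (auto intro!: J'(2,3) mon)
  from this[of "keys f"] have "(\<Sum>t\<in>keys f. single t (lookup f t)) \<in> J" by simp
  moreover have "(\<Sum>t\<in>keys f. single t (lookup f t)) = f"
    by (rule poly_mapping_eqI) (simp add: lookup_sum lookup_single when_def sum.delta in_keys_iff)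
  ultimately show "f \<in> J" by simp
qed

lemma Var_power_in_box_ideal: "i \<in> {1..n} \<Longrightarrow> Var i ^ m \<in> box_ideal n (\<lambda>_. m)"
  by (auto simp: box_ideal_def Var_power restr_eq_0_iff lookup_single when_def box_def
      intro!: single_in_polys) (auto simp: monomials_def)

lemma Idl_powers:
  "Idl\<^bsub>mpoly_ring n\<^esub> {Var i ^ m |i. i \<in> {1..n}} = (box_ideal n (\<lambda>_. m) :: 'a::comm_ring_1 mpoly set)"
proof -
  interpret R: cring "mpoly_ring n :: 'a mpoly ring" by (rule cring_mpoly_ring)
  let ?G = "{Var i ^ m |i. i \<in> {1..n}} :: 'a mpoly set"
  have G: "?G \<subseteq> box_ideal n (\<lambda>_. m)" using Var_power_in_box_ideal by blast
  then have Gc: "?G \<subseteq> carrier (mpoly_ring n)" unfolding carrier_mpoly_ring by (auto simp: box_ideal_def)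
  show ?thesis
  proof
    show "Idl\<^bsub>mpoly_ring n\<^esub> ?G \<subseteq> box_ideal n (\<lambda>_. m)"
      by (rule R.genideal_minimal[OF ideal_box_ideal G])
    show "box_ideal n (\<lambda>_. m) \<subseteq> Idl\<^bsub>mpoly_ring n\<^esub> ?G"
      by (rule box_ideal_subset[OF R.genideal_ideal[OF Gc]]) (use R.genideal_self[OF Gc] in blast)
  qed
qed

lemma lin_in_polys: "lin n c \<in> polys (monomials n)"
  unfolding polys_iff lin_def ev_def[symmetric]
  by (auto simp: lookup_sum lookup_single when_def intro!: sum.neutral)

lemma sum_Var: "(\<Sum>i=1..n. Var i) = lin n (\<lambda>_. 1)"
  by (simp add: lin_def Var_def ev_def)

text \<open>Membership means that the class in the quotient by the powers is a multiple of the sum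
  of the variables, expressed through truncated representatives.\<close>

definition sum_ideal :: "nat \<Rightarrow> (nat \<Rightarrow> nat) \<Rightarrow> 'a::comm_ring_1 mpoly set"
  where "sum_ideal n M = {f \<in> polys (monomials n). \<exists>g\<in>polys (monomials n). restr (box n M) f = lmult n M (\<lambda>_. 1) g}"

lemma ideal_sum_ideal: "ideal (sum_ideal n M :: 'a::comm_ring_1 mpoly set) (mpoly_ring n)"
proof (rule ideal_mpoly_ringI)
  let ?P = "polys (monomials n) :: 'a mpoly set"
  show "(0 :: 'a mpoly) \<in> sum_ideal n M"
    unfolding sum_ideal_def by (intro CollectI conjI bexI[of _ 0]) simp_all
  show "f + g \<in> sum_ideal n M" if fg: "f \<in> sum_ideal n M" "g \<in> sum_ideal n M" for f g :: "'a mpoly"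
  proof -
    obtain f' g' where "f' \<in> ?P" "restr (box n M) f = lmult n M (\<lambda>_. 1) f'" "g' \<in> ?P" "restr (box n M) g = lmult n M (\<lambda>_. 1) g'"
      using fg by (auto simp: sum_ideal_def)
    then show ?thesis using fg
      by (auto simp: sum_ideal_def restr_add add_in_polys lmult_def distrib_left intro!: bexI[of _ "f' + g'"])
  qed
  show "x * f \<in> sum_ideal n M" if x: "x \<in> ?P" and f: "f \<in> sum_ideal n M" for x f
  proof -
    obtain g where g: "g \<in> ?P" "restr (box n M) f = restr (box n M) (lin n (\<lambda>_. 1) * g)" and fP: "f \<in> ?P"
      using f by (auto simp: sum_ideal_def lmult_def)
    have "restr (box n M) (x * f) = restr (box n M) (x * (lin n (\<lambda>_. 1) * g))"
      using restr_mult_restr[OF fP x, of M] g restr_mult_restr[OF mult_in_polys_monomials[OF lin_in_polys g(1)] x, of M]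
      by simp
    also have "\<dots> = lmult n M (\<lambda>_. 1) (x * g)" by (simp add: lmult_def mult.left_commute)
    finally show ?thesis using x g(1) fP mult_in_polys_monomials by (auto simp: sum_ideal_def)
  qed
qed (auto simp: sum_ideal_def)

lemma Idl_powers_sum:
  "Idl\<^bsub>mpoly_ring n\<^esub> ({Var i ^ m |i. i \<in> {1..n}} \<union> {\<Sum>i=1..n. Var i}) = (sum_ideal n (\<lambda>_. m) :: 'a::comm_ring_1 mpoly set)"
proof -
  interpret R: cring "mpoly_ring n :: 'a mpoly ring" by (rule cring_mpoly_ring)
  let ?G = "{Var i ^ m |i. i \<in> {1..n}} \<union> {\<Sum>i=1..n. Var i} :: 'a mpoly set"
  let ?J = "Idl\<^bsub>mpoly_ring n\<^esub> ?G"
  have "Var i ^ m \<in> (sum_ideal n (\<lambda>_. m) :: 'a mpoly set)" if "i \<in> {1..n}" for i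
    using Var_power_in_box_ideal[OF that, of m, where 'a = 'a]
    unfolding sum_ideal_def box_ideal_def by (intro CollectI conjI bexI[of _ 0]) simp_all
  moreover have "(\<Sum>i=1..n. Var i) \<in> (sum_ideal n (\<lambda>_. m) :: 'a mpoly set)"
    unfolding sum_Var sum_ideal_def
    by (intro CollectI conjI bexI[of _ 1] lin_in_polys) (simp_all add: lmult_def polys_def zero_in_monomials)
  ultimately have G: "?G \<subseteq> sum_ideal n (\<lambda>_. m)" by auto
  then have Gc: "?G \<subseteq> carrier (mpoly_ring n)" unfolding carrier_mpoly_ring by (auto simp: sum_ideal_def)
  have J: "ideal ?J (mpoly_ring n)" by (rule R.genideal_ideal[OF Gc])
  have gens: "?G \<subseteq> ?J" by (rule R.genideal_self[OF Gc])
  then have "(\<Sum>i=1..n. Var i) \<in> ?J" by blast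
  then have lin_J: "lin n (\<lambda>_. 1) \<in> ?J" by (simp only: sum_Var)
  show ?thesis
  proof
    show "?J \<subseteq> sum_ideal n (\<lambda>_. m)" by (rule R.genideal_minimal[OF ideal_sum_ideal G])
    show "sum_ideal n (\<lambda>_. m) \<subseteq> ?J"
    proof
      fix f :: "'a mpoly" assume "f \<in> sum_ideal n (\<lambda>_. m)"
      then obtain g where f: "f \<in> polys (monomials n)" and g: "g \<in> polys (monomials n)"
          "restr (box n (\<lambda>_. m)) f = restr (box n (\<lambda>_. m)) (lin n (\<lambda>_. 1) * g)"
        by (auto simp: sum_ideal_def lmult_def)
      have lg: "lin n (\<lambda>_. 1) * g \<in> polys (monomials n)" by (rule mult_in_polys_monomials[OF lin_in_polys g(1)])
      have "f - lin n (\<lambda>_. 1) * g \<in> box_ideal n (\<lambda>_. m)"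
        using f lg g(2) by (auto simp: box_ideal_def restr_eq_0_iff restr_eq_iff polys_iff lookup_minus)
      moreover have "box_ideal n (\<lambda>_. m) \<subseteq> ?J" using gens by (intro box_ideal_subset[OF J]) auto
      moreover have "g * lin n (\<lambda>_. 1) \<in> ?J"
        by (rule ideal_mpoly_ringD(4)[OF J g(1) lin_J])
      ultimately have "f - lin n (\<lambda>_. 1) * g + g * lin n (\<lambda>_. 1) \<in> ?J"
        by (intro ideal_mpoly_ringD(3)[OF J]) auto
      then show "f \<in> ?J" by (simp add: mult.commute)
    qed
  qed
qed

lemma leading_monomials_sum_ideal:
  fixes M :: "nat \<Rightarrow> nat"
  assumes ord: "monomial_ordering n r"
  shows "leading_monomial r ` (sum_ideal n M - {0 :: 'a::field mpoly})
    = (monomials n - box n M) \<union> (\<Union>d. leads r (lmult n M (\<lambda>_. 1 :: 'a) ` polys (box_deg n M d)))"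
    (is "?L = ?R")
proof (intro equalityI subsetI)
  fix t assume "t \<in> ?L"
  then obtain f :: "'a mpoly" where f: "f \<in> sum_ideal n M" "f \<noteq> 0" "t = leading_monomial r f" by auto
  then obtain g where fP: "keys f \<subseteq> monomials n" and g: "restr (box n M) f = lmult n M (\<lambda>_. 1) g"
    by (auto simp: sum_ideal_def polys_def)
  have t: "t \<in> keys f" "\<And>s. s \<in> keys f \<Longrightarrow> (s, t) \<in> r"
    using leading_monomial[OF ord fP f(2)] f(3) by auto
  have fg: "lookup f s = (\<Sum>i=1..n. if lookup s i = 0 then 0 else 1 * lookup g (s - ev i))" if "s \<in> box n M" for s
    using arg_cong[OF g, of "\<lambda>f. lookup f s"] that by (simp add: lookup_lmult)
  show "t \<in> ?R"
  proof (cases "t \<in> box n M")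
    case True
    have "t \<noteq> 0" using fg[OF True] t(1) by (auto simp: in_keys_iff)
    then obtain i where i: "lookup t i \<noteq> 0" by (metis keys_eq_empty not_in_keys_iff_lookup_eq_zero all_not_in_conv)
    define d where "d = monom_degree (t - ev i)"
    have d: "monom_degree t = Suc d" using monom_degree_minus_single[OF i] by (simp add: d_def)
    \<comment> \<open>The ordering need not refine the degree, but \<open>t\<close> remains the
      largest monomial when \<open>f\<close> is cut down to the box and to the degree of
      \<open>t\<close>; the result is the image of the degree \<open>d\<close> part of
      \<open>g\<close>.\<close>
    define u where "u = lmult n M (\<lambda>_. 1) (restr (box_deg n M d) g)"
    have u: "lookup u s = (if monom_degree s = Suc d then lookup f s else 0)" if s: "s \<in> box n M" for s
    proof -
      have "(if lookup s i = 0 then 0 else 1 * lookup (restr (box_deg n M d) g) (s - ev i))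
        = (if monom_degree s = Suc d then (if lookup s i = 0 then 0 else 1 * lookup g (s - ev i)) else 0)" for i
        using monom_degree_minus_single[of s i] minus_single_box[OF s, of i] by (auto simp: box_deg_def)
      then show ?thesis using s fg[OF s] by (simp add: u_def lookup_lmult cong: if_cong)
    qed
    have "u \<in> lmult n M (\<lambda>_. 1) ` polys (box_deg n M d)" by (simp add: u_def)
    moreover have "t \<in> keys u" using u[OF True] d t(1) by (simp add: in_keys_iff)
    moreover have "(s, t) \<in> r" if "s \<in> keys u" for s
    proof -
      have "s \<in> box n M" using that by (auto simp: u_def in_keys_iff lookup_lmult split: if_splits)
      then show ?thesis using u[of s] that by (intro t(2)) (auto simp: in_keys_iff split: if_splits)
    qed
    ultimately show ?thesis by (auto simp: leads_def)
  qed (use t(1) fP in auto)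
next
  fix t assume "t \<in> ?R"
  then consider "t \<in> monomials n - box n M" | d where "t \<in> leads r (lmult n M (\<lambda>_. 1 :: 'a) ` polys (box_deg n M d))" by auto
  then show "t \<in> ?L"
  proof cases
    case 1
    have "leading_monomial r (single t (1 :: 'a)) = t"
      using 1 by (intro leading_monomial_eqI[OF ord]) (auto simp: monomial_ordering_refl[OF ord])
    moreover have "single t (1 :: 'a) \<in> sum_ideal n M"
      using 1 unfolding sum_ideal_def
      by (intro CollectI conjI bexI[of _ 0]) (auto simp: single_in_polys restr_eq_0_iff lookup_single when_def)
    moreover have "single t (1 :: 'a) \<noteq> 0" by (metis keys_single keys_zero insert_not_empty zero_neq_one)
    ultimately show ?thesis by (intro image_eqI[of _ _ "single t 1"]) auto
  next
    case 2
    then obtain g :: "'a mpoly" where g: "g \<in> polys (box_deg n M d)" "t \<in> keys (lmult n M (\<lambda>_. 1) g)"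
      "\<And>s. s \<in> keys (lmult n M (\<lambda>_. 1) g) \<Longrightarrow> (s, t) \<in> r"
      by (auto simp: leads_def)
    have box: "lmult n M (\<lambda>_. 1) g \<in> polys (box n M)" by (simp add: lmult_def)
    have "g \<in> polys (monomials n)" "lmult n M (\<lambda>_. 1) g \<in> polys (monomials n)"
      using box g(1) box_subset(1)[of n M] box_subset(2)[of n M d] by (auto simp: polys_def)
    then have "lmult n M (\<lambda>_. 1) g \<in> sum_ideal n M"
      using box unfolding sum_ideal_def by (intro CollectI conjI bexI[of _ g]) auto
    moreover have "lmult n M (\<lambda>_. 1) g \<noteq> 0" using g(2) by auto
    moreover have "leading_monomial r (lmult n M (\<lambda>_. 1) g) = t" by (rule leading_monomial_eqI[OF ord g(2,3)])
    ultimately show ?thesis by (intro image_eqI[of _ _ "lmult n M (\<lambda>_. 1) g"]) auto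
  qed
qed

section \<open>The graded quotient ring and its multiplication maps\<close>

lemma coset_box_ideal:
  fixes f :: "'a::comm_ring_1 mpoly"
  assumes "f \<in> polys (monomials n)"
  shows "box_ideal n M +>\<^bsub>mpoly_ring n\<^esub> f = {g \<in> polys (monomials n). restr (box n M) g = restr (box n M) f}"
proof -
  have "box_ideal n M +>\<^bsub>mpoly_ring n\<^esub> f = (\<lambda>h. h + f) ` box_ideal n M"
    by (auto simp: a_r_coset_def')
  also have "\<dots> = {g \<in> polys (monomials n). restr (box n M) g = restr (box n M) f}"
  proof (intro equalityI subsetI)
    fix g assume "g \<in> {g \<in> polys (monomials n). restr (box n M) g = restr (box n M) f}"
    then have "g - f \<in> box_ideal n M"
      using assms by (auto simp: box_ideal_def polys_iff lookup_minus restr_eq_0_iff restr_eq_iff)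
    then show "g \<in> (\<lambda>h. h + f) ` box_ideal n M" by (intro image_eqI[of _ _ "g - f"]) auto
  qed (use assms in \<open>auto simp: box_ideal_def restr_add add_in_polys\<close>)
  finally show ?thesis .
qed

lemma homogeneous_eq: "homogeneous n d = polys {t \<in> monomials n. monom_degree t = d}"
  by (auto simp: homogeneous_def polys_def)

lemma monom_degree_1:
  assumes "t \<in> monomials n" "monom_degree t = 1"
  shows "\<exists>i\<in>{1..n}. t = ev i"
proof -
  have "t \<noteq> 0" using assms(2) by auto
  then obtain i where i: "lookup t i \<noteq> 0" by (metis keys_eq_empty not_in_keys_iff_lookup_eq_zero all_not_in_conv)
  then have "monom_degree (t - ev i) = 0" using monom_degree_minus_single[OF i] assms(2) by simp
  then have "t - ev i = 0" by simp
  then have "t = ev i" using add_single_add_minus[OF i] by simp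
  then show ?thesis using assms(1) by auto
qed

lemma linear_form_eq_lin:
  assumes "l \<in> homogeneous n 1"
  shows "l = lin n (\<lambda>i. lookup l (ev i))"
proof (rule poly_mapping_eqI)
  fix t
  have ev_inj: "ev i = ev j \<longleftrightarrow> i = j" for i j by (metis keys_ev singleton_inject)
  have "lookup (lin n (\<lambda>i. lookup l (ev i))) t = (\<Sum>i=1..n. if ev i = t then lookup l (ev i) else 0)"
    by (simp add: lin_def ev_def[symmetric] lookup_sum lookup_single when_def)
  also have "\<dots> = lookup l t"
  proof (cases "\<exists>i\<in>{1..n}. t = ev i")
    case True
    then show ?thesis by (auto simp: ev_inj sum.delta)
  next
    case False
    then have "lookup l t = 0"
      using assms monom_degree_1[of t n] unfolding homogeneous_eq by (intro polys_lookup_eq_0) auto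
    moreover have "(\<Sum>i=1..n. if ev i = t then lookup l (ev i) else 0) = 0"
      using False by (intro sum.neutral) auto
    ultimately show ?thesis by simp
  qed
  finally show "lookup l t = lookup (lin n (\<lambda>i. lookup l (ev i))) t" by simp
qed

lemma lin_homogeneous: "lin n c \<in> homogeneous n 1"
  unfolding homogeneous_eq polys_iff lin_def ev_def[symmetric]
  by (auto simp: lookup_sum lookup_single when_def intro!: sum.neutral)

text \<open>Taking cosets is injective on truncated polynomials, matches the homogeneous components
  and turns multiplication by the class of a linear form into \<open>lmult\<close>.\<close>

lemma weak_lefschetz_property_iff:
  "weak_lefschetz_property n (box_ideal n M :: 'a::field mpoly set) \<longleftrightarrow> (\<exists>c :: nat \<Rightarrow> 'a. lefschetz n M c)"
proof -
  define I where "I = (box_ideal n M :: 'a mpoly set)"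
  define \<psi> where "\<psi> f = I +>\<^bsub>mpoly_ring n\<^esub> f" for f
  interpret I: ideal I "mpoly_ring n" unfolding I_def by (rule ideal_box_ideal)
  let ?P = "polys (monomials n) :: 'a mpoly set"
  let ?V = "\<lambda>d. polys (box_deg n M d) :: 'a mpoly set"
  have psi_iff: "\<psi> f = \<psi> g \<longleftrightarrow> restr (box n M) f = restr (box n M) g" if "f \<in> ?P" "g \<in> ?P" for f g
  proof -
    have "\<psi> f = \<psi> g \<longleftrightarrow> f \<in> \<psi> g"
      using that by (auto simp: \<psi>_def I_def coset_box_ideal)
    then show ?thesis using that by (auto simp: \<psi>_def I_def coset_box_ideal)
  qed
  have box_P: "polys (box n M) \<subseteq> ?P" using box_subset(1)[of n M] by (auto simp: polys_def)
  have V_box: "?V d \<subseteq> polys (box n M)" for d by (auto simp: polys_def box_deg_def)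
  have inj: "inj_on \<psi> (polys (box n M))"
    using box_P by (intro inj_onI) (auto simp: psi_iff subset_iff)
  have psi_restr: "\<psi> (restr (box n M) f) = \<psi> f" if "f \<in> ?P" for f
    using box_P that by (subst psi_iff) auto
  have comp: "quot_component n I d = \<psi> ` ?V d" for d
  proof -
    have "quot_component n I d = \<psi> ` homogeneous n d" by (simp add: quot_component_def \<psi>_def)
    also have "\<dots> = \<psi> ` ?V d"
    proof (intro equalityI subsetI)
      fix y assume "y \<in> \<psi> ` homogeneous n d"
      then obtain f where f: "f \<in> homogeneous n d" "y = \<psi> f" by auto
      have "f \<in> ?P" using f(1) by (auto simp: homogeneous_eq polys_def)
      then have "y = \<psi> (restr (box n M) f)" using f(2) psi_restr by simp
      moreover have "restr (box n M) f \<in> ?V d"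
        using f(1) by (auto simp: homogeneous_eq polys_iff box_deg_def)
      ultimately show "y \<in> \<psi> ` ?V d" by blast
    next
      have "?V d \<subseteq> homogeneous n d" by (auto simp: homogeneous_eq polys_def box_deg_def box_def)
      then show "y \<in> \<psi> ` homogeneous n d" if "y \<in> \<psi> ` ?V d" for y using that by blast
    qed
    finally show ?thesis .
  qed
  have mult: "\<psi> (lin n c) \<otimes>\<^bsub>mpoly_ring n Quot I\<^esub> \<psi> f = \<psi> (lmult n M c f)" if "f \<in> ?P" for f c
  proof -
    have "\<psi> (lin n c) \<otimes>\<^bsub>mpoly_ring n Quot I\<^esub> \<psi> f = \<psi> (lin n c * f)"
      using I.rcoset_mult_add[of "lin n c" f] that lin_in_polys[of n c]
      by (simp add: FactRing_def \<psi>_def carrier_mpoly_ring del: mpoly_ring_simps(1))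
    also have "\<dots> = \<psi> (lmult n M c f)"
      unfolding lmult_def by (rule psi_restr[symmetric]) (rule mult_in_polys_monomials[OF lin_in_polys that])
    finally show ?thesis .
  qed
  have key: "(let \<mu> = (\<lambda>a. (I +>\<^bsub>mpoly_ring n\<^esub> lin n c) \<otimes>\<^bsub>mpoly_ring n Quot I\<^esub> a) in
      inj_on \<mu> (quot_component n I d) \<or> \<mu> ` quot_component n I d = quot_component n I (d + 1))
    \<longleftrightarrow> inj_on (lmult n M c) (?V d) \<or> lmult n M c ` ?V d = ?V (Suc d)" for c d
  proof -
    define \<mu> where "\<mu> = (\<lambda>a. (I +>\<^bsub>mpoly_ring n\<^esub> lin n c) \<otimes>\<^bsub>mpoly_ring n Quot I\<^esub> a)"
    have mu: "\<mu> (\<psi> f) = \<psi> (lmult n M c f)" if "f \<in> ?V d" for f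
      using mult[of f c] that V_box box_P by (auto simp: \<mu>_def \<psi>_def)
    have EV: "lmult n M c ` ?V d \<subseteq> polys (box n M)" by (auto simp: lmult_def)
    have "inj_on \<mu> (\<psi> ` ?V d) \<longleftrightarrow> inj_on (\<mu> \<circ> \<psi>) (?V d)"
      by (rule comp_inj_on_iff) (rule inj_on_subset[OF inj V_box])
    also have "\<dots> \<longleftrightarrow> inj_on (\<psi> \<circ> lmult n M c) (?V d)"
      by (rule inj_on_cong) (simp add: mu)
    also have "\<dots> \<longleftrightarrow> inj_on (lmult n M c) (?V d)"
      using inj_on_subset[OF inj EV] by (metis comp_inj_on inj_on_imageI2)
    finally have 1: "inj_on \<mu> (\<psi> ` ?V d) \<longleftrightarrow> inj_on (lmult n M c) (?V d)" .
    have "\<mu> ` \<psi> ` ?V d = \<psi> ` lmult n M c ` ?V d" by (auto simp: image_image mu)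
    then have "\<mu> ` \<psi> ` ?V d = \<psi> ` ?V (Suc d) \<longleftrightarrow> lmult n M c ` ?V d = ?V (Suc d)"
      using inj_on_image_eq_iff[OF inj EV V_box] by simp
    then show ?thesis using 1 unfolding Let_def \<mu>_def[symmetric] comp by simp
  qed
  have "weak_lefschetz_property n I \<longleftrightarrow> (\<exists>c. \<forall>d. let \<mu> = (\<lambda>a. (I +>\<^bsub>mpoly_ring n\<^esub> lin n c) \<otimes>\<^bsub>mpoly_ring n Quot I\<^esub> a) in
      inj_on \<mu> (quot_component n I d) \<or> \<mu> ` quot_component n I d = quot_component n I (d + 1))"
    unfolding weak_lefschetz_property_def using lin_homogeneous linear_form_eq_lin by metis
  also have "\<dots> \<longleftrightarrow> (\<exists>c :: nat \<Rightarrow> 'a. lefschetz n M c)" unfolding key lefschetz_def ..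
  finally show ?thesis unfolding I_def .
qed

lemma lefschetz_char_0: "lefschetz n M (\<lambda>_. 1 :: 'a::field_char_0)"
  unfolding lefschetz_def
proof
  fix d
  consider "2 * d < socle_degree n M" | "2 * Suc d > socle_degree n M"
    by (cases "2 * d < socle_degree n M") auto
  then show "inj_on (lmult n M (\<lambda>_. 1 :: 'a)) (polys (box_deg n M d)) \<or>
      lmult n M (\<lambda>_. 1 :: 'a) ` polys (box_deg n M d) = polys (box_deg n M (Suc d))"
    using char_0_injective char_0_surjective by cases blast+
qed

section \<open>Comparison of the leading monomials over the two fields\<close>

lemma card_leads_lmult:
  assumes "monomial_ordering n r"
  shows "card (leads r (lmult n M c ` polys (box_deg n M d))) = mp.dim (lmult n M c ` polys (box_deg n M d))"
  by (rule card_leads[OF assms subspace_image_polys[OF mlinear_lmult], of _ _ _ _ "box_deg n M (Suc d)"])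
    (auto intro: lmult_in_polys box_subset(2)[THEN subsetD])

text \<open>Ballot monomials are excluded, so it remains to count. A surjective map gives as many
  leading monomials as degree d + 1 has monomials, an injective one as many as degree d has. The
  latter number is that of the non-ballot monomials up to the middle, and past it at least the size
  of degree d + 1.\<close>

lemma leads_lmult_eq:
  assumes ord: "monomial_ordering n r" and var: "\<And>i j. 1 \<le> i \<Longrightarrow> i < j \<Longrightarrow> j \<le> n \<Longrightarrow> (ev j, ev i) \<in> r"
    and char: "\<And>i k. i \<in> {1..n} \<Longrightarrow> 0 < k \<Longrightarrow> k < M i \<Longrightarrow> (of_nat k :: 'a::field) \<noteq> 0"
    and M: "\<And>i. i \<in> {1..n} \<Longrightarrow> M i \<ge> 1"
    and lef: "lefschetz n M (\<lambda>_. 1 :: 'a)"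
  shows "leads r (lmult n M (\<lambda>_. 1 :: 'a) ` polys (box_deg n M d)) = box_deg n M (Suc d) - ballot_deg n M (Suc d)"
proof -
  define U where "U = lmult n M (\<lambda>_. 1 :: 'a) ` polys (box_deg n M d)"
  define B where "B = box_deg n M (Suc d)"
  define S where "S = ballot_deg n M (Suc d)"
  have UB: "U \<subseteq> polys B" by (auto simp: U_def B_def intro: lmult_in_polys)
  have sub: "leads r U \<subseteq> B - S"
    using leads_polys_subset[OF UB] ballot_not_leading[OF ord var char] by (auto simp: U_def S_def)
  have card: "card (leads r U) = mp.dim U" unfolding U_def by (rule card_leads_lmult[OF ord])
  have finB: "finite B" by (simp add: B_def)
  have SB: "S \<subseteq> B" by (auto simp: S_def B_def ballot_deg_def)
  then have cBS: "card (B - S) + card S = card B"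
    using finB by (metis card_Diff_subset card_mono finite_subset le_add_diff_inverse2)
  have "card (B - S) \<le> card (leads r U)"
  proof (cases "U = polys B")
    case True
    then have "card (leads r U) = card B" by (metis card dim_polys finB)
    then show ?thesis using cBS by simp
  next
    case False
    then have "inj_on (lmult n M (\<lambda>_. 1 :: 'a)) (polys (box_deg n M d))"
      using lef unfolding lefschetz_def U_def B_def by blast
    then have dim: "card (leads r U) = card (box_deg n M d)"
      unfolding card unfolding U_def by (simp add: inj_on_polys_iff_dim[OF mlinear_lmult])
    show ?thesis
    proof (cases "2 * Suc d \<le> socle_degree n M + 1")
      case True
      then have "card S + card (box_deg n M d) = card B" unfolding S_def B_def by (intro card_box_deg_Suc(1) M)
      then show ?thesis using cBS dim by simp
    next
      case False
      then have "card B \<le> card (box_deg n M d)" unfolding B_def by (intro card_box_deg_Suc(2) M) auto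
      then show ?thesis using cBS dim by simp
    qed
  qed
  then have "leads r U = B - S" using sub finB by (intro card_seteq) auto
  then show ?thesis by (simp add: U_def B_def S_def)
qed

theorem theorem5p14:
  fixes p m n :: nat and r :: "monomial rel"
  assumes "CHAR('k::field) = p" and "p > 0"
    and "m \<ge> 2" and "n \<ge> 5"
    and "monomial_ordering n r"
    and "\<And>i j. 1 \<le> i \<Longrightarrow> i < j \<Longrightarrow> j \<le> n \<Longrightarrow>
           (Poly_Mapping.single j 1, Poly_Mapping.single i 1) \<in> r"
  shows "weak_lefschetz_property n
           (Idl\<^bsub>mpoly_ring n\<^esub> {Var i ^ m |i. i \<in> {1..n}} :: 'k mpoly set)
     \<longleftrightarrow> monomials_in n (initial_ideal n r
           (Idl\<^bsub>mpoly_ring n\<^esub> ({Var i ^ m |i. i \<in> {1..n}} \<union> {\<Sum>i=1..n. Var i}) :: 'k mpoly set))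
       = monomials_in n (initial_ideal n r
           (Idl\<^bsub>mpoly_ring n\<^esub> ({Var i ^ m |i. i \<in> {1..n}} \<union> {\<Sum>i=1..n. Var i})
             :: 'l::field_char_0 mpoly set))"
proof -
  define M where "M = (\<lambda>_ :: nat. m)"
  define U where "U d = lmult n M (\<lambda>_. 1 :: 'k) ` polys (box_deg n M d)" for d
  define U0 where "U0 d = lmult n M (\<lambda>_. 1 :: 'l) ` polys (box_deg n M d)" for d
  note ord = assms(5)
  have var: "(ev j, ev i) \<in> r" if "1 \<le> i" "i < j" "j \<le> n" for i j
    unfolding ev_def using that by (rule assms(6))
  have "U d \<subseteq> polys (box_deg n M (Suc d))" "U0 d \<subseteq> polys (box_deg n M (Suc d))" for d
    by (auto simp: U_def U0_def intro: lmult_in_polys)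
  then have sub: "leads r (U d) \<subseteq> box_deg n M (Suc d)" "leads r (U0 d) \<subseteq> box_deg n M (Suc d)" for d
    by (simp_all only: leads_polys_subset)
  have eq_iff: "(monomials n - box n M) \<union> (\<Union>d. leads r (U d)) = (monomials n - box n M) \<union> (\<Union>d. leads r (U0 d))
      \<longleftrightarrow> (\<forall>d. leads r (U d) = leads r (U0 d))" (is "?X = ?Y \<longleftrightarrow> _")
  proof
    assume eq: "?X = ?Y"
    \<comment> \<open>The sets in the union have different degrees, so intersecting with a degree
      recovers each of them.\<close>
    have "?X \<inter> box_deg n M (Suc d) = leads r (U d)" "?Y \<inter> box_deg n M (Suc d) = leads r (U0 d)" for d
      using sub by (auto simp: box_deg_def subset_iff)
    then show "\<forall>d. leads r (U d) = leads r (U0 d)" using eq by metis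
  qed simp
  have "weak_lefschetz_property n (box_ideal n M :: 'k mpoly set) \<longleftrightarrow> (\<forall>d. leads r (U d) = leads r (U0 d))"
    unfolding weak_lefschetz_property_iff
  proof
    assume "\<exists>c :: nat \<Rightarrow> 'k. lefschetz n M c"
    then obtain c :: "nat \<Rightarrow> 'k" where c: "lefschetz n M c" by auto
    \<comment> \<open>A characteristic below m is incompatible with the property; otherwise all
      positive k < m are invertible, as the exclusion of the ballot monomials requires.\<close>
    have "m \<le> p"
      using char_less_imp_not_lefschetz[of n m c] c assms(1,2,4) unfolding M_def by (metis not_le)
    then have char: "(of_nat k :: 'k) \<noteq> 0" if "0 < k" "k < M i" for k i
      using that assms(1) by (auto simp: M_def of_nat_eq_0_iff_char_dvd dest: dvd_imp_le)
    have "leads r (U d) = box_deg n M (Suc d) - ballot_deg n M (Suc d)" for d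
      unfolding U_def using assms(3)
      by (intro leads_lmult_eq[OF ord var] char lefschetz_sum_of_variables[OF c]) (auto simp: M_def)
    moreover have "leads r (U0 d) = box_deg n M (Suc d) - ballot_deg n M (Suc d)" for d
      unfolding U0_def using assms(3)
      by (intro leads_lmult_eq[OF ord var] lefschetz_char_0) (auto simp: M_def)
    ultimately show "\<forall>d. leads r (U d) = leads r (U0 d)" by simp
  next
    assume leads: "\<forall>d. leads r (U d) = leads r (U0 d)"
    \<comment> \<open>The rank is the number of leading monomials, so the ranks agree with those
      over the field of characteristic zero, which are maximal.\<close>
    have dim: "mp.dim (U d) = mp.dim (U0 d)" for d
      using leads card_leads_lmult[OF ord] unfolding U_def U0_def by metis
    have "inj_on (lmult n M (\<lambda>_. 1 :: 'k)) (polys (box_deg n M d)) \<or> U d = polys (box_deg n M (Suc d))" for d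
    proof -
      consider "inj_on (lmult n M (\<lambda>_. 1 :: 'l)) (polys (box_deg n M d))" | "U0 d = polys (box_deg n M (Suc d))"
        using lefschetz_char_0[of n M, where 'a = 'l] by (auto simp: lefschetz_def U0_def)
      then show ?thesis
      proof cases
        case 1
        then have "mp.dim (U0 d) = card (box_deg n M d)" by (simp add: U0_def inj_on_polys_iff_dim[OF mlinear_lmult])
        then show ?thesis using dim by (simp add: U_def inj_on_polys_iff_dim[OF mlinear_lmult])
      next
        case 2
        then have "mp.dim (U d) = card (box_deg n M (Suc d))" by (simp add: dim dim_polys)
        then have "U d = polys (box_deg n M (Suc d))"
          unfolding U_def by (intro subspace_full subspace_image_polys mlinear_lmult) (auto intro: lmult_in_polys)
        then show ?thesis by simp
      qed
    qed
    then show "\<exists>c :: nat \<Rightarrow> 'k. lefschetz n M c" unfolding lefschetz_def U_def by blast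
  qed
  then show ?thesis
    unfolding Idl_powers Idl_powers_sum monomials_in_initial_ideal[OF ord ideal_sum_ideal]
      leading_monomials_sum_ideal[OF ord] M_def[symmetric] U_def[symmetric] U0_def[symmetric] eq_iff .
qed

end
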